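(* Fix $\varepsilon>0$ (small) and $C\ge 10$. Let $N\ge 1$ be sufficiently large. Set $\rho_{+}=\frac25-\varepsilon$, $\rho_{-}=\frac37-\varepsilon$, and let $z_{+}\le N^{1/2}$, $z_{-}\le N^{1/3-\varepsilon}$. Define $$\mathcal{D}^{+}=\{p_1\cdots p_r\le N^{\rho_{+}}:\ z_{+}\ge p_1>\dots>p_r,\ p_1\cdots p_{2k-2}p_{2k-1}^2\le N^{\rho_{+}}\text{ for all }k\ge 1\},$$ $$\mathcal{D}^{-}=\{p_1\cdots p_r\le N^{\rho_{-}}:\ z_{-}\ge p_1>\dots>p_r,\ p_1\cdots p_{2k-1}p_{2k}^2\le N^{\rho_{-}}\text{ for all }k\ge 1\},$$ (the $p_i$ primes; conditions involving indices exceeding $r$ are vacuous), and let $\lambda_d^{\pm}=\mu(d)$ if $d\in\mathcal{D}^{\pm}$ and $\lambda_d^{\pm}=0$ otherwise (the upper/lower bound semilinear sieve weights). Let $\alpha\in\mathbb{R}$ satisfy $|\alpha-\frac aq|\le\frac1{q^2}$ for some coprime integers $a,q$ with $q\in[(\log N)^{1000C},N(\log N)^{-1000C}]$. Then for any integer $b\neq0$, choosing either the $+$ sign throughout or the $-$ sign throughout, $$\sum_{\substack{d\le N^{\rho_{\pm}}\\(d,b)=1}}\Bigg|\lambda_d^{\pm}\sum_{\substack{N\le n<2N\\ n\equiv b\ (\mathrm{mod}\ d)}}\Lambda(n)e(\alpha n)\Bigg|\ll \frac{N}{(\log N)^{C}},$$ where the implied constant may depend on $\varepsilon$ and $C$.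
   Context: $\Lambda$ is the von Mangoldt function, $\mu$ the Möbius function, and $e(t)=e^{2\pi i t}$. *)

theory Defs
  imports "HOL-Analysis.Analysis" "HOL-Number_Theory.Number_Theory" "HOL-Computational_Algebra.Squarefree"
begin

definition moebius_mu :: "nat \<Rightarrow> int" where
  "moebius_mu n = (if n = 0 \<or> \<not> squarefree n then 0 else (-1) ^ card (prime_factors n))"

definition e_char :: "real \<Rightarrow> complex" where
  "e_char t = exp (2 * of_real pi * \<i> * of_real t)"

text \<open>Semilinear sieve support sets.  A list ps = [p_1,...,p_r] of primes,
  strictly decreasing, with p_1 \<le> z.  The extra condition is imposed at
  (1-based) positions j of a given parity:
    upper sign (+): j odd  (j = 2k-1):  p_1...p_{2k-2} p_{2k-1}^2 \<le> N^rho,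
    lower sign (-): j even (j = 2k)  :  p_1...p_{2k-1} p_{2k}^2   \<le> N^rho.
  With 0-based index i = j - 1: upper uses even i, lower uses odd i.\<close>
definition sieve_support :: "bool \<Rightarrow> real \<Rightarrow> real \<Rightarrow> real \<Rightarrow> nat set" where
  "sieve_support upper N rho z =
     {d. \<exists>ps. d = prod_list ps \<and> real d \<le> N powr rho
          \<and> (\<forall>p\<in>set ps. prime p \<and> real p \<le> z)
          \<and> sorted_wrt (>) ps
          \<and> (\<forall>i<length ps. (if upper then even i else odd i) \<longrightarrow>
                real (prod_list (take i ps) * (ps ! i)^2) \<le> N powr rho)}"

definition D_plus :: "real \<Rightarrow> real \<Rightarrow> real \<Rightarrow> nat set" where
  "D_plus \<epsilon> N z = sieve_support True N (2/5 - \<epsilon>) z"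

definition D_minus :: "real \<Rightarrow> real \<Rightarrow> real \<Rightarrow> nat set" where
  "D_minus \<epsilon> N z = sieve_support False N (3/7 - \<epsilon>) z"

definition sieve_weight :: "nat set \<Rightarrow> nat \<Rightarrow> int" where
  "sieve_weight D d = (if d \<in> D then moebius_mu d else 0)"

definition S_ap :: "nat \<Rightarrow> real \<Rightarrow> int \<Rightarrow> nat \<Rightarrow> complex" where
  "S_ap N \<alpha> b d = (\<Sum>n\<in>{n. N \<le> n \<and> n < 2 * N \<and> [int n = b] (mod int d)}.
       mangoldt n * e_char (\<alpha> * real n))"

definition sieve_sum :: "nat set \<Rightarrow> real \<Rightarrow> nat \<Rightarrow> real \<Rightarrow> int \<Rightarrow> real" where
  "sieve_sum D rho N \<alpha> b = (\<Sum>d\<in>{d. 1 \<le> d \<and> real d \<le> real N powr rho \<and> coprime (int d) b}.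
       norm (of_int (sieve_weight D d) * S_ap N \<alpha> b d))"

end

theory Submission
  imports Defs "HOL-Real_Asymp.Real_Asymp"
begin

text \<open>
Vaughan's identity with \<open>U = V = N\<^sup>1\<^sup>/\<^sup>3\<close> leaves type I sums with a variable \<open>m \<le> N\<^sup>1\<^sup>/\<^sup>2\<close> and
type II sums with a variable \<open>m \<in> [M, 2M)\<close>, \<open>N\<^sup>1\<^sup>/\<^sup>2 \<le> M \<le> 2 N\<^sup>2\<^sup>/\<^sup>3\<close>.  The support conditions of the sieves
enter only through \<open>p\<^sub>1\<^sup>2 \<le> N\<^sup>\<rho>\<close> (upper sieve) and \<open>p\<^sub>1 p\<^sub>2\<^sup>2 \<le> N\<^sup>\<rho>\<close> (lower sieve): all prime factors of
\<open>d\<close>, with at most one exception \<open>p \<le> N\<^sup>1\<^sup>/\<^sup>3\<^sup>-\<^sup>\<epsilon>\<close>, are at most \<open>N\<^sup>1\<^sup>-\<^sup>2\<^sup>\<rho>\<close>.  Hence a greedy choice factors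
\<open>d = d\<^sub>1 d\<^sub>2\<close> with \<open>d\<^sub>1 \<le> N/(MQ)\<close> and \<open>d\<^sub>1 d\<^sub>2\<^sup>2 \<le> M/Q\<close> for a large power \<open>Q\<close> of \<open>log N\<close>.
Applying Cauchy-Schwarz with \<open>d\<^sub>1\<close> and \<open>m\<close> outside, the correlations are sums of \<open>e(\<alpha> m (n - n'))\<close> over \<open>m\<close>
in a class modulo \<open>[d, d']\<close>, with \<open>n - n'\<close> divisible by \<open>(d, d')\<close>.  Everything is thereby bounded by
\[ \sum_{d^2 j \le x / Q} d\, \tau(j)^2 \min\Big(\frac{x}{d^2 j}, \frac{1}{\|\alpha d^2 j\|}\Big), \qquad x = 4N, \]
whose terms with \<open>d = 1\<close> control the type I sums.  Small \<open>d\<close> are handled by the classical bound for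
\<open>\<Sum> min(x/n, 1/\<parallel>\<alpha> n\<parallel>)\<close>; for large \<open>d\<close> the minimum is expanded in Fejer kernels and Weyl
differencing in \<open>d\<close> leads back to the classical bound.
\<close>

section \<open>Exponential sums over intervals and progressions\<close>

text \<open>The levels 2/5 and 3/7 come from the factorization. With e = d / d_1 the requirements
  read d e <= M / Q and d / e <= N / (M Q). For d <= N^(rho - eps) and Q <= N^eps they hold for
  every e in the window [M / N^(1 - rho), M / N^rho], whose ends have ratio N^(1 - 2 rho); a greedy
  product of primes up to that size cannot jump over it. From p_1^2 <= N^rho this size is guaranteed
  if rho / 2 <= 1 - 2 rho, that is rho <= 2/5; from p_2^3 <= p_1 p_2^2 <= N^rho if rho / 3 <= 1 - 2
  rho, that is rho <= 3/7. The exceptional prime p may stay in d_1 because M <= 2 N^(2/3).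

  Each use of Cauchy-Schwarz halves the saved exponent of r: r^8 for the plain sum of minima, r^4
  with divisor weights, r^2 after Weyl differencing, r once tau(j)^2 is restored, sqrt r for the
  type II sums. The exponent 24 is 8 + 8 + 8: for d <= r^8 the number of d and the weight d cost r^8
  each, and r^8 is left.\<close>

definition ndist :: "real \<Rightarrow> real" where
  "ndist t = \<bar>t - of_int (round t)\<bar>"

text \<open>\<open>cap H t\<close> is \<open>min H (1 / \<parallel>t\<parallel>)\<close>, written so that it equals \<open>H\<close> at integers, where \<open>1 / 0 = 0\<close> would give 0.\<close>
definition cap :: "real \<Rightarrow> real \<Rightarrow> real" where
  "cap H t = H / max 1 (H * ndist t)"

lemma ndist_nonneg [simp]: "0 \<le> ndist t"
  by (simp add: ndist_def)

lemma ndist_le_half: "ndist t \<le> 1/2"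
  unfolding ndist_def using of_int_round_abs_le[of t] by (simp add: abs_minus_commute)

lemma ndist_le: "ndist t \<le> \<bar>t - of_int n\<bar>"
  unfolding ndist_def using round_diff_minimal[of t n] by simp

lemma ndist_minus: "ndist (- t) = ndist t"
proof -
  have "ndist (- s) \<le> ndist s" for s
    using ndist_le[of "- s" "- round s"] by (simp add: ndist_def)
  from this[of t] this[of "- t"] show ?thesis by simp
qed

lemma cap_nonneg: "0 \<le> H \<Longrightarrow> 0 \<le> cap H t"
  by (simp add: cap_def)

lemma cap_le: assumes "0 \<le> H" shows "cap H t \<le> H"
proof -
  have "H / max 1 (H * ndist t) \<le> H / 1"
    using assms by (intro divide_left_mono) auto
  then show ?thesis by (simp add: cap_def)
qed

lemma cap_mult_ndist_le: "0 \<le> H \<Longrightarrow> cap H t * ndist t \<le> 1"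
  by (simp add: cap_def divide_simps)

text \<open>Together with \<open>cap_le\<close> and \<open>cap_mult_ndist_le\<close> this
  characterizes \<open>cap H t\<close> as the largest s with s <= H and s ||t|| <= 1, so that
  estimates need not unfold the quotient.\<close>

lemma cap_geI:
  assumes "0 \<le> s" "s \<le> H" "s * ndist t \<le> 1"
  shows "s \<le> cap H t"
proof (cases "H * ndist t \<le> 1")
  case True
  then show ?thesis using assms by (simp add: cap_def max_def)
next
  case False
  then have "H \<noteq> 0" "ndist t \<noteq> 0" by auto
  then have "ndist t > 0" using ndist_nonneg[of t] by linarith
  with False assms show ?thesis by (simp add: cap_def max_def field_simps)
qed

lemma cap_mono: "0 \<le> H \<Longrightarrow> H \<le> H' \<Longrightarrow> cap H t \<le> cap H' t"
  by (meson cap_geI cap_le cap_mult_ndist_le cap_nonneg order_trans)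

lemma cap_minus: "cap H (- t) = cap H t"
  by (simp add: cap_def ndist_minus)

lemma e_char_add: "e_char (s + t) = e_char s * e_char t"
  unfolding e_char_def by (simp add: algebra_simps flip: exp_add)

lemma e_char_0 [simp]: "e_char 0 = 1"
  by (simp add: e_char_def)

lemma e_char_cis: "e_char t = cis (2 * pi * t)"
  by (simp add: e_char_def cis_conv_exp mult_ac)

lemma norm_e_char [simp]: "norm (e_char t) = 1"
  by (simp add: e_char_cis)

lemma e_char_of_int [simp]: "e_char (of_int n) = 1"
  unfolding e_char_cis by (rule cis_multiple_2pi) auto

lemma cnj_e_char: "cnj (e_char t) = e_char (- t)"
  by (simp add: e_char_cis cis_cnj)

lemma e_char_mult_of_nat: "e_char (t * of_nat n) = e_char t ^ n"
  unfolding e_char_cis Complex.DeMoivre by (rule arg_cong[of _ _ cis]) (simp add: algebra_simps)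

text \<open>|e(t) - 1| = 2 |sin (pi t)|, and the sine is bounded below by concavity. The constant 2
  turns the bound 2 / |e(t) - 1| for a geometric sum into 1 / ||t||.\<close>

lemma e_char_norm_diff_one: "2 * ndist t \<le> norm (e_char t - 1)"
proof -
  define s where "s = t - of_int (round t)"
  have s: "\<bar>s\<bar> = ndist t" "\<bar>s\<bar> \<le> 1/2" using ndist_le_half[of t] by (auto simp: s_def ndist_def)
  have "t = s + of_int (round t)" by (simp add: s_def)
  then have "e_char t = e_char s" by (metis e_char_add e_char_of_int mult.right_neutral)
  moreover have "norm (e_char s - 1) = 2 * \<bar>sin (pi * s)\<bar>"
    using dist_exp_i_1[of "2 * pi * s"] by (simp add: e_char_def mult_ac)
  moreover have "\<bar>s\<bar> \<le> \<bar>sin (pi * s)\<bar>"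
  proof -
    define y where "y = \<bar>s\<bar>"
    have y: "0 \<le> y" "y \<le> 1/2" using s by (auto simp: y_def)
    have "y \<le> sin (pi * y)"
    proof -
      have cc: "convex_on {0..pi} (\<lambda>x. - sin x)"
        by (rule f''_ge0_imp_convex[where f' = "\<lambda>x. - cos x" and f'' = sin])
          (auto intro!: derivative_eq_intros sin_ge_zero)
      \<comment> \<open>The chord of the sine from 0 to pi/2 gives \<open>2 * y\<close>; half of it
        is enough.\<close>
      have "- sin ((1 - 2*y) *\<^sub>R 0 + (2*y) *\<^sub>R (pi/2)) \<le> (1 - 2*y) * (- sin 0) + (2*y) * (- sin (pi/2))"
        by (rule convex_onD[OF cc]) (use y in auto)
      then have "2 * y \<le> sin (pi * y)" by (simp add: mult.commute)
      with y show ?thesis by linarith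
    qed
    moreover have "sin (pi * y) = \<bar>sin (pi * s)\<bar>"
    proof (cases "s \<ge> 0")
      case True
      have "0 \<le> sin (pi * s)" by (rule sin_ge_zero) (use True s in auto)
      then show ?thesis using True by (simp add: y_def)
    next
      case False
      have "pi * (- s) \<le> pi * 1" by (rule mult_left_mono) (use False s in auto)
      then have "0 \<le> sin (pi * (- s))" by (intro sin_ge_zero) (use False in \<open>auto simp: mult_nonneg_nonpos\<close>)
      then show ?thesis using False by (simp add: y_def)
    qed
    ultimately show ?thesis by (simp add: y_def)
  qed
  ultimately show ?thesis using s by simp
qed

text \<open>Trivial bound and geometric series. The offset \<open>c\<close> absorbs the constant
  phases that substitutions and differencing leave behind.\<close>

lemma norm_sum_e_char_le_cap:
  fixes u v :: nat
  assumes "real v - real u \<le> H" "0 \<le> H"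
  shows "norm (\<Sum>k=u..<v. e_char (t * real k + c)) \<le> cap H t"
proof (cases "u \<le> v")
  case False
  then show ?thesis using assms by (simp add: cap_nonneg)
next
  case True
  let ?S = "\<Sum>k=u..<v. e_char t ^ k"
  have S: "norm (\<Sum>k=u..<v. e_char (t * real k + c)) = norm ?S"
    by (simp add: e_char_add e_char_mult_of_nat norm_mult flip: sum_distrib_right)
  have "norm ?S \<le> (\<Sum>k=u..<v. norm (e_char t ^ k))" by (rule norm_sum)
  also have "\<dots> = real v - real u" using True by (simp add: norm_power)
  finally have 1: "norm ?S \<le> H" using assms by linarith
  have "(e_char t - 1) * ?S = e_char t ^ v - e_char t ^ u"
    using True by (induction v rule: dec_induct) (simp_all add: algebra_simps)
  then have "norm (e_char t - 1) * norm ?S = norm (e_char t ^ v - e_char t ^ u)"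
    by (metis norm_mult)
  also have "\<dots> \<le> norm (e_char t ^ v) + norm (e_char t ^ u)" by (rule norm_triangle_ineq4)
  also have "\<dots> = 2" by (simp add: norm_power)
  finally have "norm (e_char t - 1) * norm ?S \<le> 2" .
  moreover have "2 * ndist t * norm ?S \<le> norm (e_char t - 1) * norm ?S"
    by (intro mult_right_mono e_char_norm_diff_one) auto
  ultimately have "norm ?S * ndist t \<le> 1" by (simp add: mult_ac)
  then show ?thesis unfolding S using 1 by (intro cap_geI) auto
qed

text \<open>Under m = r + W k the class becomes an interval of k and the frequency is multiplied by
  W; the summand 1 in the bound for H pays for the rounding of the number of k.\<close>

lemma norm_sum_e_char_cong_le_cap:
  fixes u v W m0 :: nat
  assumes W: "0 < W" and H: "(real v - real u) / real W + 1 \<le> H" "0 \<le> H"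
  shows "norm (\<Sum>m\<in>{m\<in>{u..<v}. [m = m0] (mod W)}. e_char (t * real m)) \<le> cap H (t * real W)"
proof -
  let ?A = "{m\<in>{u..<v}. [m = m0] (mod W)}"
  define r where "r = m0 mod W"
  have rW: "r < W" using W by (simp add: r_def)
  have mem: "r + W * k \<in> ?A \<longleftrightarrow> u \<le> r + W * k \<and> r + W * k < v" for k
    by (auto simp: r_def cong_def)
  \<comment> \<open>\<open>r + W * k\<close> increases with k, so comparing it with u or v is the
    same as comparing k with these least elements.\<close>
  define u' where "u' = (LEAST k. u \<le> r + W * k)"
  define v' where "v' = (LEAST k. v \<le> r + W * k)"
  have ex: "\<exists>k. x \<le> r + W * k" for x
    using W mult_le_mono1[of 1 W x] by (intro exI[of _ x]) linarith
  have u': "u \<le> r + W * k \<longleftrightarrow> u' \<le> k" for k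
  proof
    assume "u \<le> r + W * k" then show "u' \<le> k" unfolding u'_def by (rule Least_le)
  next
    assume "u' \<le> k"
    moreover have "u \<le> r + W * u'" unfolding u'_def by (rule LeastI_ex[OF ex])
    ultimately show "u \<le> r + W * k" by (meson add_left_mono le_trans mult_le_mono2)
  qed
  have v': "v \<le> r + W * k \<longleftrightarrow> v' \<le> k" for k
  proof
    assume "v \<le> r + W * k" then show "v' \<le> k" unfolding v'_def by (rule Least_le)
  next
    assume "v' \<le> k"
    moreover have "v \<le> r + W * v'" unfolding v'_def by (rule LeastI_ex[OF ex])
    ultimately show "v \<le> r + W * k" by (meson add_left_mono le_trans mult_le_mono2)
  qed
  have A: "?A = (\<lambda>k. r + W * k) ` {u'..<v'}"
  proof (intro equalityI subsetI)
    fix m assume m: "m \<in> ?A"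
    have "m = r + W * (m div W)" using m mod_mult_div_eq[of m W] by (simp add: r_def cong_def)
    moreover from this m have "u \<le> r + W * (m div W)" "\<not> v \<le> r + W * (m div W)" by auto
    then have "m div W \<in> {u'..<v'}" unfolding u' v' by auto
    ultimately show "m \<in> (\<lambda>k. r + W * k) ` {u'..<v'}" by (rule image_eqI)
  next
    fix m assume "m \<in> (\<lambda>k. r + W * k) ` {u'..<v'}"
    then obtain k where k: "m = r + W * k" "u' \<le> k" "\<not> v' \<le> k"
      by (metis (no_types, lifting) atLeastLessThan_iff imageE linorder_not_le)
    with u'[of k] v'[of k] show "m \<in> ?A" unfolding k(1) mem by auto
  qed
  have inj: "inj_on (\<lambda>k. r + W * k) {u'..<v'}" using W by (auto simp: inj_on_def)
  have "(\<Sum>m\<in>?A. e_char (t * real m)) = (\<Sum>k\<in>{u'..<v'}. e_char ((t * real W) * real k + t * real r))"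
    unfolding A by (subst sum.reindex[OF inj]) (simp add: algebra_simps)
  moreover have "real v' - real u' \<le> H"
  proof (cases "u' < v'")
    case False then show ?thesis using H by simp
  next
    case True
    have "u \<le> r + W * u'" using u' by blast
    moreover have "r + W * (v' - 1) < v" using v'[of "v' - 1"] True by auto
    ultimately have "real u \<le> real (r + W * u')" "real (r + W * (v' - 1)) < real v"
      by (simp_all only: of_nat_le_iff of_nat_less_iff)
    then have "real W * (real v' - 1) - real W * real u' \<le> real v - real u"
      using True by (simp add: of_nat_diff)
    then have "real v' - 1 - real u' \<le> (real v - real u) / real W"
      using W by (simp add: field_simps)
    then show ?thesis using H by linarith
  qed
  ultimately show ?thesis using norm_sum_e_char_le_cap[of v' u' H "t * real W" "t * real r"] H by simp
qed

section \<open>Sums of min(H, 1/\<parallel>t\<parallel>) and divisor sums\<close>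

lemma sum_inverse_le_ln:
  assumes "real n \<le> y" "1 \<le> y"
  shows "(\<Sum>k=1..n. 1 / real k) \<le> 1 + ln y"
proof (cases "n = 0")
  case True
  then show ?thesis using assms by simp
next
  case False
  then have "1 \<le> n" by simp
  then have "(\<Sum>k=1..n. 1 / real k) \<le> 1 + ln (real n)"
  proof (induction n rule: dec_induct)
    case base
    then show ?case by simp
  next
    case (step m)
    then have m: "real m > 0" by simp
    have "ln (real m / real (Suc m)) \<le> real m / real (Suc m) - 1"
      by (rule ln_le_minus_one) (use m in auto)
    also have "\<dots> = - 1 / real (Suc m)" by (simp add: field_simps)
    finally have "ln (real m) + 1 / real (Suc m) \<le> ln (real (Suc m))"
      using m by (simp add: ln_div)
    then show ?case using step by simp
  qed
  also have "\<dots> \<le> 1 + ln y" using assms False by simp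
  finally show ?thesis .
qed

lemma ndist_ge_frac: "min (frac t) (1 - frac t) \<le> ndist t"
proof (cases "round t \<le> \<lfloor>t\<rfloor>")
  case True
  then have "real_of_int (round t) \<le> of_int \<lfloor>t\<rfloor>" by simp
  then show ?thesis by (simp add: ndist_def frac_def min_def abs_if)
next
  case False
  then have "\<lfloor>t\<rfloor> + 1 \<le> round t" by simp
  then have "real_of_int \<lfloor>t\<rfloor> + 1 \<le> of_int (round t)"
    by (metis of_int_1 of_int_add of_int_le_iff)
  then show ?thesis by (simp add: ndist_def frac_def min_def abs_if)
qed

text \<open>q does not divide a k, so a k / q is at distance at least 1 / q from the integers, and
  \<open>\<alpha> * k\<close> differs from it by at most |k| / q^2 <= 1 / (2 q).\<close>

lemma ndist_separated:
  fixes a k :: int and q :: nat and \<alpha> :: real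
  assumes co: "coprime a (int q)" and \<alpha>: "\<bar>\<alpha> - a / q\<bar> \<le> 1 / (real q)^2"
    and k: "k \<noteq> 0" "2 * \<bar>k\<bar> \<le> int q"
  shows "1 / (2 * real q) \<le> ndist (\<alpha> * k)"
proof -
  have q: "q > 0" using k by auto
  define n where "n = round (\<alpha> * k)"
  have "\<not> int q dvd k" using k zdvd_imp_le[of "int q" "\<bar>k\<bar>"] by auto
  then have "\<not> int q dvd a * k" using co by (simp add: coprime_commute coprime_dvd_mult_right_iff)
  then have "a * k - n * int q \<noteq> 0" by (metis dvd_triv_right eq_iff_diff_eq_0)
  then have "1 \<le> \<bar>a * k - n * int q\<bar>" by linarith
  then have "1 \<le> \<bar>real_of_int (a * k - n * int q)\<bar>" by linarith
  also have "real_of_int (a * k - n * int q) = real q * (a / q * k - n)"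
    using q by (simp add: field_simps)
  finally have "1 \<le> real q * \<bar>a / q * k - n\<bar>" by (simp add: abs_mult)
  then have 1: "1 / real q \<le> \<bar>a / q * k - n\<bar>" using q by (simp add: field_simps)
  have "\<bar>\<alpha> * k - a / q * k\<bar> = \<bar>\<alpha> - a / q\<bar> * \<bar>real_of_int k\<bar>"
    by (simp add: algebra_simps flip: abs_mult)
  also have "\<dots> \<le> 1 / (real q)^2 * (real q / 2)"
    using \<alpha> k by (intro mult_mono) auto
  also have "\<dots> = 1 / (2 * real q)" using q by (simp add: power2_eq_square)
  finally have 2: "\<bar>\<alpha> * k - a / q * k\<bar> \<le> 1 / (2 * real q)" .
  have "1 / real q = 1 / (2 * real q) + 1 / (2 * real q)" using q by (simp add: field_simps)
  moreover have "ndist (\<alpha> * k) = \<bar>\<alpha> * k - n\<bar>" by (simp add: ndist_def n_def)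
  ultimately show ?thesis using 1 2 by linarith
qed

text \<open>By \<open>ndist_separated\<close>, applied to differences of two arguments, each of the
  2 q cells of length 1 / (2 q) on the circle contains at most one point. The two cells touching an
  integer cost H each; the others give harmonic sums.\<close>

lemma sum_cap_block:
  fixes a :: int and q u K :: nat
  assumes co: "coprime a (int q)" and q: "q > 0" and \<alpha>: "\<bar>\<alpha> - a / q\<bar> \<le> 1 / (real q)^2"
    and K: "2 * K \<le> q" and H: "0 \<le> H"
  shows "(\<Sum>x=u..<u+K. cap H (\<alpha> * real x)) \<le> 2 * H + 4 * q * (1 + ln (2 * q))"
proof -
  define cell where "cell x = nat \<lfloor>2 * q * frac (\<alpha> * real x)\<rfloor>" for x :: nat
  \<comment> \<open>An inner cell receives the sum of the bounds seen from both ends of [0, 1], so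
    that no minimum has to be summed; the reflection c -> 2 q - 1 - c makes the two sums
    equal.\<close>
  define g where "g c = (if c = 0 \<or> c = 2*q-1 then H else 2*q / real c + 2*q / (real (2*q-1) - real c))" for c
  have cell: "real (cell x) \<le> 2 * q * frac (\<alpha> * real x)" "2 * q * frac (\<alpha> * real x) < real (cell x) + 1" for x
  proof -
    have "0 \<le> 2 * q * frac (\<alpha> * real x)" by simp
    then show "real (cell x) \<le> 2 * q * frac (\<alpha> * real x)" "2 * q * frac (\<alpha> * real x) < real (cell x) + 1"
      unfolding cell_def by linarith+
  qed
  have cell_less: "cell x < 2 * q" for x
  proof -
    have "2 * q * frac (\<alpha> * real x) < 2 * q * 1"
      using q frac_lt_1[of "\<alpha> * real x"] by simp
    then have "real (cell x) < real (2 * q)" using cell(1)[of x] by simp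
    then show ?thesis by simp
  qed
  have cap_g: "cap H (\<alpha> * real x) \<le> g (cell x)" for x
  proof (cases "cell x = 0 \<or> cell x = 2*q-1")
    case True
    then show ?thesis using cap_le[OF H] by (simp add: g_def)
  next
    case False
    define c where "c = cell x"
    define t where "t = \<alpha> * real x"
    have c: "0 < c" "c < 2*q-1" using False cell_less[of x] by (auto simp: c_def)
    have c': "real c < real (2*q-1)" "real (2*q-1) = 2 * q - 1" using c by auto
    have f: "real c / (2*q) \<le> frac t" "(real (2*q-1) - real c) / (2*q) \<le> 1 - frac t"
      using cell[of x] q c' unfolding c_def t_def by (auto simp: field_simps)
    have "cap H t \<le> 2*q / real c + 2*q / (real (2*q-1) - real c)"
    proof (cases "frac t \<le> 1 - frac t")
      case True
      then have "real c / (2*q) \<le> ndist t" using f(1) ndist_ge_frac[of t] by simp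
      then have "cap H t * (real c / (2*q)) \<le> cap H t * ndist t" by (intro mult_left_mono cap_nonneg H)
      then have "cap H t * (real c / (2*q)) \<le> 1" using cap_mult_ndist_le[OF H, of t] by linarith
      then have "cap H t \<le> 2*q / real c" using c q by (simp add: field_simps)
      moreover have "0 \<le> 2*q / (real (2*q-1) - real c)" using c' by simp
      ultimately show ?thesis by linarith
    next
      case False
      then have "(real (2*q-1) - real c) / (2*q) \<le> ndist t" using f(2) ndist_ge_frac[of t] by simp
      then have "cap H t * ((real (2*q-1) - real c) / (2*q)) \<le> cap H t * ndist t" by (intro mult_left_mono cap_nonneg H)
      then have "cap H t * ((real (2*q-1) - real c) / (2*q)) \<le> 1" using cap_mult_ndist_le[OF H, of t] by linarith
      then have "cap H t * (real (2*q-1) - real c) \<le> 2*q" using q by (simp add: divide_simps)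
      then have "cap H t \<le> 2*q / (real (2*q-1) - real c)" using c' by (simp add: pos_le_divide_eq)
      moreover have "0 \<le> 2*q / real c" using c' by simp
      ultimately show ?thesis by linarith
    qed
    then show ?thesis using False by (simp add: g_def c_def t_def)
  qed
  have inj: "inj_on cell {u..<u+K}"
  proof (rule inj_onI, rule ccontr)
    fix x x' assume x: "x \<in> {u..<u+K}" "x' \<in> {u..<u+K}" "cell x = cell x'" "x \<noteq> x'"
    define k where "k = int x - int x'"
    have k: "k \<noteq> 0" using x by (simp add: k_def)
    have "u \<le> x" "x < u + K" "u \<le> x'" "x' < u + K" using x by auto
    then have "int x - int x' \<le> int K" "int x' - int x \<le> int K" by linarith+
    then have "2 * \<bar>k\<bar> \<le> 2 * int K" by (simp add: k_def abs_le_iff)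
    with K have k2: "2 * \<bar>k\<bar> \<le> int q" by linarith
    have "\<bar>2 * q * frac (\<alpha> * real x) - 2 * q * frac (\<alpha> * real x')\<bar> < 1"
      using cell[of x] cell[of x'] x(3) by linarith
    then have "2 * q * \<bar>frac (\<alpha> * real x) - frac (\<alpha> * real x')\<bar> < 1"
      by (simp add: abs_mult flip: right_diff_distrib)
    moreover have "\<alpha> * k - of_int (\<lfloor>\<alpha> * real x\<rfloor> - \<lfloor>\<alpha> * real x'\<rfloor>) = frac (\<alpha> * real x) - frac (\<alpha> * real x')"
      by (simp add: frac_def k_def algebra_simps)
    then have "ndist (\<alpha> * k) \<le> \<bar>frac (\<alpha> * real x) - frac (\<alpha> * real x')\<bar>"
      using ndist_le[of "\<alpha> * k" "\<lfloor>\<alpha> * real x\<rfloor> - \<lfloor>\<alpha> * real x'\<rfloor>"] by simp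
    ultimately have "2 * q * ndist (\<alpha> * k) < 1"
      by (meson le_less_trans mult_left_mono of_nat_0_le_iff)
    then show False using ndist_separated[OF co \<alpha> k k2] q by (simp add: field_simps)
  qed
  have g_nonneg: "0 \<le> g c" if "c \<in> {..<2*q}" for c
    using H that by (auto simp: g_def of_nat_diff intro!: add_nonneg_nonneg divide_nonneg_nonneg)
  have "(\<Sum>x=u..<u+K. cap H (\<alpha> * real x)) \<le> (\<Sum>x=u..<u+K. g (cell x))"
    by (intro sum_mono cap_g)
  also have "\<dots> = (\<Sum>c\<in>cell ` {u..<u+K}. g c)" by (simp add: sum.reindex[OF inj])
  also have "\<dots> \<le> (\<Sum>c\<in>{..<2*q}. g c)"
    by (intro sum_mono2) (use cell_less g_nonneg in auto)
  also have "\<dots> = (\<Sum>c\<in>{0,2*q-1} \<union> {1..<2*q-1}. g c)"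
    by (intro sum.cong) (use q in auto)
  also have "\<dots> \<le> (\<Sum>c\<in>{0,2*q-1}. g c) + (\<Sum>c=1..<2*q-1. g c)"
    using g_nonneg q by (subst sum.union_disjoint) auto
  also have "(\<Sum>c\<in>{0,2*q-1}. g c) = 2 * H" using q by (simp add: g_def)
  also have "(\<Sum>c=1..<2*q-1. g c) = (\<Sum>c=1..<2*q-1. 2*q / real c) + (\<Sum>c=1..<2*q-1. 2*q / (real (2*q-1) - real c))"
    unfolding sum.distrib[symmetric] by (intro sum.cong) (auto simp: g_def)
  also have "(\<Sum>c=1..<2*q-1. 2*q / (real (2*q-1) - real c)) = (\<Sum>c=1..<2*q-1. 2*q / real c)"
    by (rule sum.reindex_bij_witness[where i = "\<lambda>c. 2*q-1-c" and j = "\<lambda>c. 2*q-1-c"]) (auto simp: of_nat_diff)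
  finally have "(\<Sum>x=u..<u+K. cap H (\<alpha> * real x)) \<le> 2 * H + 2 * (2 * q * (\<Sum>c=1..<2*q-1. 1 / real c))"
    by (simp add: sum_distrib_left)
  also have "\<dots> \<le> 2 * H + 2 * (2 * q * (1 + ln (2 * q)))"
  proof -
    have "(\<Sum>c=1..<2*q-1. 1 / real c) \<le> (\<Sum>c=1..2*q. 1 / real c)"
      by (intro sum_mono2) auto
    also have "\<dots> \<le> 1 + ln (2 * q)" using q by (intro sum_inverse_le_ln) auto
    finally show ?thesis by (intro add_left_mono mult_left_mono) auto
  qed
  finally show ?thesis by simp
qed

text \<open>The range is cut into blocks of length about q / 2. In block k >= 1 the two extreme
  cells cost y / (k K) each, which sums harmonically to order y L / q; the remaining
  \<open>B\<close> of order q L occurs about n / q + 1 times.\<close>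

lemma sum_cap_le:
  fixes a :: int and q n :: nat
  assumes co: "coprime a (int q)" and \<alpha>: "\<bar>\<alpha> - a / q\<bar> \<le> 1 / (real q)^2"
    and q: "2 \<le> q" "real q \<le> y" and n: "real n \<le> y"
  shows "(\<Sum>x=1..n. cap (y / x) (\<alpha> * real x)) \<le> 24 * (1 + ln y) * (y / q + n + q)"
proof -
  define K where "K = q div 2"
  define L where "L = 1 + ln y"
  define B where "B = 4 * q * (1 + ln (2 * q))"
  have y: "2 \<le> y" using q by linarith
  have L: "1 \<le> L" using y by (simp add: L_def)
  have K: "0 < K" "2 * K \<le> q" "q \<le> 3 * K" using q by (auto simp: K_def)
  have B: "B \<le> 8 * q * L"
  proof -
    have "ln (2 * real q) = ln 2 + ln (real q)" using q by (simp add: ln_mult)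
    also have "\<dots> \<le> 1 + ln y" using q ln_2_less_1 by (intro add_mono) auto
    also have "\<dots> \<le> 1 + 2 * ln y" using y by simp
    finally have "1 + ln (2 * real q) \<le> 2 * L" by (simp add: L_def)
    then have "4 * q * (1 + ln (2 * q)) \<le> 4 * q * (2 * L)" by (intro mult_left_mono) auto
    then show ?thesis by (simp add: B_def)
  qed
  have B0: "0 \<le> B" using q by (simp add: B_def)
  let ?f = "\<lambda>x. cap (y / real (x + 1)) (\<alpha> * real (x + 1))"
  have f0: "0 \<le> ?f x" for x using y by (intro cap_nonneg) auto
  have shift: "(\<Sum>x\<in>{k*K..<k*K+K}. cap H (\<alpha> * real (x+1))) \<le> 2 * H + B" if "0 \<le> H" for k H
  proof -
    have "(\<Sum>x\<in>{k*K..<k*K+K}. cap H (\<alpha> * real (x+1))) = (\<Sum>x\<in>{k*K+1..<(k*K+1)+K}. cap H (\<alpha> * real x))"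
      by (rule sum.reindex_bij_witness[where i = "\<lambda>x. x - 1" and j = "\<lambda>x. x + 1"]) auto
    also have "\<dots> \<le> 2 * H + B"
      unfolding B_def by (rule sum_cap_block) (use co \<alpha> q K that in auto)
    finally show ?thesis .
  qed
  \<comment> \<open>In the first block y / x may be as large as y. But its arguments lie between 1
    and q / 2, so \<open>ndist_separated\<close> applies to the arguments themselves and
    \<open>2 * q\<close> can replace y / x.\<close>
  have k0: "(\<Sum>x\<in>{0*K..<0*K+K}. ?f x) \<le> 4 * q + B"
  proof -
    have "?f x \<le> cap (2 * q) (\<alpha> * real (x+1))" if "x \<in> {0*K..<0*K+K}" for x
    proof (rule cap_geI)
      have "1 / (2 * real q) \<le> ndist (\<alpha> * of_int (int (x+1)))"
        by (rule ndist_separated[OF co \<alpha>]) (use that K in auto)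
      then have "?f x * (1 / (2 * real q)) \<le> ?f x * ndist (\<alpha> * real (x+1))"
        by (intro mult_left_mono f0) simp
      also have "\<dots> \<le> 1" using y by (intro cap_mult_ndist_le) auto
      finally show "?f x \<le> 2 * q" using q by (simp add: field_simps)
      show "?f x * ndist (\<alpha> * real (x+1)) \<le> 1" using y by (intro cap_mult_ndist_le) auto
    qed (rule f0)
    then have "(\<Sum>x\<in>{0*K..<0*K+K}. ?f x) \<le> (\<Sum>x\<in>{0*K..<0*K+K}. cap (2 * q) (\<alpha> * real (x+1)))"
      by (rule sum_mono)
    also have "\<dots> \<le> 2 * real (2 * q) + B" by (rule shift) simp
    finally show ?thesis by simp
  qed
  have k1: "(\<Sum>x\<in>{k*K..<k*K+K}. ?f x) \<le> (6 * y / q) * (1 / k) + B" if "0 < k" for k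
  proof -
    have "(\<Sum>x\<in>{k*K..<k*K+K}. ?f x) \<le> (\<Sum>x\<in>{k*K..<k*K+K}. cap (y / (k * K)) (\<alpha> * real (x+1)))"
    proof (intro sum_mono cap_mono)
      fix x assume "x \<in> {k*K..<k*K+K}"
      then have "real (k * K) \<le> real (x + 1)" by (subst of_nat_le_iff) auto
      then show "y / real (x + 1) \<le> y / (k * K)" using y K that by (intro divide_left_mono) auto
    qed (use y in auto)
    also have "\<dots> \<le> 2 * (y / (k * K)) + B" by (rule shift) (use y in auto)
    also have "2 * (y / (k * K)) \<le> (6 * y / q) * (1 / k)"
    proof -
      have "y * real q \<le> y * (3 * K)" using y K by (intro mult_left_mono) linarith+
      then show ?thesis using that K q by (simp add: field_simps)
    qed
    finally show ?thesis by simp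
  qed
  define m where "m = n div K"
  have "(\<Sum>x=1..n. cap (y / x) (\<alpha> * real x)) = (\<Sum>x\<in>{..<n}. ?f x)"
    by (rule sum.reindex_bij_witness[where i = "\<lambda>x. x + 1" and j = "\<lambda>x. x - 1"]) auto
  also have "\<dots> \<le> (\<Sum>x\<in>{..<Suc m * K}. ?f x)"
  proof (rule sum_mono2)
    have "n < Suc m * K" using K unfolding m_def by (metis dividend_less_div_times mult_Suc)
    then show "{..<n} \<subseteq> {..<Suc m * K}" by auto
  qed (use f0 in auto)
  also have "\<dots> = (\<Sum>k<Suc m. \<Sum>x\<in>{k*K..<k*K+K}. ?f x)" by (rule sum.nat_group[symmetric])
  also have "\<dots> = (\<Sum>x\<in>{0*K..<0*K+K}. ?f x) + (\<Sum>k=1..m. \<Sum>x\<in>{k*K..<k*K+K}. ?f x)"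
  proof -
    have "{..<Suc m} = insert 0 {1..m}" by auto
    then show ?thesis by simp
  qed
  also have "\<dots> \<le> (4 * q + B) + (\<Sum>k=1..m. (6 * y / q) * (1 / k) + B)"
    by (intro add_mono k0 sum_mono k1) auto
  also have "\<dots> = 4 * q + B + 6 * (y / q * (\<Sum>k=1..m. 1 / real k)) + m * B"
    by (simp add: sum.distrib sum_distrib_left)
  also have "\<dots> \<le> 4 * q + 8 * (q * L) + 6 * (y / q * L) + 24 * n * L"
  proof (intro add_mono)
    have "m \<le> n" using K by (simp add: m_def)
    then show "6 * (y / q * (\<Sum>k=1..m. 1 / real k)) \<le> 6 * (y / q * L)"
      unfolding L_def using y n by (intro mult_left_mono sum_inverse_le_ln) auto
    have "m * q \<le> m * (3 * K)" using K by simp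
    also have "\<dots> \<le> 3 * n" by (simp add: m_def)
    finally have "real m * real q \<le> 3 * real n" by (metis of_nat_le_iff of_nat_mult of_nat_numeral)
    then have "8 * L * (real m * real q) \<le> 8 * L * (3 * real n)" using L by (intro mult_left_mono) auto
    moreover have "m * B \<le> m * (8 * q * L)" using B by (intro mult_left_mono) auto
    ultimately show "m * B \<le> 24 * n * L" by (simp add: mult_ac)
  qed (use B in auto)
  also have "\<dots> \<le> 24 * L * (y / q + n + q)"
  proof -
    have 1: "real q * 1 \<le> q * L" using L by (intro mult_left_mono) auto
    have 2: "0 \<le> y / q * L" "0 \<le> real q * L" using L y by auto
    have "4 * x + 8 * u + 6 * v + w \<le> 24 * u + 24 * v + w" if "x * 1 \<le> u" "0 \<le> v" "0 \<le> u" for x u v w :: real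
      using that by linarith
    from this[OF 1 2] have "4 * q + 8 * (q * L) + 6 * (y / q * L) + 24 * n * L \<le> 24 * (q * L) + 24 * (y / q * L) + 24 * n * L"
      unfolding of_nat_mult of_nat_numeral .
    also have "\<dots> = 24 * L * (y / q + n + q)" by (simp add: algebra_simps)
    finally show ?thesis .
  qed
  finally show ?thesis unfolding L_def .
qed

section \<open>Moments of the divisor function and Cauchy-Schwarz inequalities\<close>

definition tau :: "nat \<Rightarrow> real" where
  "tau n = real (card {d. d dvd n})"

lemma tau_nonneg [simp]: "0 \<le> tau n" by (simp add: tau_def)

lemma tau_ge_1: "0 < n \<Longrightarrow> 1 \<le> tau n"
  unfolding tau_def using card_mono[of "{d. d dvd n}" "{1}"] by simp

lemma tau_mult_le:
  assumes "0 < a" "0 < b"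
  shows "tau (a * b) \<le> tau a * tau b"
proof -
  have "{d. d dvd a * b} \<subseteq> (\<lambda>(x, y). x * y) ` ({d. d dvd a} \<times> {d. d dvd b})"
  proof
    fix d assume "d \<in> {d. d dvd a * b}"
    then obtain x y where "d = x * y" "x dvd a" "y dvd b" using division_decomp[of d a b] by auto
    then show "d \<in> (\<lambda>(x, y). x * y) ` ({d. d dvd a} \<times> {d. d dvd b})" by auto
  qed
  then have "card {d. d dvd a * b} \<le> card ((\<lambda>(x, y). x * y) ` ({d. d dvd a} \<times> {d. d dvd b}))"
    using assms by (intro card_mono) auto
  also have "\<dots> \<le> card ({d. d dvd a} \<times> {d. d dvd b})"
    using assms by (intro card_image_le) auto
  finally have "card {d. d dvd a * b} \<le> card {d. d dvd a} * card {d. d dvd b}"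
    by (simp add: card_cartesian_product)
  then show ?thesis unfolding tau_def by (metis of_nat_le_iff of_nat_mult)
qed

text \<open>One factor tau(n) is opened as a sum over n = a b; submultiplicativity of the other
  factors bounds the result by the square of the previous moment, hence the exponent 2^j.\<close>

lemma sum_tau_power_le:
  assumes "(\<Sum>n=1..N. 1 / real n) \<le> L"
  shows "(\<Sum>n=1..N. tau n ^ j / real n) \<le> L ^ (2 ^ j)"
proof (induction j)
  case 0
  then show ?case using assms by simp
next
  case (Suc j)
  have "(\<Sum>n=1..N. tau n ^ Suc j / real n) = (\<Sum>n=1..N. \<Sum>a | a dvd n. tau n ^ j / real n)"
    by (simp add: tau_def)
  also have "\<dots> = (\<Sum>(n,a)\<in>(SIGMA n:{1..N}. {a. a dvd n}). tau n ^ j / real n)"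
    by (subst sum.Sigma) auto
  also have "\<dots> \<le> (\<Sum>(a,b)\<in>{1..N}\<times>{1..N}. (tau a ^ j / real a) * (tau b ^ j / real b))"
  proof (rule sum_le_included[where i = "\<lambda>(a, b). (a * b, a)"])
    show "\<forall>x\<in>SIGMA n:{1..N}. {a. a dvd n}. \<exists>y\<in>{1..N} \<times> {1..N}. (case y of (a, b) \<Rightarrow> (a * b, a)) = x \<and>
        (case x of (n, a) \<Rightarrow> tau n ^ j / real n) \<le> (case y of (a, b) \<Rightarrow> tau a ^ j / real a * (tau b ^ j / real b))" (is "\<forall>x\<in>_. ?P x")
    proof
      fix x assume x: "x \<in> (SIGMA n:{1..N}. {a. a dvd n})"
      then obtain a b where ab: "x = (a * b, a)" "1 \<le> a * b" "a * b \<le> N" by (force elim: dvdE)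
      then have pos: "0 < a" "0 < b" by auto
      then have "a \<le> N" "b \<le> N" using ab
        by (metis One_nat_def Suc_leI dual_order.trans mult.right_neutral mult_le_mono2, metis One_nat_def Suc_leI dual_order.trans mult_1 mult_le_mono1)
      moreover have "tau (a * b) ^ j \<le> (tau a * tau b) ^ j" by (intro power_mono tau_mult_le pos) auto
      then have "tau (a * b) ^ j / real (a * b) \<le> tau a ^ j / real a * (tau b ^ j / real b)"
        using pos by (simp add: divide_right_mono power_mult_distrib)
      ultimately show "?P x"
        using ab pos by (intro bexI[of _ "(a, b)"]) auto
    qed
    show "\<forall>y\<in>{1..N} \<times> {1..N}. 0 \<le> (case y of (a, b) \<Rightarrow> tau a ^ j / real a * (tau b ^ j / real b))"
      by (auto intro!: mult_nonneg_nonneg)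
  qed (auto intro!: finite_SigmaI)
  also have "\<dots> = (\<Sum>n=1..N. tau n ^ j / real n) * (\<Sum>n=1..N. tau n ^ j / real n)"
    by (simp add: sum_product sum.cartesian_product)
  also have "\<dots> \<le> L ^ (2 ^ j) * L ^ (2 ^ j)"
    using Suc by (intro mult_mono) (auto intro!: sum_nonneg intro: order_trans[rotated])
  finally show ?case by (simp add: mult_2 power_add)
qed

text \<open>A triple with product j is determined by its first two entries, both divisors of j. This
  reduces every multiple sum whose phase depends on a product to a sum over one variable.\<close>

lemma sum_triples_le_tau:
  fixes h :: "nat \<Rightarrow> real"
  assumes fin: "finite T" and T: "\<And>a b c. (a, b, c) \<in> T \<Longrightarrow> 0 < a * b * c \<and> a * b * c \<le> J"
    and h: "\<And>j. 0 \<le> h j"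
  shows "(\<Sum>(a, b, c)\<in>T. h (a * b * c)) \<le> (\<Sum>j=1..J. (tau j)^2 * h j)"
proof -
  have "(\<Sum>(a, b, c)\<in>T. h (a * b * c)) \<le>
      (\<Sum>(j, a, b)\<in>(SIGMA j:{1..J}. {a. a dvd j} \<times> {b. b dvd j}). h j)"
  proof (rule sum_le_included[where i = "\<lambda>(j, a, b). (a, b, j div (a * b))"])
    show "\<forall>x\<in>T. \<exists>y\<in>(SIGMA j:{1..J}. {a. a dvd j} \<times> {b. b dvd j}).
        (case y of (j, a, b) \<Rightarrow> (a, b, j div (a * b))) = x \<and>
        (case x of (a, b, c) \<Rightarrow> h (a * b * c)) \<le> (case y of (j, a, b) \<Rightarrow> h j)" (is "\<forall>x\<in>_. ?P x")
    proof
      fix x assume "x \<in> T"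
      moreover obtain a b c where x: "x = (a, b, c)" by (rule prod_cases3)
      ultimately have "0 < a * b * c" "a * b * c \<le> J" using T by blast+
      then show "?P x"
        unfolding x by (intro bexI[of _ "(a * b * c, a, b)"]) auto
    qed
  qed (use fin h in \<open>auto intro!: finite_SigmaI\<close>)
  also have "\<dots> = (\<Sum>j=1..J. \<Sum>x\<in>{a. a dvd j} \<times> {b. b dvd j}. h j)"
    by (subst sum.Sigma) (auto simp: case_prod_unfold)
  also have "\<dots> = (\<Sum>j=1..J. (tau j)^2 * h j)"
    by (simp add: tau_def card_cartesian_product power2_eq_square)
  finally show ?thesis .
qed

lemma Cauchy_Schwarz_sum_real:
  fixes f g :: "'a \<Rightarrow> real"
  shows "(\<Sum>i\<in>A. f i * g i)\<^sup>2 \<le> (\<Sum>i\<in>A. (f i)\<^sup>2) * (\<Sum>i\<in>A. (g i)\<^sup>2)"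
proof -
  have "\<bar>\<Sum>i\<in>A. f i * g i\<bar> \<le> (\<Sum>i\<in>A. \<bar>f i\<bar> * \<bar>g i\<bar>)"
    by (rule order_trans[OF sum_abs]) (simp add: abs_mult)
  also have "\<dots> \<le> L2_set f A * L2_set g A" by (rule L2_set_mult_ineq)
  finally have "\<bar>\<Sum>i\<in>A. f i * g i\<bar> \<le> \<bar>L2_set f A * L2_set g A\<bar>" by simp
  then have "(\<Sum>i\<in>A. f i * g i)\<^sup>2 \<le> (L2_set f A * L2_set g A)\<^sup>2"
    by (simp only: abs_le_square_iff)
  then show ?thesis by (simp add: L2_set_def power_mult_distrib sum_nonneg)
qed

text \<open>Used to strip divisor weights: w contains a \<open>cap\<close>, f is a squared divisor
  function. The factor with f^2 is bounded trivially, and the saving comes from the factor without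
  f.\<close>

lemma Cauchy_Schwarz_weighted:
  fixes w f :: "'a \<Rightarrow> real"
  assumes "\<And>i. i \<in> A \<Longrightarrow> 0 \<le> w i"
  shows "(\<Sum>i\<in>A. w i * f i)\<^sup>2 \<le> (\<Sum>i\<in>A. w i * (f i)\<^sup>2) * (\<Sum>i\<in>A. w i)"
proof -
  have "(\<Sum>i\<in>A. w i * f i)\<^sup>2 = (\<Sum>i\<in>A. (sqrt (w i) * f i) * sqrt (w i))\<^sup>2"
    using assms by (intro arg_cong[of _ _ "\<lambda>x. x\<^sup>2"] sum.cong) (auto simp: mult_ac)
  also have "\<dots> \<le> (\<Sum>i\<in>A. (sqrt (w i) * f i)\<^sup>2) * (\<Sum>i\<in>A. (sqrt (w i))\<^sup>2)"
    by (rule Cauchy_Schwarz_sum_real)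
  also have "\<dots> = (\<Sum>i\<in>A. w i * (f i)\<^sup>2) * (\<Sum>i\<in>A. w i)"
    using assms by (intro arg_cong2[of _ _ _ _ "(*)"] sum.cong) (auto simp: power_mult_distrib)
  finally show ?thesis .
qed

section \<open>Weyl differencing and the Fejer kernel\<close>

text \<open>The shifts s and -s contribute conjugate terms, whence twice the real part; the first
  sum is the shift 0.\<close>

lemma norm_sum_squared_differencing:
  fixes f :: "nat \<Rightarrow> complex"
  assumes "u \<le> v"
  shows "(norm (\<Sum>d=u..<v. f d))\<^sup>2 = (\<Sum>d=u..<v. (norm (f d))\<^sup>2)
    + 2 * Re (\<Sum>s=1..<v-u. \<Sum>d=u..<v-s. f (d + s) * cnj (f d))"
  using assms
proof (induction v rule: dec_induct)
  case base
  then show ?case by simp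
next
  case (step v)
  let ?S = "\<Sum>d=u..<v. f d"
  let ?g = "\<lambda>s d. f (d + s) * cnj (f d)"
  have "(\<Sum>s=1..<Suc v-u. \<Sum>d=u..<Suc v-s. ?g s d)
      = (\<Sum>s=1..<Suc v-u. (\<Sum>d=u..<v-s. ?g s d) + ?g s (v - s))"
  proof (rule sum.cong)
    fix s assume s: "s \<in> {1..<Suc v-u}"
    then have "Suc v - s = Suc (v - s)" "u \<le> v - s" by auto
    then show "(\<Sum>d=u..<Suc v-s. ?g s d) = (\<Sum>d=u..<v-s. ?g s d) + ?g s (v - s)" by simp
  qed simp
  also have "\<dots> = (\<Sum>s=1..<Suc v-u. \<Sum>d=u..<v-s. ?g s d) + (\<Sum>s=1..<Suc v-u. ?g s (v - s))"
    by (rule sum.distrib)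
  also have "(\<Sum>s=1..<Suc v-u. \<Sum>d=u..<v-s. ?g s d) = (\<Sum>s=1..<v-u. \<Sum>d=u..<v-s. ?g s d)"
    by (rule sum.mono_neutral_right) auto
  also have "(\<Sum>s=1..<Suc v-u. ?g s (v - s)) = (\<Sum>d=u..<v. f v * cnj (f d))"
    by (rule sum.reindex_bij_witness[where i = "\<lambda>d. v - d" and j = "\<lambda>s. v - s"]) auto
  also have "\<dots> = f v * cnj ?S" by (simp add: sum_distrib_left)
  finally have *: "(\<Sum>s=1..<Suc v-u. \<Sum>d=u..<Suc v-s. ?g s d)
      = (\<Sum>s=1..<v-u. \<Sum>d=u..<v-s. ?g s d) + f v * cnj ?S" .
  have "(norm (\<Sum>d=u..<Suc v. f d))\<^sup>2 = (norm (?S + f v))\<^sup>2" using step by simp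
  also have "\<dots> = (norm ?S)\<^sup>2 + (norm (f v))\<^sup>2 + 2 * Re (f v * cnj ?S)"
    unfolding cmod_power2 by (simp add: power2_eq_square algebra_simps sum_negf)
  finally show ?case unfolding * using step by simp
qed

text \<open>The shift s turns the quadratic phase into a linear one of frequency
  \<open>2 * \<beta> * real s\<close>, so each inner sum is geometric.\<close>

lemma weyl_differencing:
  fixes u v :: nat
  assumes D: "real v - real u \<le> D" "0 \<le> D"
  shows "(norm (\<Sum>d=u..<v. e_char (\<beta> * (real d)\<^sup>2)))\<^sup>2 \<le> D + 2 * (\<Sum>s=1..<v-u. cap D (2 * \<beta> * real s))"
proof (cases "u \<le> v")
  case False
  then show ?thesis using D by (simp add: sum_nonneg cap_nonneg)
next
  case True
  let ?f = "\<lambda>d. e_char (\<beta> * (real d)\<^sup>2)"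
  have "Re (\<Sum>s=1..<v-u. \<Sum>d=u..<v-s. ?f (d + s) * cnj (?f d)) \<le> norm (\<Sum>s=1..<v-u. \<Sum>d=u..<v-s. ?f (d + s) * cnj (?f d))"
    by (rule complex_Re_le_cmod)
  also have "\<dots> \<le> (\<Sum>s=1..<v-u. norm (\<Sum>d=u..<v-s. ?f (d + s) * cnj (?f d)))"
    by (rule norm_sum)
  also have "\<dots> \<le> (\<Sum>s=1..<v-u. cap D (2 * \<beta> * real s))"
  proof (rule sum_mono)
    fix s assume "s \<in> {1..<v-u}"
    have "?f (d + s) * cnj (?f d) = e_char ((2 * \<beta> * real s) * real d + \<beta> * (real s)\<^sup>2)" for d
      unfolding cnj_e_char e_char_add[symmetric]
      by (rule arg_cong[of _ _ e_char]) (simp add: power2_eq_square algebra_simps)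
    then show "norm (\<Sum>d=u..<v-s. ?f (d + s) * cnj (?f d)) \<le> cap D (2 * \<beta> * real s)"
      using D by (simp only:) (intro norm_sum_e_char_le_cap, linarith+)
  qed
  finally show ?thesis
    unfolding norm_sum_squared_differencing[OF True] using D True by simp
qed

text \<open>Partial summation: the weight d is written as the sum of 1 over 1 <= k <= d. This leaves
  at most D tails of the unweighted sum, each bounded by \<open>weyl_differencing\<close>.\<close>

lemma weyl_weighted:
  fixes u v :: nat
  assumes D: "real v \<le> D + 1" "0 \<le> D"
  shows "norm (\<Sum>d=u..<v. of_nat d * e_char (\<beta> * (real d)\<^sup>2))
    \<le> D * sqrt (D + 2 * (\<Sum>s=1..<v. cap D (2 * \<beta> * real s)))"
proof -
  let ?f = "\<lambda>d. e_char (\<beta> * (real d)\<^sup>2)"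
  define W where "W = D + 2 * (\<Sum>s=1..<v. cap D (2 * \<beta> * real s))"
  have W0: "0 \<le> W" unfolding W_def using D by (simp add: sum_nonneg cap_nonneg)
  have inner: "norm (\<Sum>d=max u k..<v. ?f d) \<le> sqrt W" if "k \<ge> 1" for k
  proof (rule real_le_rsqrt)
    have "(norm (\<Sum>d=max u k..<v. ?f d))\<^sup>2 \<le> D + 2 * (\<Sum>s=1..<v-max u k. cap D (2 * \<beta> * real s))"
      by (rule weyl_differencing) (use D that in linarith)+
    also have "\<dots> \<le> W" unfolding W_def
      using D by (intro add_left_mono mult_left_mono sum_mono2) (auto intro: cap_nonneg)
    finally show "(norm (\<Sum>d=max u k..<v. ?f d))\<^sup>2 \<le> W" .
  qed
  have "(\<Sum>d=u..<v. of_nat d * ?f d) = (\<Sum>d=u..<v. \<Sum>k=1..d. ?f d)"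
    by simp
  also have "\<dots> = (\<Sum>k=1..<v. \<Sum>d=max u k..<v. ?f d)"
    unfolding sum.Sigma[OF finite_atLeastLessThan ballI[OF finite_atLeastAtMost]]
      sum.Sigma[OF finite_atLeastLessThan ballI[OF finite_atLeastLessThan]]
    by (rule sum.reindex_bij_witness[where i = "\<lambda>(k, d). (d, k)" and j = "\<lambda>(d, k). (k, d)"]) auto
  also have "norm \<dots> \<le> (\<Sum>k=1..<v. sqrt W)"
    by (intro order_trans[OF norm_sum] sum_mono inner) auto
  also have "\<dots> = real (v - 1) * sqrt W" by simp
  also have "\<dots> \<le> D * sqrt W" using D W0 by (intro mult_right_mono) auto
  finally show ?thesis unfolding W_def .
qed

section \<open>Fejer kernels as a smooth majorant of the minimum\<close>

definition fejer :: "nat \<Rightarrow> real \<Rightarrow> real" where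
  "fejer Y t = (norm (\<Sum>k=0..<Y. e_char (real k * t)))\<^sup>2 / real Y"

lemma fejer_nonneg: "0 \<le> fejer Y t"
  by (simp add: fejer_def)

text \<open>The condition keeps all angles 2 pi k ||t|| below pi / 3, where the cosine is at least
  1/2; this is the origin of the 6.\<close>

lemma fejer_lower_bound:
  assumes Y: "0 < Y" and t: "6 * real Y * ndist t \<le> 1"
  shows "real Y / 4 \<le> fejer Y t"
proof -
  define s where "s = t - of_int (round t)"
  have s: "\<bar>s\<bar> = ndist t" by (simp add: s_def ndist_def)
  have "1/2 \<le> Re (e_char (real k * t))" if "k \<in> {0..<Y}" for k
  proof -
    have "real k * t = real k * s + of_int (int k * round t)" by (simp add: s_def algebra_simps)
    then have e: "e_char (real k * t) = e_char (real k * s)" by (simp only: e_char_add e_char_of_int) simp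
    have "6 * (real k * \<bar>s\<bar>) \<le> 6 * (real Y * \<bar>s\<bar>)" using that by (intro mult_left_mono mult_right_mono) auto
    then have "6 * (real k * \<bar>s\<bar>) \<le> 1" using t unfolding s by simp
    then have "2 * pi * (real k * \<bar>s\<bar>) \<le> 2 * pi * (1/6)" by (intro mult_left_mono) auto
    then have "\<bar>2 * pi * (real k * s)\<bar> \<le> pi / 3" by (simp add: abs_mult)
    then have "cos (pi / 3) \<le> cos \<bar>2 * pi * (real k * s)\<bar>" using pi_gt_zero by (intro cos_monotone_0_pi_le) auto
    then show ?thesis unfolding e by (simp add: e_char_cis cos_60)
  qed
  then have "(\<Sum>k=0..<Y. 1/2) \<le> (\<Sum>k=0..<Y. Re (e_char (real k * t)))" by (rule sum_mono)
  then have "real Y / 2 \<le> Re (\<Sum>k=0..<Y. e_char (real k * t))" by simp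
  also have "\<dots> \<le> norm (\<Sum>k=0..<Y. e_char (real k * t))" by (rule complex_Re_le_cmod)
  finally have "(real Y / 2)\<^sup>2 \<le> (norm (\<Sum>k=0..<Y. e_char (real k * t)))\<^sup>2" by (intro power_mono) auto
  then have "(real Y / 2)\<^sup>2 / real Y \<le> fejer Y t" unfolding fejer_def by (intro divide_right_mono) auto
  then show ?thesis using Y by (simp add: power2_eq_square)
qed

text \<open>The minimum is comparable to the largest power 2^i <= H with 6 * 2^i ||t|| <= 1, where
  the Fejer kernel is large. That i depends on t, so all scales up to H are summed. The condition
  \<open>2 ^ i \<le> H\<close> is kept because it later limits which pairs occur at scale i.\<close>

lemma cap_le_sum_fejer:
  assumes H: "1 \<le> H" "H < 2 ^ I"
  shows "cap H t \<le> 48 * (\<Sum>i\<in>{i\<in>{..<I}. 2 ^ i \<le> H}. fejer (2 ^ i) t)"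
proof -
  let ?J = "{i\<in>{..<I}. 2 ^ i \<le> H}"
  have memJ: "i \<in> ?J" if "2 ^ i \<le> H" for i
  proof -
    have "(2::real) ^ i < 2 ^ I" using that H by linarith
    then show ?thesis using that by simp
  qed
  have ge: "fejer (2 ^ i) t \<le> (\<Sum>i\<in>?J. fejer (2 ^ i) t)" if "2 ^ i \<le> H" for i
    using memJ[OF that] by (intro member_le_sum) (auto intro: fejer_nonneg)
  define A where "A = {i. (2::real) ^ i \<le> H \<and> 6 * 2 ^ i * ndist t \<le> 1}"
  have finA: "finite A" by (rule finite_subset[of _ "{..<I}"]) (use memJ in \<open>auto simp: A_def\<close>)
  have cap1: "cap H t * ndist t \<le> 1" "0 \<le> cap H t" using H by (auto intro: cap_mult_ndist_le cap_nonneg)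
  have small: "cap H t \<le> c" if "1 < c * ndist t" "0 \<le> c" for c
  proof (rule ccontr)
    assume "\<not> cap H t \<le> c"
    then have "c * ndist t \<le> cap H t * ndist t" by (intro mult_right_mono) auto
    then show False using that cap1 by linarith
  qed
  show ?thesis
  proof (cases "A = {}")
    case True
    then have "1 < 6 * ndist t" using H by (auto simp: A_def dest: spec[of _ 0])
    then have "cap H t \<le> 6" by (rule small) simp
    moreover have "fejer (2 ^ 0) t = 1" by (simp add: fejer_def)
    ultimately show ?thesis using ge[of 0] H by simp
  next
    case False
    define i where "i = Max A"
    have i: "i \<in> A" using finA False by (simp add: i_def)
    \<comment> \<open>By maximality of i the next scale exceeds H or violates the condition with the
      6; in both cases the cap is at most 12 * 2^i, and 48 = 12 * 4.\<close>
    have "Suc i \<notin> A" using Max_ge[OF finA, of "Suc i"] unfolding i_def by auto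
    then consider "H < 2 * 2 ^ i" | "1 < (12 * 2 ^ i) * ndist t" by (auto simp: A_def)
    then have "cap H t \<le> 12 * 2 ^ i"
    proof cases
      case 1
      then show ?thesis using cap_le[of H t] H by linarith
    next
      case 2
      then show ?thesis by (rule small) simp
    qed
    moreover have "real (2 ^ i) / 4 \<le> fejer (2 ^ i) t"
      by (rule fejer_lower_bound) (use i in \<open>auto simp: A_def\<close>)
    moreover have "fejer (2 ^ i) t \<le> (\<Sum>i\<in>?J. fejer (2 ^ i) t)" by (rule ge) (use i in \<open>simp add: A_def\<close>)
    ultimately show ?thesis by simp
  qed
qed

lemma fejer_expand:
  assumes "0 < Y"
  shows "fejer Y t = 1 + 2 * (\<Sum>s=1..<Y. (1 - real s / real Y) * Re (e_char (real s * t)))"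
proof -
  have *: "e_char (real (d + s) * t) * cnj (e_char (real d * t)) = e_char (real s * t)" for d s
    unfolding cnj_e_char e_char_add[symmetric] by (simp add: algebra_simps)
  have "(norm (\<Sum>k=0..<Y. e_char (real k * t)))\<^sup>2 = real Y + 2 * Re (\<Sum>s=1..<Y. of_nat (Y - s) * e_char (real s * t))"
    by (subst norm_sum_squared_differencing) (simp_all only: *, simp_all)
  also have "Re (\<Sum>s=1..<Y. of_nat (Y - s) * e_char (real s * t)) = (\<Sum>s=1..<Y. real Y * ((1 - real s / real Y) * Re (e_char (real s * t))))"
    unfolding Re_sum using assms by (intro sum.cong) (auto simp: field_simps of_nat_diff)
  finally show ?thesis using assms unfolding fejer_def
    by (simp add: add_divide_distrib flip: sum_distrib_left)
qed

text \<open>The Fejer coefficients lie between 0 and 1, so apart from the constant term only the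
  norms of exponential sums at the frequencies 1, ..., Y - 1 remain.\<close>

lemma sum_fejer_le:
  fixes w :: "'a \<Rightarrow> real"
  assumes "0 < Y"
  shows "(\<Sum>p\<in>P. w p * fejer Y (t p)) \<le> (\<Sum>p\<in>P. w p)
    + 2 * (\<Sum>s=1..<Y. norm (\<Sum>p\<in>P. of_real (w p) * e_char (real s * t p)))"
proof -
  have "(\<Sum>p\<in>P. w p * fejer Y (t p)) = (\<Sum>p\<in>P. w p) + 2 * (\<Sum>p\<in>P. \<Sum>s=1..<Y. (1 - real s / real Y) * (w p * Re (e_char (real s * t p))))"
    by (simp add: fejer_expand[OF assms] algebra_simps sum.distrib sum_distrib_left)
  also have "(\<Sum>p\<in>P. \<Sum>s=1..<Y. (1 - real s / real Y) * (w p * Re (e_char (real s * t p))))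
      = (\<Sum>s=1..<Y. (1 - real s / real Y) * Re (\<Sum>p\<in>P. of_real (w p) * e_char (real s * t p)))"
    by (subst sum.swap) (simp add: sum_distrib_left)
  also have "\<dots> \<le> (\<Sum>s=1..<Y. norm (\<Sum>p\<in>P. of_real (w p) * e_char (real s * t p)))"
  proof (rule sum_mono)
    fix s assume s: "s \<in> {1..<Y}"
    let ?z = "\<Sum>p\<in>P. of_real (w p) * e_char (real s * t p)"
    have "(1 - real s / real Y) * Re ?z \<le> (1 - real s / real Y) * norm ?z"
      using s by (intro mult_left_mono complex_Re_le_cmod) auto
    also have "\<dots> \<le> 1 * norm ?z" by (intro mult_right_mono) auto
    finally show "(1 - real s / real Y) * Re ?z \<le> norm ?z" by simp
  qed
  finally show ?thesis by simp
qed

section \<open>The quadratic sum over minor arcs\<close>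

text \<open>The small parameter is \<open>1 / r\<close>: all savings are powers of \<open>r\<close>, with \<open>Q = r\<^sup>2\<^sup>4\<close>, and \<open>r\<^sup>8\<close> separates
  small from large \<open>d\<close> in the sum over \<open>d\<^sup>2 j\<close>.\<close>
locale minor_arc =
  fixes \<alpha> :: real and a :: int and q :: nat and x r L :: real
  assumes co: "coprime a (int q)"
    and approx: "\<bar>\<alpha> - a / q\<bar> \<le> 1 / (real q)\<^sup>2"
    and r: "2 \<le> r"
    and q_lower: "r ^ 24 \<le> q"
    and q_upper: "q \<le> x / r ^ 24"
    and L_def: "L = 2 + ln x"
begin

abbreviation cap_at :: "nat \<Rightarrow> real" where
  "cap_at n \<equiv> cap (x / real n) (\<alpha> * real n)"

lemma r_pow: "1 \<le> r ^ n" "0 < r ^ n"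
  using r by (auto intro: one_le_power)

lemma q_ge_2: "2 \<le> q"
proof -
  have "(2::real) ^ 1 \<le> 2 ^ 24" by (rule power_increasing) auto
  also have "(2::real) ^ 24 \<le> r ^ 24" using r by (intro power_mono) auto
  finally show ?thesis using q_lower by simp
qed

lemma q_le_x: "q \<le> x"
proof -
  have "real q * 1 \<le> q * r ^ 24" using r_pow by (intro mult_left_mono) auto
  also have "\<dots> \<le> x" using q_upper r_pow(2)[of 24] by (simp add: pos_le_divide_eq)
  finally show ?thesis by simp
qed

lemma x_ge_2: "2 \<le> x"
  using q_le_x q_ge_2 by linarith

lemma L_ge_2: "2 \<le> L"
  using x_ge_2 by (simp add: L_def)

text \<open>The 2 in the definition of L makes room for the argument 2 x, which arises from the
  factor 2 in differenced frequencies.\<close>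

lemma L_ln: "1 + ln (2 * x) \<le> L"
  using x_ge_2 ln_2_less_1 by (simp add: L_def ln_mult)

lemma harm_le_L:
  assumes "real n \<le> 2 * x"
  shows "(\<Sum>k=1..n. 1 / real k) \<le> L"
  using sum_inverse_le_ln[of n "2 * x"] L_ln x_ge_2 assms by linarith

lemma x_div_q: "x / q \<le> x / r ^ 24"
  using q_lower r_pow(2)[of 24] q_ge_2 x_ge_2 by (intro divide_left_mono mult_pos_pos) auto

lemma x_div_r_mono: "m \<le> n \<Longrightarrow> x / r ^ n \<le> x / r ^ m"
  using r x_ge_2 by (intro divide_left_mono power_increasing mult_pos_pos zero_less_power) auto

lemma x_div_r_le: "x / r ^ n \<le> x"
  using x_div_r_mono[of 0 n] by simp

lemma L_pow_mono: "m \<le> n \<Longrightarrow> L ^ m \<le> L ^ n"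
  using L_ge_2 by (intro power_increasing) auto

lemma exists_dyadic_length:
  obtains I :: nat where "x < 2 ^ I" "real I \<le> 2 * L"
proof
  define I where "I = nat \<lfloor>log 2 x\<rfloor> + 1"
  have log0: "0 \<le> log 2 x" using x_ge_2 by simp
  have "log 2 x < real I" unfolding I_def using log0 by linarith
  then have "x < 2 powr real I" using x_ge_2 by (simp add: log_less_iff)
  then show "x < 2 ^ I" by (simp add: powr_realpow)
  have "1 / 2 \<le> ln (2::real)" using ln_le_minus_one[of "1/2"] by (simp add: ln_div)
  then have "ln x / ln 2 \<le> ln x / (1/2)" using x_ge_2 by (intro divide_left_mono) auto
  then have "log 2 x \<le> 2 * ln x" by (simp add: log_def)
  moreover have "real I \<le> log 2 x + 1" unfolding I_def using log0 by linarith
  ultimately show "real I \<le> 2 * L" by (simp add: L_def)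
qed

text \<open>Cauchy-Schwarz between a fourth moment of tau, where the cap is bounded by 2 x / k, and
  the sum without tau, where \<open>sum_cap_le\<close> saves r^8. The length 2 x matches the
  products 2 s j k of \<open>weyl_double_sum_le\<close>.\<close>

lemma weighted_sum_cap_le:
  assumes n: "real n \<le> 2 * x / r ^ 8"
  shows "(\<Sum>k=1..n. (tau k)\<^sup>2 * cap (2 * x / k) (\<alpha> * real k)) \<le> 16 * x * L ^ 9 / r ^ 4"
proof -
  let ?c = "\<lambda>k. cap (2 * x / real k) (\<alpha> * real k)"
  have c0: "0 \<le> ?c k" for k using x_ge_2 by (intro cap_nonneg) auto
  have n2: "real n \<le> 2 * x" using n x_div_r_le[of 8] by simp
  have A: "(\<Sum>k=1..n. ?c k * ((tau k)\<^sup>2)\<^sup>2) \<le> 2 * x * L ^ 16"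
  proof -
    have "(\<Sum>k=1..n. ?c k * ((tau k)\<^sup>2)\<^sup>2) \<le> (\<Sum>k=1..n. (2 * x / real k) * tau k ^ 4)"
      using x_ge_2 by (intro sum_mono mult_mono cap_le) (auto simp flip: power_mult)
    also have "\<dots> = 2 * x * (\<Sum>k=1..n. tau k ^ 4 / real k)" by (simp add: sum_distrib_left)
    also have "\<dots> \<le> 2 * x * L ^ (2 ^ 4)"
      using x_ge_2 by (intro mult_left_mono sum_tau_power_le harm_le_L n2) auto
    finally show ?thesis by simp
  qed
  have B: "(\<Sum>k=1..n. ?c k) \<le> 120 * L * (x / r ^ 8)"
  proof -
    have "(\<Sum>k=1..n. ?c k) \<le> 24 * (1 + ln (2 * x)) * (2 * x / q + n + q)"
      by (rule sum_cap_le) (use co approx q_ge_2 q_le_x x_ge_2 n2 in auto)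
    also have "\<dots> \<le> 24 * L * (5 * (x / r ^ 8))"
    proof (intro mult_mono)
      have "x / q \<le> x / r ^ 8" "q \<le> x / r ^ 8"
        using x_div_q q_upper x_div_r_mono[of 8 24] by auto
      then show "2 * x / q + n + q \<le> 5 * (x / r ^ 8)" using n by simp
    qed (use L_ln L_ge_2 x_ge_2 in auto)
    finally show ?thesis by simp
  qed
  have "(\<Sum>k=1..n. (tau k)\<^sup>2 * ?c k)\<^sup>2 = (\<Sum>k=1..n. ?c k * (tau k)\<^sup>2)\<^sup>2" by (simp add: mult.commute)
  also have "\<dots> \<le> (\<Sum>k=1..n. ?c k * ((tau k)\<^sup>2)\<^sup>2) * (\<Sum>k=1..n. ?c k)"
    by (rule Cauchy_Schwarz_weighted) (rule c0)
  also have "\<dots> \<le> (2 * x * L ^ 16) * (120 * L * (x / r ^ 8))"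
    using x_ge_2 L_ge_2 by (intro mult_mono A B) (auto intro!: sum_nonneg c0 mult_nonneg_nonneg)
  also have "\<dots> = 240 * (x\<^sup>2 / r ^ 8) * L ^ 17" by (simp add: power2_eq_square eval_nat_numeral)
  also have "\<dots> \<le> 256 * (x\<^sup>2 / r ^ 8) * L ^ 18"
    using r_pow(2)[of 8] L_ge_2 by (intro mult_mono L_pow_mono) auto
  also have "\<dots> = (16 * x * L ^ 9 / r ^ 4)\<^sup>2"
    by (simp add: power_mult_distrib power_divide flip: power_mult)
  finally show ?thesis
    by (rule power2_le_imp_le) (use x_ge_2 L_ge_2 r in \<open>auto intro!: divide_nonneg_nonneg mult_nonneg_nonneg\<close>)
qed

text \<open>For fixed s and j the sum over d is a weighted quadratic sum of length D_j = sqrt (Z /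
  j), treated by \<open>weyl_weighted\<close>. After Cauchy-Schwarz over (s, j) the differenced
  phases are alpha times 2 s j k, a single variable. The condition d > r^8 makes D_j >= r^8, and
  this provides the saving both in the diagonal and in the range of 2 s j k.\<close>

lemma weyl_double_sum_le:
  fixes Y :: nat and Z :: real
  assumes Y: "1 \<le> Y" and Z: "0 \<le> Z" "real Y * Z \<le> x" and P: "P = {(d, j). r ^ 8 < real d \<and> 0 < j \<and> real (d^2 * j) \<le> Z}"
  shows "(\<Sum>s=1..<Y. norm (\<Sum>(d, j)\<in>P. of_real (real d) * e_char (real s * (\<alpha> * real (d^2 * j))))) \<le> 6 * x * L ^ 5 / r ^ 2" (is "?S \<le> _")
    and "(\<Sum>(d, j)\<in>P. real d) \<le> Z * L" and "finite P"
proof -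
  define D where "D j = sqrt (Z / real j)" for j
  define u where "u = nat \<lfloor>r ^ 8\<rfloor> + 1"
  define v where "v j = nat \<lfloor>D j\<rfloor> + 1" for j
  \<comment> \<open>d > r^8 and d^2 j <= Z leave only j <= Z / r^16.\<close>
  define J where "J = nat \<lfloor>Z / r ^ 16\<rfloor>"
  define W where "W s j = D j + 2 * (\<Sum>k=1..<v j. cap (D j) (2 * (real s * \<alpha> * real j) * real k))" for s j
  have Zx: "Z \<le> x"
  proof -
    have "1 * Z \<le> real Y * Z" using Y Z by (intro mult_right_mono) auto
    then show ?thesis using Z by simp
  qed
  have D0: "0 \<le> D j" for j using Z by (simp add: D_def)
  have v: "real (v j) \<le> D j + 1" "d < v j \<longleftrightarrow> real d \<le> D j" for j d
    using D0[of j] unfolding v_def by linarith+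
  have u: "u \<le> d \<longleftrightarrow> r ^ 8 < real d" for d
    using r_pow(1)[of 8] unfolding u_def by linarith
  have le_D: "real d \<le> D j \<longleftrightarrow> real (d^2 * j) \<le> Z" if "0 < j" for d j
  proof -
    have "real d \<le> D j \<longleftrightarrow> (real d)\<^sup>2 \<le> Z / real j"
      unfolding D_def by (metis of_nat_0_le_iff real_le_lsqrt real_sqrt_le_iff real_sqrt_pow2 real_sqrt_power real_sqrt_unique)
    then show ?thesis using that by (simp add: pos_le_divide_eq)
  qed
  have D_ge: "r ^ 8 \<le> D j" if "j \<in> {1..J}" for j
  proof -
    have "real j \<le> Z / r ^ 16" using that Z r_pow[of 16] unfolding J_def by (auto simp: le_nat_floor) linarith
    then have "r ^ 16 \<le> Z / real j" using that r_pow(2)[of 16] by (auto simp: field_simps)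
    then have "(r ^ 8)\<^sup>2 \<le> Z / real j" by (simp flip: power_mult)
    then show ?thesis unfolding D_def by (rule real_le_rsqrt)
  qed
  have P_eq: "P = (\<lambda>(j, d). (d, j)) ` (SIGMA j:{1..J}. {u..<v j})"
  proof (intro equalityI subsetI)
    fix p assume "p \<in> P"
    then obtain d j where p: "p = (d, j)" "r ^ 8 < real d" "0 < j" "real (d^2 * j) \<le> Z" unfolding P by auto
    have "r ^ 16 * real j = (r ^ 8)\<^sup>2 * real j" by (simp flip: power_mult)
    also have "\<dots> \<le> (real d)\<^sup>2 * real j" using p r_pow[of 8] by (intro mult_right_mono power_mono) auto
    also have "\<dots> \<le> Z" using p by simp
    finally have "real j \<le> Z / r ^ 16" using r_pow(2)[of 16] by (simp add: field_simps)
    then have "j \<le> J" unfolding J_def by (rule le_nat_floor)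
    then show "p \<in> (\<lambda>(j, d). (d, j)) ` (SIGMA j:{1..J}. {u..<v j})"
      using p le_D[of j d] u[of d] v(2)[of d j] by force
  next
    fix p assume "p \<in> (\<lambda>(j, d). (d, j)) ` (SIGMA j:{1..J}. {u..<v j})"
    then obtain d j where p: "p = (d, j)" "j \<in> {1..J}" "u \<le> d" "d < v j" by auto
    then show "p \<in> P" unfolding P using le_D[of j d] u[of d] v(2)[of d j] by auto
  qed
  show fin: "finite P" unfolding P_eq by auto
  have sum_P: "(\<Sum>(d, j)\<in>P. f d j) = (\<Sum>j=1..J. \<Sum>d=u..<v j. f d j)" for f :: "nat \<Rightarrow> nat \<Rightarrow> 'b::comm_monoid_add"
    unfolding P_eq by (subst sum.reindex) (auto simp: inj_on_def sum.Sigma case_prod_unfold)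
  have J: "real J \<le> Z / r ^ 16" unfolding J_def using Z r_pow[of 16] by simp
  have "Z / r ^ 16 \<le> Z / 1" using Z r_pow[of 16] by (intro divide_left_mono) auto
  then have J2: "real J \<le> 2 * x" using J Zx x_ge_2 by linarith
  have D2: "(\<Sum>j=1..J. (D j)\<^sup>2) \<le> Z * L"
  proof -
    have "(\<Sum>j=1..J. (D j)\<^sup>2) = Z * (\<Sum>j=1..J. 1 / real j)"
      using Z by (simp add: D_def sum_distrib_left)
    also have "\<dots> \<le> Z * L" using Z J2 by (intro mult_left_mono harm_le_L) auto
    finally show ?thesis .
  qed
  show "(\<Sum>(d, j)\<in>P. real d) \<le> Z * L"
  proof -
    have "(\<Sum>(d, j)\<in>P. real d) = (\<Sum>j=1..J. \<Sum>d=u..<v j. real d)" by (rule sum_P)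
    also have "\<dots> \<le> (\<Sum>j=1..J. (D j)\<^sup>2)"
    proof (rule sum_mono)
      fix j
      have "(\<Sum>d=u..<v j. real d) \<le> (\<Sum>d=u..<v j. D j)"
        by (intro sum_mono) (use v in auto)
      also have "\<dots> = real (v j - u) * D j" by simp
      also have "\<dots> \<le> D j * D j"
      proof (intro mult_right_mono D0)
        have "1 \<le> u" by (simp add: u_def)
        then show "real (v j - u) \<le> D j" using v(1)[of j] D0[of j] by linarith
      qed
      finally show "(\<Sum>d=u..<v j. real d) \<le> (D j)\<^sup>2" by (simp add: power2_eq_square)
    qed
    also note D2
    finally show ?thesis .
  qed
  have W0: "0 \<le> W s j" for s j unfolding W_def using D0 by (auto intro!: add_nonneg_nonneg sum_nonneg cap_nonneg)
  have inner: "norm (\<Sum>(d, j)\<in>P. of_real (real d) * e_char (real s * (\<alpha> * real (d^2 * j)))) \<le> (\<Sum>j=1..J. D j * sqrt (W s j))" for s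
  proof -
    have "(\<Sum>(d, j)\<in>P. of_real (real d) * e_char (real s * (\<alpha> * real (d^2 * j))))
        = (\<Sum>j=1..J. \<Sum>d=u..<v j. of_nat d * e_char ((real s * \<alpha> * real j) * (real d)\<^sup>2))"
      by (subst sum_P) (simp add: mult_ac)
    also have "norm \<dots> \<le> (\<Sum>j=1..J. D j * sqrt (W s j))"
      unfolding W_def using v D0 by (intro order_trans[OF norm_sum] sum_mono weyl_weighted)
    finally show ?thesis .
  qed
  let ?K = "{1..<Y} \<times> {1..J}"
  have Y1: "real (Y - 1) \<le> real Y" by simp
  have WW: "(\<Sum>(s, j)\<in>?K. W s j) \<le> 33 * x * L ^ 9 / r ^ 4"
  proof -
    have D1: "(\<Sum>(s, j)\<in>?K. D j) \<le> x * L / r ^ 8"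
    proof -
      have "(\<Sum>j=1..J. D j) \<le> (\<Sum>j=1..J. (D j)\<^sup>2 / r ^ 8)"
      proof (rule sum_mono)
        fix j assume j: "j \<in> {1..J}"
        have "D j * r ^ 8 \<le> D j * D j" using D_ge[OF j] D0 by (intro mult_left_mono)
        then show "D j \<le> (D j)\<^sup>2 / r ^ 8" using r_pow(2)[of 8] by (simp add: field_simps power2_eq_square)
      qed
      also have "\<dots> = (\<Sum>j=1..J. (D j)\<^sup>2) / r ^ 8" by (simp add: sum_divide_distrib)
      also have "\<dots> \<le> Z * L / r ^ 8" using D2 r_pow(2)[of 8] by (intro divide_right_mono) auto
      finally have *: "(\<Sum>j=1..J. D j) \<le> Z * L / r ^ 8" .
      have "(\<Sum>(s, j)\<in>?K. D j) = real (Y - 1) * (\<Sum>j=1..J. D j)"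
        by (simp flip: sum.cartesian_product)
      also have "\<dots> \<le> real Y * (Z * L / r ^ 8)"
        using Z L_ge_2 by (intro mult_mono * Y1) (auto intro!: sum_nonneg D0)
      also have "\<dots> = (real Y * Z) * L / r ^ 8" by simp
      also have "\<dots> \<le> x * L / r ^ 8" using Z L_ge_2 r_pow[of 8] by (intro divide_right_mono mult_right_mono) auto
      finally show ?thesis .
    qed
    \<comment> \<open>The factor 2 of the differenced frequency goes into the first coordinate, so
      that the phase is alpha times the product of the triple.\<close>
    define T where "T = (\<lambda>((s, j), k). (2 * s, j, k)) ` (SIGMA p:?K. {1..<v (snd p)})"
    have inj: "inj_on (\<lambda>((s, j), k). (2 * s, j, k)) (SIGMA p:?K. {1..<v (snd p)})" by (auto simp: inj_on_def)
    \<comment> \<open>s j k D_j <= Y j D_j^2 = Y Z <= x. Hence D_j may be raised to 2 x / (2 s j k),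
      a function of the product alone, and D_j >= r^8 keeps the product below 2 x / r^8.\<close>
    have key: "real (s * j * k) * D j \<le> x" "real (2 * s * j * k) \<le> 2 * x / r ^ 8"
      if "s \<in> {1..<Y}" "j \<in> {1..J}" "k \<in> {1..<v j}" for s j k
    proof -
      have k: "real k \<le> D j" using that v by simp
      have "real (s * j * k) * D j = real s * real j * real k * D j" by simp
      also have "\<dots> \<le> real Y * real j * D j * D j" using that k D0 by (intro mult_mono) auto
      also have "\<dots> = real Y * (real j * (D j)\<^sup>2)" by (simp add: power2_eq_square)
      also have "real j * (D j)\<^sup>2 = Z" using that Z by (simp add: D_def)
      finally show 1: "real (s * j * k) * D j \<le> x" using Z by linarith
      have "real (s * j * k) * r ^ 8 \<le> real (s * j * k) * D j" using D_ge that by (intro mult_left_mono) auto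
      then have "real (s * j * k) * r ^ 8 \<le> x" using 1 by linarith
      then show "real (2 * s * j * k) \<le> 2 * x / r ^ 8" using r_pow(2)[of 8] by (simp add: field_simps)
    qed
    define n where "n = nat \<lfloor>2 * x / r ^ 8\<rfloor>"
    have n: "real n \<le> 2 * x / r ^ 8" unfolding n_def using x_ge_2 r_pow[of 8] by simp
    have "(\<Sum>(s, j)\<in>?K. \<Sum>k=1..<v j. cap (D j) (2 * (real s * \<alpha> * real j) * real k))
        \<le> (\<Sum>(s, j)\<in>?K. \<Sum>k=1..<v j. cap (2 * x / real (2 * s * j * k)) (\<alpha> * real (2 * s * j * k)))"
    proof (clarify intro!: sum_mono, clarsimp simp del: of_nat_mult)
      fix s j k assume "Suc 0 \<le> s" "s < Y" "Suc 0 \<le> j" "j \<le> J" "Suc 0 \<le> k" "k < v j"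
      then have sjk: "s \<in> {1..<Y}" "j \<in> {1..J}" "k \<in> {1..<v j}" by auto
      then have pos: "0 < real (s * j * k)" by simp
      have "D j \<le> 2 * x / real (2 * s * j * k)" using key(1)[OF sjk] pos by (simp add: field_simps)
      moreover have "2 * (real s * \<alpha> * real j) * real k = \<alpha> * real (2 * s * j * k)" by simp
      ultimately show "cap (D j) (2 * (real s * \<alpha> * real j) * real k) \<le> cap (2 * x / real (2 * s * j * k)) (\<alpha> * real (2 * s * j * k))"
        using D0 by (simp only:) (rule cap_mono)
    qed
    also have "\<dots> = (\<Sum>(s, j, k)\<in>T. cap (2 * x / real (s * j * k)) (\<alpha> * real (s * j * k)))"
      unfolding T_def by (subst sum.reindex[OF inj]) (simp add: sum.Sigma case_prod_unfold)
    also have "\<dots> \<le> (\<Sum>m=1..n. (tau m)\<^sup>2 * cap (2 * x / m) (\<alpha> * real m))"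
    proof (rule sum_triples_le_tau)
      fix s j k assume "(s, j, k) \<in> T"
      then obtain s' where s': "s = 2 * s'" "s' \<in> {1..<Y}" "j \<in> {1..J}" "k \<in> {1..<v j}" by (auto simp: T_def)
      then have "real (s * j * k) \<le> 2 * x / r ^ 8" using key(2)[of s' j k] by simp
      then have "s * j * k \<le> n" unfolding n_def by (rule le_nat_floor)
      then show "0 < s * j * k \<and> s * j * k \<le> n" using s' by auto
    qed (use x_ge_2 in \<open>auto simp: T_def intro!: cap_nonneg\<close>)
    also have "\<dots> \<le> 16 * x * L ^ 9 / r ^ 4" by (rule weighted_sum_cap_le[OF n])
    finally have T2: "(\<Sum>(s, j)\<in>?K. \<Sum>k=1..<v j. cap (D j) (2 * (real s * \<alpha> * real j) * real k)) \<le> 16 * x * L ^ 9 / r ^ 4" .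
    have "(\<Sum>(s, j)\<in>?K. W s j) = (\<Sum>(s, j)\<in>?K. D j) + 2 * (\<Sum>(s, j)\<in>?K. \<Sum>k=1..<v j. cap (D j) (2 * (real s * \<alpha> * real j) * real k))"
      by (simp add: W_def case_prod_unfold sum.distrib sum_distrib_left)
    also have "\<dots> \<le> x * L / r ^ 8 + 2 * (16 * x * L ^ 9 / r ^ 4)" using D1 T2 by linarith
    also have "x * L / r ^ 8 \<le> x * L ^ 9 / r ^ 4"
      using x_ge_2 L_ge_2 r r_pow[of 4] L_pow_mono[of 1 9]
      by (intro frac_le mult_left_mono power_increasing) auto
    finally show ?thesis by (simp add: field_simps)
  qed
  have DD: "(\<Sum>(s, j)\<in>?K. (D j)\<^sup>2) \<le> x * L"
  proof -
    have "(\<Sum>(s, j)\<in>?K. (D j)\<^sup>2) = real (Y - 1) * (\<Sum>j=1..J. (D j)\<^sup>2)"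
      by (simp flip: sum.cartesian_product)
    also have "\<dots> \<le> real Y * (Z * L)" using Z L_ge_2 by (intro mult_mono D2 Y1) (auto intro!: sum_nonneg)
    also have "\<dots> = (real Y * Z) * L" by simp
    also have "\<dots> \<le> x * L" using Z L_ge_2 by (intro mult_right_mono) auto
    finally show ?thesis .
  qed
  have "?S
      \<le> (\<Sum>s=1..<Y. \<Sum>j=1..J. D j * sqrt (W s j))" by (intro sum_mono inner)
  also have "\<dots> = (\<Sum>p\<in>?K. D (snd p) * sqrt (W (fst p) (snd p)))" by (simp add: sum.cartesian_product case_prod_unfold)
  finally have 1: "?S
      \<le> (\<Sum>p\<in>?K. D (snd p) * sqrt (W (fst p) (snd p)))" .
  \<comment> \<open>The first factor is bounded trivially by \<open>DD\<close>; the saving r^4 sits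
    entirely in \<open>WW\<close>.\<close>
  have "(\<Sum>p\<in>?K. D (snd p) * sqrt (W (fst p) (snd p)))\<^sup>2 \<le> (\<Sum>p\<in>?K. (D (snd p))\<^sup>2) * (\<Sum>p\<in>?K. (sqrt (W (fst p) (snd p)))\<^sup>2)"
    by (rule Cauchy_Schwarz_sum_real)
  also have "\<dots> = (\<Sum>(s, j)\<in>?K. (D j)\<^sup>2) * (\<Sum>(s, j)\<in>?K. W s j)" using W0 by (simp add: case_prod_unfold)
  also have "\<dots> \<le> (x * L) * (33 * x * L ^ 9 / r ^ 4)"
    using x_ge_2 L_ge_2 W0 by (intro mult_mono DD WW) (auto intro!: sum_nonneg)
  also have "\<dots> = 33 * (x * L ^ 5 / r ^ 2)\<^sup>2"
    by (simp add: power_mult_distrib power_divide flip: power_mult) (simp add: power2_eq_square eval_nat_numeral)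
  also have "\<dots> \<le> (6 * (x * L ^ 5 / r ^ 2))\<^sup>2" unfolding power_mult_distrib by simp
  finally have "(\<Sum>p\<in>?K. D (snd p) * sqrt (W (fst p) (snd p))) \<le> 6 * (x * L ^ 5 / r ^ 2)"
    by (rule power2_le_imp_le) (use x_ge_2 L_ge_2 in \<open>auto intro!: mult_nonneg_nonneg divide_nonneg_nonneg\<close>)
  then show "?S \<le> 6 * x * L ^ 5 / r ^ 2"
    using 1 by simp
qed


section \<open>The sum of minima over pairs, split according to the size of d\<close>

definition small_pairs :: "(nat \<times> nat) set" where
  "small_pairs = {(d, j). 0 < d \<and> 0 < j \<and> real (d^2 * j) \<le> x / r ^ 24}"

lemma small_pairs_bounds:
  assumes "(d, j) \<in> small_pairs"
  shows "0 < d" "0 < j" "real (d^2 * j) \<le> x / r ^ 24" "real (d^2 * j) \<le> x" "real d \<le> x" "real j \<le> x"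
proof -
  show 1: "0 < d" "0 < j" "real (d^2 * j) \<le> x / r ^ 24" using assms by (auto simp: small_pairs_def)
  show 2: "real (d^2 * j) \<le> x" using 1 x_div_r_le[of 24] by linarith
  have "d * 1 \<le> d * (d * j)" "1 * j \<le> d\<^sup>2 * j" using 1 by (auto intro!: mult_le_mono simp: Suc_le_eq)
  then have "d \<le> d\<^sup>2 * j" "j \<le> d\<^sup>2 * j" by (auto simp: power2_eq_square mult.assoc)
  then show "real d \<le> x" "real j \<le> x" using 2 by (meson of_nat_le_iff order_trans)+
qed

lemma small_pairs_subset: "small_pairs \<subseteq> {1..nat \<lfloor>x\<rfloor>} \<times> {1..nat \<lfloor>x\<rfloor>}"
  using small_pairs_bounds(1,2,5,6) by (auto simp: Suc_le_eq intro!: le_nat_floor)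

lemma finite_small_pairs: "finite small_pairs"
  by (rule finite_subset[OF small_pairs_subset]) auto

text \<open>For each d the argument d^2 j is relaxed to an arbitrary integer up to x / r^24, and
  \<open>sum_cap_le\<close> applies. Weight and number of the d cost r^16 in total.\<close>

lemma sum_cap_pairs_small_d:
  "(\<Sum>(d, j)\<in>{(d, j)\<in>small_pairs. real d \<le> r ^ 8}. real d * cap_at (d^2 * j))
    \<le> 72 * x * L ^ 6 / r ^ 2"
proof -
  let ?P = "{(d, j)\<in>small_pairs. real d \<le> r ^ 8}"
  define c where "c n = cap_at n" for n :: nat
  have c0: "0 \<le> c n" for n unfolding c_def using x_ge_2 by (intro cap_nonneg) auto
  define n where "n = nat \<lfloor>x / r ^ 24\<rfloor>"
  define m where "m = nat \<lfloor>r ^ 8\<rfloor>"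
  have n: "real n \<le> x / r ^ 24" unfolding n_def using x_ge_2 r_pow[of 24] by simp
  have m: "real m \<le> r ^ 8" unfolding m_def using r_pow[of 8] by simp
  have "(\<Sum>(d, j)\<in>?P. real d * c (d^2 * j)) \<le> (\<Sum>(d, k)\<in>{1..m} \<times> {1..n}. r ^ 8 * c k)"
  proof (rule sum_le_included[where i = "\<lambda>(d, k). (d, k div d\<^sup>2)"])
    show "\<forall>p\<in>?P. \<exists>y\<in>{1..m} \<times> {1..n}. (case y of (d, k) \<Rightarrow> (d, k div d\<^sup>2)) = p \<and>
       (case p of (d, j) \<Rightarrow> real d * c (d^2 * j)) \<le> (case y of (d, k) \<Rightarrow> r ^ 8 * c k)" (is "\<forall>p\<in>_. ?R p")
    proof
      fix p assume "p \<in> ?P"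
      then obtain d j where p: "p = (d, j)" "(d, j) \<in> small_pairs" "real d \<le> r ^ 8" by auto
      note b = small_pairs_bounds[OF p(2)]
      have "d \<le> m" unfolding m_def using p by (intro le_nat_floor)
      moreover have "d\<^sup>2 * j \<le> n" unfolding n_def using b by (intro le_nat_floor)
      ultimately show "?R p"
        using b p by (intro bexI[of _ "(d, d\<^sup>2 * j)"]) (auto intro!: mult_right_mono c0 simp: Suc_le_eq)
    qed
  qed (use c0 r in \<open>auto intro!: finite_subset[OF _ finite_small_pairs] mult_nonneg_nonneg\<close>)
  also have "\<dots> = real m * r ^ 8 * (\<Sum>k=1..n. c k)"
    by (simp add: mult_ac flip: sum.cartesian_product sum_distrib_left sum_distrib_right)
  also have "\<dots> \<le> r ^ 8 * r ^ 8 * (72 * L * (x / r ^ 24))"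
  proof (intro mult_mono m)
    have "(\<Sum>k=1..n. c k) \<le> 24 * (1 + ln x) * (x / q + n + q)"
      unfolding c_def
      by (rule sum_cap_le) (use co approx q_ge_2 q_le_x n x_div_r_le[of 24] in auto)
    also have "\<dots> \<le> 24 * L * (3 * (x / r ^ 24))"
      using x_div_q q_upper n x_ge_2 L_ge_2 by (intro mult_mono) (auto simp: L_def)
    finally show "(\<Sum>k=1..n. c k) \<le> 72 * L * (x / r ^ 24)" by simp
  qed (use r in \<open>auto intro!: sum_nonneg c0\<close>)
  also have "\<dots> = 72 * (x / r ^ 8) * L" 
    using r_pow(2)[of 1] by (simp add: field_simps flip: power_add)
  also have "\<dots> \<le> 72 * (x / r ^ 2) * L ^ 6"
    using x_div_r_mono[of 2 8] L_pow_mono[of 1 6] x_ge_2 L_ge_2 r_pow(2)[of 2] by (intro mult_mono) auto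
  finally show ?thesis by (simp add: c_def)
qed

text \<open>At Fejer scale 2^i only pairs with d^2 j <= x / 2^i occur, which is the condition Y Z <=
  x of \<open>weyl_double_sum_le\<close> with Y = 2^i and Z = \<open>Z i\<close>. The constant Fejer
  term is small because \<open>Z i\<close> is at most x / r^24, and the number of scales costs a
  factor 2 L.\<close>

lemma sum_cap_pairs_large_d:
  "(\<Sum>(d, j)\<in>{(d, j)\<in>small_pairs. r ^ 8 < real d}. real d * cap_at (d^2 * j))
    \<le> 1248 * x * L ^ 6 / r ^ 2"
proof -
  let ?P = "{(d, j)\<in>small_pairs. r ^ 8 < real d}"
  let ?v = "\<lambda>p. real ((fst p)\<^sup>2 * snd p)"
  have finP: "finite ?P" by (rule finite_subset[OF _ finite_small_pairs]) auto
  obtain I :: nat where I: "x < 2 ^ I" "real I \<le> 2 * L" by (rule exists_dyadic_length)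
  define Z where "Z i = min (x / r ^ 24) (x / 2 ^ i)" for i :: nat
  define Q where "Q i = {(d, j). r ^ 8 < real d \<and> 0 < j \<and> real (d^2 * j) \<le> Z i}" for i
  have Z: "0 \<le> Z i" "Z i \<le> x / r ^ 24" "real (2 ^ i) * Z i \<le> x" for i
  proof -
    show "0 \<le> Z i" "Z i \<le> x / r ^ 24" using x_ge_2 r_pow(2)[of 24] by (auto simp: Z_def)
    have "real (2 ^ i) * Z i \<le> real (2 ^ i) * (x / 2 ^ i)" by (intro mult_left_mono) (auto simp: Z_def)
    then show "real (2 ^ i) * Z i \<le> x" by simp
  qed
  have Q_eq: "Q i = {p\<in>?P. 2 ^ i \<le> x / ?v p}" for i
  proof -
    have "(d, j) \<in> Q i \<longleftrightarrow> (d, j) \<in> ?P \<and> 2 ^ i \<le> x / real (d^2 * j)" for d j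
    proof (cases "r ^ 8 < real d \<and> 0 < j")
      case True
      then have "0 < real d" using r_pow(2)[of 8] by linarith
      then have "0 < real (d^2 * j)" using True by simp
      then have "2 ^ i \<le> x / real (d^2 * j) \<longleftrightarrow> real (d^2 * j) \<le> x / 2 ^ i" by (simp add: field_simps)
      then show ?thesis using True \<open>0 < real d\<close> by (auto simp: Q_def Z_def small_pairs_def)
    qed (auto simp: Q_def small_pairs_def)
    then show ?thesis by auto
  qed
  have level: "(\<Sum>(d, j)\<in>Q i. real d * fejer (2 ^ i) (\<alpha> * real (d^2 * j))) \<le> 13 * (x * L ^ 5 / r ^ 2)" for i
  proof -
    have "(\<Sum>p\<in>Q i. real (fst p) * fejer (2 ^ i) (\<alpha> * ?v p))
      \<le> (\<Sum>p\<in>Q i. real (fst p)) + 2 * (\<Sum>s=1..<2 ^ i. norm (\<Sum>p\<in>Q i. of_real (real (fst p)) * e_char (real s * (\<alpha> * ?v p))))"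
      by (rule sum_fejer_le) simp
    also have "\<dots> \<le> Z i * L + 2 * (6 * x * L ^ 5 / r ^ 2)"
      using weyl_double_sum_le[OF _ Z(1) Z(3) Q_def, of i] unfolding case_prod_unfold
      by (intro add_mono mult_left_mono) auto
    also have "Z i * L \<le> x * L ^ 5 / r ^ 2"
    proof -
      have "Z i * L \<le> (x / r ^ 2) * L ^ 5"
        using Z(2)[of i] x_div_r_mono[of 2 24] L_pow_mono[of 1 5] x_ge_2 L_ge_2 r_pow(2)[of 2]
        by (intro mult_mono) auto
      then show ?thesis by simp
    qed
    finally show ?thesis by (simp add: case_prod_unfold)
  qed
  have "(\<Sum>p\<in>?P. real (fst p) * cap (x / ?v p) (\<alpha> * ?v p))
      \<le> (\<Sum>p\<in>?P. real (fst p) * (48 * (\<Sum>i\<in>{i\<in>{..<I}. 2 ^ i \<le> x / ?v p}. fejer (2 ^ i) (\<alpha> * ?v p))))"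
  proof (intro sum_mono mult_left_mono cap_le_sum_fejer)
    fix p assume "p \<in> ?P"
    then have b: "(fst p, snd p) \<in> small_pairs" by auto
    have pos: "1 \<le> ?v p" using small_pairs_bounds(1,2)[OF b]
      by (metis One_nat_def Suc_leI nat_0_less_mult_iff of_nat_1 of_nat_le_iff zero_less_power)
    show "1 \<le> x / ?v p" using small_pairs_bounds(4)[OF b] pos by simp
    have "x / ?v p \<le> x / 1" using pos x_ge_2 by (intro divide_left_mono) auto
    then show "x / ?v p < 2 ^ I" using I by linarith
  qed simp
  also have "\<dots> = 48 * (\<Sum>p\<in>?P. \<Sum>i\<in>{i\<in>{..<I}. 2 ^ i \<le> x / ?v p}. real (fst p) * fejer (2 ^ i) (\<alpha> * ?v p))"
    by (simp add: sum_distrib_left mult_ac)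
  also have "\<dots> = 48 * (\<Sum>i\<in>{..<I}. \<Sum>p\<in>Q i. real (fst p) * fejer (2 ^ i) (\<alpha> * ?v p))"
    unfolding Q_eq by (subst sum.swap_restrict[OF finP]) auto
  also have "\<dots> \<le> 48 * (\<Sum>i\<in>{..<I}. 13 * (x * L ^ 5 / r ^ 2))"
    using level by (intro mult_left_mono sum_mono) (auto simp: case_prod_unfold)
  also have "\<dots> = 48 * (real I * (13 * (x * L ^ 5 / r ^ 2)))" by simp
  also have "\<dots> \<le> 48 * (2 * L * (13 * (x * L ^ 5 / r ^ 2)))"
    using I x_ge_2 L_ge_2 r_pow(2)[of 2] by (intro mult_left_mono mult_right_mono) auto
  also have "\<dots> = 1248 * x * L ^ 6 / r ^ 2" by (simp add: eval_nat_numeral)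
  finally show ?thesis by (simp add: case_prod_unfold)
qed

text \<open>The divisor weights are restored by Cauchy-Schwarz: the sum with tau(j)^4 is bounded
  trivially, the sum without tau by the two preceding lemmas.\<close>

lemma sum_cap_pairs:
  "(\<Sum>(d, j)\<in>small_pairs. real d * (tau j)^2 * cap_at (d^2 * j)) \<le> 37 * x * L ^ 12 / r"
proof -
  define w where "w p = real (fst p) * cap_at ((fst p)\<^sup>2 * snd p)" for p :: "nat \<times> nat"
  have w0: "0 \<le> w p" for p unfolding w_def using x_ge_2 by (auto intro!: mult_nonneg_nonneg cap_nonneg)
  have B: "(\<Sum>p\<in>small_pairs. w p) \<le> 1320 * (x * L ^ 6 / r ^ 2)"
  proof -
    have "small_pairs = {(d, j)\<in>small_pairs. real d \<le> r ^ 8} \<union> {(d, j)\<in>small_pairs. r ^ 8 < real d}" by auto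
    then have "(\<Sum>p\<in>small_pairs. w p) = (\<Sum>p\<in>{(d, j)\<in>small_pairs. real d \<le> r ^ 8} \<union> {(d, j)\<in>small_pairs. r ^ 8 < real d}. w p)"
      by simp
    also have "\<dots> = (\<Sum>p\<in>{(d, j)\<in>small_pairs. real d \<le> r ^ 8}. w p) + (\<Sum>p\<in>{(d, j)\<in>small_pairs. r ^ 8 < real d}. w p)"
      by (rule sum.union_disjoint) (auto intro!: finite_subset[OF _ finite_small_pairs])
    also have "\<dots> \<le> 72 * x * L ^ 6 / r ^ 2 + 1248 * x * L ^ 6 / r ^ 2"
      using sum_cap_pairs_small_d sum_cap_pairs_large_d unfolding w_def case_prod_unfold by (rule add_mono)
    finally show ?thesis by simp
  qed
  have A: "(\<Sum>p\<in>small_pairs. w p * ((tau (snd p))\<^sup>2)\<^sup>2) \<le> x * L ^ 17"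
  proof -
    define n where "n = nat \<lfloor>x\<rfloor>"
    have n: "real n \<le> 2 * x" using x_ge_2 unfolding n_def by linarith
    have "(\<Sum>p\<in>small_pairs. w p * ((tau (snd p))\<^sup>2)\<^sup>2) \<le> (\<Sum>p\<in>small_pairs. x * ((1 / real (fst p)) * (tau (snd p) ^ 4 / real (snd p))))"
    proof (rule sum_mono)
      fix p assume "p \<in> small_pairs"
      then have b: "(fst p, snd p) \<in> small_pairs" by simp
      have "w p \<le> real (fst p) * (x / real ((fst p)\<^sup>2 * snd p))"
        unfolding w_def using x_ge_2 by (intro mult_left_mono cap_le) auto
      also have "\<dots> = x * (1 / real (fst p) * (1 / real (snd p)))"
        using small_pairs_bounds(1,2)[OF b] by (simp add: power2_eq_square)
      finally have "w p * tau (snd p) ^ 4 \<le> x * (1 / real (fst p) * (1 / real (snd p))) * tau (snd p) ^ 4"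
        by (intro mult_right_mono) auto
      then show "w p * ((tau (snd p))\<^sup>2)\<^sup>2 \<le> x * ((1 / real (fst p)) * (tau (snd p) ^ 4 / real (snd p)))"
        by (simp flip: power_mult)
    qed
    also have "\<dots> \<le> (\<Sum>p\<in>{1..n} \<times> {1..n}. x * ((1 / real (fst p)) * (tau (snd p) ^ 4 / real (snd p))))"
      using small_pairs_subset x_ge_2 unfolding n_def by (intro sum_mono2) auto
    also have "\<dots> = x * ((\<Sum>d=1..n. 1 / real d) * (\<Sum>j=1..n. tau j ^ 4 / real j))"
      by (subst sum_distrib_left[symmetric], subst sum_product) (simp add: sum.cartesian_product case_prod_unfold)
    also have "\<dots> \<le> x * (L * L ^ (2 ^ 4))"
      using x_ge_2 L_ge_2 by (intro mult_left_mono mult_mono sum_tau_power_le harm_le_L n) (auto intro!: sum_nonneg)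
    also have "L * L ^ (2 ^ 4) = L ^ 17" by (simp flip: power_Suc)
    finally show ?thesis .
  qed
  have "(\<Sum>p\<in>small_pairs. w p * (tau (snd p))\<^sup>2)\<^sup>2 \<le> (\<Sum>p\<in>small_pairs. w p * ((tau (snd p))\<^sup>2)\<^sup>2) * (\<Sum>p\<in>small_pairs. w p)"
    by (rule Cauchy_Schwarz_weighted) (rule w0)
  also have "\<dots> \<le> (x * L ^ 17) * (1320 * (x * L ^ 6 / r ^ 2))"
    using x_ge_2 L_ge_2 by (intro mult_mono A B) (auto intro!: sum_nonneg w0 mult_nonneg_nonneg)
  also have "\<dots> = 1320 * (x / r)\<^sup>2 * L ^ 23"
    by (simp add: power2_eq_square flip: power_add)
  \<comment> \<open>1320 <= 37^2 = 1369, and a spare factor L makes the exponent even, so that the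
    bound is a perfect square.\<close>
  also have "\<dots> \<le> 1369 * (x / r)\<^sup>2 * L ^ 24"
    using L_pow_mono[of 23 24] L_ge_2 by (intro mult_mono) auto
  also have "\<dots> = (37 * x * L ^ 12 / r)\<^sup>2"
    by (simp add: power_mult_distrib power_divide flip: power_mult)
  finally have "(\<Sum>p\<in>small_pairs. w p * (tau (snd p))\<^sup>2) \<le> 37 * x * L ^ 12 / r"
    by (rule power2_le_imp_le) (use x_ge_2 L_ge_2 r in \<open>auto intro!: divide_nonneg_nonneg mult_nonneg_nonneg\<close>)
  then show ?thesis by (simp add: w_def case_prod_unfold mult_ac)
qed

end

section \<open>Correlations of bilinear sums in progressions\<close>

text \<open>In the applications A is cut out by inequalities on products. Convexity makes it an
  interval without computing its ends, and B is a residue class inside it, possibly empty.\<close>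

lemma norm_sum_e_char_convex_cong_le_cap:
  fixes A B :: "nat set"
  assumes A: "A \<subseteq> {lo..<hi}" "\<And>i j k. i \<in> A \<Longrightarrow> k \<in> A \<Longrightarrow> i \<le> j \<Longrightarrow> j \<le> k \<Longrightarrow> j \<in> A"
    and B: "B \<subseteq> A" "\<And>m m'. m \<in> B \<Longrightarrow> m' \<in> A \<Longrightarrow> m' \<in> B \<longleftrightarrow> [m' = m] (mod W)"
    and W: "0 < W" and H: "(real hi - real lo) / real W + 1 \<le> H" "0 \<le> H"
  shows "norm (\<Sum>m\<in>B. e_char (t * real m)) \<le> cap H (t * real W)"
proof (cases "B = {}")
  case True
  then show ?thesis using H by (simp add: cap_nonneg)
next
  case False
  then obtain m0 where m0: "m0 \<in> B" by auto
  have fin: "finite A" using A(1) finite_subset by blast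
  have ne: "A \<noteq> {}" using m0 B by auto
  define u v where "u = Min A" and "v = Suc (Max A)"
  have uv: "u \<in> A" "Max A \<in> A" using fin ne by (auto simp: u_def)
  have A_eq: "A = {u..<v}"
  proof (intro equalityI subsetI)
    fix j assume "j \<in> A"
    then show "j \<in> {u..<v}" using fin by (auto simp: u_def v_def less_Suc_eq_le)
  next
    fix j assume "j \<in> {u..<v}"
    then show "j \<in> A" using A(2)[OF uv, of j] by (auto simp: v_def)
  qed
  have B_eq: "B = {m\<in>{u..<v}. [m = m0] (mod W)}"
    using B m0 unfolding A_eq by blast
  have "lo \<le> u" "v \<le> hi" using A(1) uv unfolding v_def by auto
  then have "(real v - real u) / real W \<le> (real hi - real lo) / real W" by (intro divide_right_mono) auto
  then show ?thesis unfolding B_eq using W H by (intro norm_sum_e_char_cong_le_cap) auto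
qed

text \<open>Because b is a unit modulo d, so are m and n; for fixed n the solutions m therefore form
  a single class.\<close>

lemma cong_mult_cancel_coprime_target:
  fixes b :: int and d n m m' :: nat
  assumes b: "coprime (int d) b" and m: "[int (m * n) = b] (mod int d)"
  shows "[int (m' * n) = b] (mod int d) \<longleftrightarrow> [m' = m] (mod d)"
    and "coprime m d"
proof -
  have "coprime b (int d)" using b by (simp add: coprime_commute)
  then have "coprime (int (m * n)) (int d)"
    using m cong_imp_coprime[of b "int (m * n)" "int d"] by (simp add: cong_sym)
  then have c: "coprime n d" "coprime m d" by auto
  then show "coprime m d" by simp
  have "[int (m' * n) = b] (mod int d) \<longleftrightarrow> [int (m' * n) = int (m * n)] (mod int d)"
    using m by (meson cong_sym cong_trans)
  also have "\<dots> \<longleftrightarrow> [m' * n = m * n] (mod d)" by (rule cong_int_iff)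
  also have "\<dots> \<longleftrightarrow> [m' = m] (mod d)" using c by (intro cong_mult_rcancel_nat)
  finally show "[int (m' * n) = b] (mod int d) \<longleftrightarrow> [m' = m] (mod d)" .
qed

lemma cong_lcm_nat_iff:
  fixes a b c d :: nat
  shows "[a = b] (mod lcm c d) \<longleftrightarrow> [a = b] (mod c) \<and> [a = b] (mod d)"
proof -
  have "[a = b] (mod k) \<longleftrightarrow> int k dvd int a - int b" for k
    by (metis cong_iff_dvd_diff cong_int_iff)
  moreover have "int (lcm c d) = lcm (int c) (int d)" by simp
  ultimately show ?thesis by (metis lcm_least_iff)
qed

text \<open>Range and congruence are part of the summand, so that multiple sums run over fixed boxes
  and can be interchanged freely.\<close>

definition ap_term :: "real \<Rightarrow> nat \<Rightarrow> int \<Rightarrow> nat \<Rightarrow> nat \<Rightarrow> complex" where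
  "ap_term \<alpha> N b d n = (if N \<le> n \<and> n < 2 * N \<and> [int n = b] (mod int d) then e_char (\<alpha> * real n) else 0)"

text \<open>The two congruences put m into one class modulo the lcm. Modulo the gcd they both hold
  with m a unit, which forces n and n' to be congruent there. The length 2 M / lcm contains the
  additional 1, since lcm <= M.\<close>

lemma bilinear_correlation_le:
  fixes b :: int and d d' n n' M :: nat
  assumes b: "coprime (int d) b" "coprime (int d') b" and pos: "0 < d" "0 < d'"
    and W: "lcm d d' \<le> M"
  shows "norm (\<Sum>m=M..<2*M. ap_term \<alpha> N b d (m * n) * cnj (ap_term \<alpha> N b d' (m * n')))
    \<le> (if [n = n'] (mod gcd d d') then cap (2 * M / lcm d d') (\<alpha> * (real n - real n') * real (lcm d d')) else 0)"
proof -
  define A where "A = {m\<in>{M..<2*M}. N \<le> m * n \<and> m * n < 2 * N \<and> N \<le> m * n' \<and> m * n' < 2 * N}"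
  define B where "B = {m\<in>A. [int (m * n) = b] (mod int d) \<and> [int (m * n') = b] (mod int d')}"
  have Wpos: "0 < lcm d d'" using pos by (simp add: lcm_pos_nat)
  have "(\<Sum>m=M..<2*M. ap_term \<alpha> N b d (m * n) * cnj (ap_term \<alpha> N b d' (m * n')))
      = (\<Sum>m\<in>B. e_char (\<alpha> * real (m * n)) * cnj (e_char (\<alpha> * real (m * n'))))"
    by (rule sum.mono_neutral_cong_right) (auto simp: A_def B_def ap_term_def)
  also have "\<dots> = (\<Sum>m\<in>B. e_char ((\<alpha> * (real n - real n')) * real m))"
    unfolding cnj_e_char e_char_add[symmetric] by (simp add: algebra_simps)
  finally have eq: "(\<Sum>m=M..<2*M. ap_term \<alpha> N b d (m * n) * cnj (ap_term \<alpha> N b d' (m * n')))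
      = (\<Sum>m\<in>B. e_char ((\<alpha> * (real n - real n')) * real m))" .
  show ?thesis
  proof (cases "[n = n'] (mod gcd d d')")
    case True
    have "norm (\<Sum>m\<in>B. e_char ((\<alpha> * (real n - real n')) * real m)) \<le> cap (2 * M / lcm d d') ((\<alpha> * (real n - real n')) * real (lcm d d'))"
    proof (rule norm_sum_e_char_convex_cong_le_cap)
      show "A \<subseteq> {M..<2*M}" "B \<subseteq> A" by (auto simp: A_def B_def)
      show "j \<in> A" if "i \<in> A" "k \<in> A" "i \<le> j" "j \<le> k" for i j k
      proof -
        have "i * n \<le> j * n" "i * n' \<le> j * n'" "j * n \<le> k * n" "j * n' \<le> k * n'"
          using that by (auto intro: mult_le_mono1)
        moreover have "M \<le> i" "k < 2 * M" "N \<le> i * n" "N \<le> i * n'" "k * n < 2 * N" "k * n' < 2 * N"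
          using that by (auto simp: A_def)
        ultimately have "M \<le> j \<and> j < 2 * M \<and> N \<le> j * n \<and> j * n < 2 * N \<and> N \<le> j * n' \<and> j * n' < 2 * N"
          using that by linarith
        then show "j \<in> A" by (simp add: A_def)
      qed
      show "m' \<in> B \<longleftrightarrow> [m' = m] (mod lcm d d')" if "m \<in> B" "m' \<in> A" for m m'
      proof -
        have "[int (m * n) = b] (mod int d)" "[int (m * n') = b] (mod int d')" using that by (auto simp: B_def)
        then show ?thesis
          using cong_mult_cancel_coprime_target(1)[OF b(1), of m n m'] cong_mult_cancel_coprime_target(1)[OF b(2), of m n' m'] that(2)
          unfolding cong_lcm_nat_iff B_def by auto
      qed
      have "1 \<le> real M / real (lcm d d')" using W Wpos by simp
      then show "(real (2 * M) - real M) / real (lcm d d') + 1 \<le> 2 * M / lcm d d'" by simp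
    qed (use Wpos in auto)
    then show ?thesis unfolding eq using True by simp
  next
    case False
    have "B = {}"
    proof (rule ccontr)
      assume "B \<noteq> {}"
      then obtain m where m: "[int (m * n) = b] (mod int d)" "[int (m * n') = b] (mod int d')" by (auto simp: B_def)
      have co: "coprime m (gcd d d')"
        using cong_mult_cancel_coprime_target(2)[OF b(1) m(1)] by (meson coprime_divisors dvd_refl gcd_dvd1)
      have "[int (m * n) = b] (mod int (gcd d d'))" "[int (m * n') = b] (mod int (gcd d d'))"
        using m by (auto intro: cong_dvd_modulus)
      then have "[int (m * n) = int (m * n')] (mod int (gcd d d'))" by (meson cong_sym cong_trans)
      then have "[m * n = m * n'] (mod gcd d d')" unfolding cong_int_iff .
      then have "[n = n'] (mod gcd d d')" using co by (simp add: cong_mult_lcancel_nat)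
      then show False using False by simp
    qed
    then show ?thesis unfolding eq using False by simp
  qed
qed

text \<open>Write n' = n + G l or n' = n - G l. As the cap is even in its argument, both directions
  have the same bound, and n' = n costs at most H.\<close>

lemma sum_cap_cong_class_le:
  fixes n n1 G :: nat
  assumes G: "0 < G" and n: "n \<in> {1..n1}" and H: "0 \<le> H"
  shows "(\<Sum>n'\<in>{1..n1}. if [n = n'] (mod G) then cap H (\<beta> * (real n - real n')) else 0)
    \<le> H + 2 * (\<Sum>l=1..n1 div G. cap H (\<beta> * real (G * l)))"
proof -
  let ?k = "\<lambda>n'. cap H (\<beta> * (real n - real n'))"
  let ?S = "{n'\<in>{1..n1}. [n = n'] (mod G)}"
  let ?U = "(\<lambda>l. n + G * l) ` {1..n1 div G}" and ?V = "(\<lambda>l. n - G * l) ` {l\<in>{1..n1 div G}. G * l < n}"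
  have k0: "0 \<le> ?k n'" for n' using H by (rule cap_nonneg)
  have Un_le: "(\<Sum>n'\<in>A \<union> B. ?k n') \<le> (\<Sum>n'\<in>A. ?k n') + (\<Sum>n'\<in>B. ?k n')" if "finite A" "finite B" for A B
    using sum.union_inter[OF that, of ?k] sum_nonneg[of "A \<inter> B" ?k] k0 by simp
  have sub: "?S \<subseteq> {n} \<union> (?U \<union> ?V)"
  proof
    fix n' assume n': "n' \<in> ?S"
    consider "n' = n" | "n < n'" | "n' < n" by linarith
    then show "n' \<in> {n} \<union> (?U \<union> ?V)"
    proof cases
      case 2
      then have "G dvd n' - n" using n' by (metis (no_types, lifting) cong_altdef_nat cong_sym less_imp_le mem_Collect_eq)
      then obtain l where l: "n' - n = G * l" by (elim dvdE)
      then have "0 < l" "G * l \<le> n1" using 2 n' by (auto intro: gr0I)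
      then have "l \<le> n1 div G" using G by (simp add: less_eq_div_iff_mult_less_eq mult.commute)
      then have "n' \<in> ?U" using l 2 \<open>0 < l\<close> by (intro image_eqI[of _ _ l]) auto
      then show ?thesis by simp
    next
      case 3
      then have "G dvd n - n'" using n' by (metis (no_types, lifting) cong_altdef_nat less_imp_le mem_Collect_eq)
      then obtain l where l: "n - n' = G * l" by (elim dvdE)
      then have "0 < l" "G * l \<le> n1" "G * l < n" using 3 n n' by (auto intro: gr0I)
      then have "l \<le> n1 div G" using G by (simp add: less_eq_div_iff_mult_less_eq mult.commute)
      then have "n' \<in> ?V" using l 3 \<open>0 < l\<close> \<open>G * l < n\<close> by (intro image_eqI[of _ _ l]) auto
      then show ?thesis by simp
    qed simp
  qed
  have injU: "inj_on (\<lambda>l. n + G * l) {1..n1 div G}" using G by (auto simp: inj_on_def)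
  have injV: "inj_on (\<lambda>l. n - G * l) {l\<in>{1..n1 div G}. G * l < n}"
  proof (rule inj_onI)
    fix l l' assume "l \<in> {l\<in>{1..n1 div G}. G * l < n}" "l' \<in> {l\<in>{1..n1 div G}. G * l < n}" "n - G * l = n - G * l'"
    then have "G * l = G * l'" by (metis (no_types, lifting) diff_diff_cancel less_imp_le mem_Collect_eq)
    then show "l = l'" using G by simp
  qed
  have "(\<Sum>n'\<in>{1..n1}. if [n = n'] (mod G) then ?k n' else 0) = (\<Sum>n'\<in>?S. ?k n')"
    by (rule sum.mono_neutral_cong_right) auto
  also have "\<dots> \<le> (\<Sum>n'\<in>{n} \<union> (?U \<union> ?V). ?k n')" by (intro sum_mono2 sub k0) auto
  also have "\<dots> \<le> (\<Sum>n'\<in>{n}. ?k n') + (\<Sum>n'\<in>?U \<union> ?V. ?k n')"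
    by (rule Un_le) auto
  also have "(\<Sum>n'\<in>?U \<union> ?V. ?k n') \<le> (\<Sum>n'\<in>?U. ?k n') + (\<Sum>n'\<in>?V. ?k n')"
    by (rule Un_le) auto
  also have "(\<Sum>n'\<in>?U. ?k n') = (\<Sum>l=1..n1 div G. cap H (\<beta> * real (G * l)))"
  proof -
    have "\<beta> * (real n - real (n + G * l)) = - (\<beta> * real (G * l))" for l by (simp add: algebra_simps)
    then show ?thesis by (subst sum.reindex[OF injU]) (simp only: o_def cap_minus)
  qed
  also have "(\<Sum>n'\<in>?V. ?k n') = (\<Sum>l\<in>{l\<in>{1..n1 div G}. G * l < n}. cap H (\<beta> * real (G * l)))"
    by (subst sum.reindex[OF injV]) (auto intro!: sum.cong simp: of_nat_diff)
  also have "\<dots> \<le> (\<Sum>l=1..n1 div G. cap H (\<beta> * real (G * l)))"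
    using H by (intro sum_mono2) (auto intro: cap_nonneg)
  also have "(\<Sum>n'\<in>{n}. ?k n') \<le> H" using cap_le[OF H] by simp
  finally show ?thesis by simp
qed

text \<open>Schur test: y y' <= (y^2 + y'^2) / 2, and by symmetry both halves reduce to row
  sums.\<close>

lemma sum_symmetric_kernel_le:
  fixes y :: "nat \<Rightarrow> real" and \<kappa> :: "nat \<Rightarrow> nat \<Rightarrow> real"
  assumes sym: "\<And>n n'. \<kappa> n n' = \<kappa> n' n" and nonneg: "\<And>n n'. 0 \<le> \<kappa> n n'"
    and row: "\<And>n. n \<in> I \<Longrightarrow> (\<Sum>n'\<in>I. \<kappa> n n') \<le> K"
  shows "(\<Sum>n\<in>I. \<Sum>n'\<in>I. y n * y n' * \<kappa> n n') \<le> (\<Sum>n\<in>I. (y n)\<^sup>2) * K"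
proof -
  have "(\<Sum>n\<in>I. \<Sum>n'\<in>I. y n * y n' * \<kappa> n n') \<le> (\<Sum>n\<in>I. \<Sum>n'\<in>I. ((y n)\<^sup>2 / 2 * \<kappa> n n' + (y n')\<^sup>2 / 2 * \<kappa> n' n))"
  proof (intro sum_mono)
    fix n n'
    have "y n * y n' \<le> (y n)\<^sup>2 / 2 + (y n')\<^sup>2 / 2" using sum_squares_bound[of "y n" "y n'"] by simp
    then have "y n * y n' * \<kappa> n n' \<le> ((y n)\<^sup>2 / 2 + (y n')\<^sup>2 / 2) * \<kappa> n n'" by (intro mult_right_mono nonneg)
    then show "y n * y n' * \<kappa> n n' \<le> (y n)\<^sup>2 / 2 * \<kappa> n n' + (y n')\<^sup>2 / 2 * \<kappa> n' n"
      using sym[of n n'] by (simp add: algebra_simps)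
  qed
  also have "\<dots> = (\<Sum>n\<in>I. \<Sum>n'\<in>I. (y n)\<^sup>2 / 2 * \<kappa> n n') + (\<Sum>n\<in>I. \<Sum>n'\<in>I. (y n')\<^sup>2 / 2 * \<kappa> n' n)"
    by (simp add: sum.distrib)
  also have "(\<Sum>n\<in>I. \<Sum>n'\<in>I. (y n')\<^sup>2 / 2 * \<kappa> n' n) = (\<Sum>n\<in>I. \<Sum>n'\<in>I. (y n)\<^sup>2 / 2 * \<kappa> n n')"
    by (rule sum.swap)
  also have "(\<Sum>n\<in>I. \<Sum>n'\<in>I. (y n)\<^sup>2 / 2 * \<kappa> n n') + (\<Sum>n\<in>I. \<Sum>n'\<in>I. (y n)\<^sup>2 / 2 * \<kappa> n n')
      = (\<Sum>n\<in>I. (y n)\<^sup>2 * (\<Sum>n'\<in>I. \<kappa> n n'))"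
    unfolding sum.distrib[symmetric] sum_distrib_left by (intro sum.cong) auto
  also have "\<dots> \<le> (\<Sum>n\<in>I. (y n)\<^sup>2 * K)" by (intro sum_mono mult_left_mono row) auto
  finally show ?thesis by (simp add: sum_distrib_right)
qed

text \<open>Pairs are grouped by their lcm w: both entries divide w, so there are at most tau(w)^2
  of them, and the second moment gives L^4.\<close>

lemma sum_inverse_lcm_le:
  fixes E :: "nat set"
  assumes E: "finite E" "\<And>e. e \<in> E \<Longrightarrow> 0 < e" and n: "\<And>e e'. e \<in> E \<Longrightarrow> e' \<in> E \<Longrightarrow> lcm e e' \<le> n"
    and L: "(\<Sum>k=1..n. 1 / real k) \<le> L"
  shows "(\<Sum>e\<in>E. \<Sum>e'\<in>E. 1 / real (lcm e e')) \<le> L ^ 4"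
proof -
  have "(\<Sum>(e, e')\<in>E \<times> E. 1 / real (lcm e e')) \<le> (\<Sum>(w, e, e')\<in>(SIGMA w:{1..n}. {a. a dvd w} \<times> {a. a dvd w}). 1 / real w)"
  proof (rule sum_le_included[where i = "\<lambda>(w, e, e'). (e, e')"])
    show "\<forall>p\<in>E \<times> E. \<exists>y\<in>(SIGMA w:{1..n}. {a. a dvd w} \<times> {a. a dvd w}). (case y of (w, e, e') \<Rightarrow> (e, e')) = p \<and>
        (case p of (e, e') \<Rightarrow> 1 / real (lcm e e')) \<le> (case y of (w, e, e') \<Rightarrow> 1 / real w)" (is "\<forall>p\<in>_. ?P p")
    proof
      fix p assume "p \<in> E \<times> E"
      then obtain e e' where p: "p = (e, e')" "e \<in> E" "e' \<in> E" by auto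
      then have "1 \<le> lcm e e'" using E(2) by (simp add: Suc_le_eq lcm_pos_nat)
      then show "?P p"
        using p n by (intro bexI[of _ "(lcm e e', e, e')"]) auto
    qed
  qed (use E in \<open>auto intro!: finite_SigmaI\<close>)
  also have "\<dots> = (\<Sum>w=1..n. \<Sum>p\<in>{a. a dvd w} \<times> {a. a dvd w}. 1 / real w)"
    by (subst sum.Sigma) (auto simp: case_prod_unfold)
  also have "\<dots> = (\<Sum>w=1..n. tau w ^ 2 / real w)"
    by (simp add: tau_def card_cartesian_product power2_eq_square)
  also have "\<dots> \<le> L ^ (2 ^ 2)" by (rule sum_tau_power_le) (rule L)
  finally show ?thesis by (simp add: sum.cartesian_product)
qed

definition bilinear_ap :: "real \<Rightarrow> nat \<Rightarrow> int \<Rightarrow> nat set \<Rightarrow> (nat \<Rightarrow> complex) \<Rightarrow> (nat \<Rightarrow> complex) \<Rightarrow> nat \<Rightarrow> complex" where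
  "bilinear_ap \<alpha> N b I \<xi> \<eta> d = (\<Sum>m\<in>I. \<Sum>n=1..2*N. \<xi> m * \<eta> n * ap_term \<alpha> N b d (m * n))"

lemma ap_term_eq_0: "2 * N \<le> n \<Longrightarrow> ap_term \<alpha> N b d n = 0"
  by (simp add: ap_term_def)

context minor_arc
begin

text \<open>The square is opened and m is summed first. With n - n' = l gcd(d, d') the frequency
  becomes d d' l, which for d = d1 e and d' = d1 e' equals d1^2 (e e' l). The triples (e, e', l)
  collapse to j with weight tau(j)^2; the terms n = n' give the part with L^4.\<close>

lemma sum_correlations_le:
  fixes N M :: nat and b :: int and F :: "nat set" and c \<eta> :: "nat \<Rightarrow> complex"
  assumes xN: "x = 4 * real N" and d1: "0 < d1" and M: "0 < M" "real M \<le> real N"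
    and F: "finite F" "\<And>d. d \<in> F \<Longrightarrow> 0 < d \<and> d1 dvd d \<and> coprime (int d) b \<and> real d ^ 2 \<le> real d1 * real M / r ^ 24"
    and c: "\<And>d. norm (c d) \<le> 1" and \<eta>: "(\<Sum>n=1..2*N div M. (norm (\<eta> n))\<^sup>2) \<le> Y"
  shows "(\<Sum>m=M..<2*M. (norm (\<Sum>d\<in>F. \<Sum>n=1..2*N div M. c d * \<eta> n * ap_term \<alpha> N b d (m * n)))\<^sup>2)
    \<le> Y * (2 * real M * L ^ 4 / real d1 + 2 * (\<Sum>j=1..nat \<lfloor>x / r ^ 24 / (real d1)\<^sup>2\<rfloor>. (tau j)^2 * cap_at (d1^2 * j)))"
proof -
  define n1 where "n1 = 2 * N div M"
  let ?I = "{1..n1}"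
  have Y0: "0 \<le> Y" using \<eta> by (meson order_trans sum_nonneg zero_le_power2)
  define g where "g d m n = ap_term \<alpha> N b d (m * n)" for d m n
  define H where "H d d' = 2 * real M / real (lcm d d')" for d d' :: nat
  define \<kappa> where "\<kappa> d d' n n' = (if [n = n'] (mod gcd d d') then cap (H d d') (\<alpha> * real (lcm d d') * (real n - real n')) else 0)" for d d' n n' :: nat
  have H0: "0 \<le> H d d'" for d d' by (simp add: H_def)
  have gl: "gcd d d' * lcm d d' = d * d'" for d d' :: nat by (simp add: prod_gcd_lcm_nat[symmetric])
  \<comment> \<open>d1 divides the gcd, so the lcm is at most d d' / d1, and the bound on d^2 makes
    this at most M / r^24.\<close>
  have lcm_d1: "real (lcm d d') \<le> real M / r ^ 24" "d1 * lcm d d' \<le> d * d'" if "d \<in> F" "d' \<in> F" for d d'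
  proof -
    have "d1 dvd gcd d d'" "0 < gcd d d'" using F(2)[OF that(1)] F(2)[OF that(2)] by auto
    then have "d1 \<le> gcd d d'" by (rule dvd_imp_le)
    then show 1: "d1 * lcm d d' \<le> d * d'" unfolding gl[of d d', symmetric] by (rule mult_le_mono1)
    have s: "0 \<le> real d1 * real M / r ^ 24" using r_pow(2)[of 24] by simp
    have "real d * real d' \<le> sqrt (real d1 * real M / r ^ 24) * sqrt (real d1 * real M / r ^ 24)"
      using F(2)[OF that(1)] F(2)[OF that(2)] by (intro mult_mono real_le_rsqrt) auto
    also have "\<dots> = real d1 * (real M / r ^ 24)" using s by simp
    finally have "real d1 * real (lcm d d') \<le> real d1 * (real M / r ^ 24)"
      using 1 by (metis (mono_tags, lifting) of_nat_le_iff of_nat_mult order_trans)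
    then show "real (lcm d d') \<le> real M / r ^ 24" by (rule mult_left_le_imp_le) (use d1 in simp)
  qed
  have lcm_pos: "0 < lcm d d'" "0 < gcd d d'" if "d \<in> F" "d' \<in> F" for d d'
    using F(2)[OF that(1)] F(2)[OF that(2)] by (auto simp: lcm_pos_nat)
  have lcm_M: "lcm d d' \<le> M" if "d \<in> F" "d' \<in> F" for d d'
  proof -
    have "real M / r ^ 24 \<le> real M / 1" using r_pow[of 24] by (intro divide_left_mono) auto
    then show ?thesis using lcm_d1(1)[OF that] by simp
  qed
  have pair: "(\<Sum>n\<in>?I. \<Sum>n'\<in>?I. norm (\<eta> n) * norm (\<eta> n') * \<kappa> d d' n n')
      \<le> Y * (H d d' + 2 * (\<Sum>l=1..n1 div gcd d d'. cap (H d d') (\<alpha> * real (d * d' * l))))"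
    if dd: "d \<in> F" "d' \<in> F" for d d'
  proof -
    have "real (lcm d d') * real (gcd d d') = real d * real d'"
      by (metis gl mult.commute of_nat_mult)
    \<comment> \<open>lcm times gcd is the product d d', so the modulus of n - n' and the modulus of
      m combine in the frequency.\<close>
    then have phase: "\<alpha> * real (lcm d d') * real (gcd d d' * l) = \<alpha> * real (d * d' * l)" for l
      by (simp add: mult.assoc)
    have "(\<Sum>n\<in>?I. \<Sum>n'\<in>?I. norm (\<eta> n) * norm (\<eta> n') * \<kappa> d d' n n')
        \<le> (\<Sum>n\<in>?I. (norm (\<eta> n))\<^sup>2) * (H d d' + 2 * (\<Sum>l=1..n1 div gcd d d'. cap (H d d') (\<alpha> * real (lcm d d') * real (gcd d d' * l))))"
    proof (rule sum_symmetric_kernel_le)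
      show "\<kappa> d d' n n' = \<kappa> d d' n' n" for n n'
      proof -
        have "\<alpha> * real (lcm d d') * (real n - real n') = - (\<alpha> * real (lcm d d') * (real n' - real n))"
          by (simp add: algebra_simps)
        then show ?thesis unfolding \<kappa>_def by (metis cap_minus cong_sym_eq)
      qed
      show "0 \<le> \<kappa> d d' n n'" for n n' unfolding \<kappa>_def by (auto intro: cap_nonneg H0)
      show "(\<Sum>n'\<in>?I. \<kappa> d d' n n') \<le> H d d' + 2 * (\<Sum>l=1..n1 div gcd d d'. cap (H d d') (\<alpha> * real (lcm d d') * real (gcd d d' * l)))"
        if "n \<in> ?I" for n
        unfolding \<kappa>_def using lcm_pos[OF dd] that by (intro sum_cap_cong_class_le H0) auto
    qed
    also have "\<dots> \<le> Y * (H d d' + 2 * (\<Sum>l=1..n1 div gcd d d'. cap (H d d') (\<alpha> * real (lcm d d') * real (gcd d d' * l))))"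
      using \<eta> H0 unfolding n1_def by (intro mult_right_mono) (auto intro!: add_nonneg_nonneg sum_nonneg cap_nonneg)
    finally show ?thesis by (simp only: phase)
  qed
  define E where "E = (\<lambda>d. d div d1) ` F"
  have F_E: "d1 * (d div d1) = d" if "d \<in> F" for d using F(2)[OF that] by simp
  have inj: "inj_on (\<lambda>d. d div d1) F" by (rule inj_onI) (metis F_E)
  have E_mem: "d1 * e \<in> F" if "e \<in> E" for e using that F_E by (auto simp: E_def)
  have E_pos: "0 < e" if "e \<in> E" for e using F(2)[OF E_mem[OF that]] by simp
  have lcm_E: "lcm (d1 * e) (d1 * e') = d1 * lcm e e'" for e e' by (simp add: lcm_mult_left)
  have finE: "finite E" using F(1) by (simp add: E_def)
  have sumF: "(\<Sum>d\<in>F. h d) = (\<Sum>e\<in>E. h (d1 * e))" for h :: "nat \<Rightarrow> real"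
  proof -
    have "(\<Sum>e\<in>E. h (d1 * e)) = (\<Sum>d\<in>F. h (d1 * (d div d1)))" unfolding E_def by (subst sum.reindex[OF inj]) simp
    also have "\<dots> = (\<Sum>d\<in>F. h d)" by (intro sum.cong refl arg_cong[of _ _ h] F_E)
    finally show ?thesis by simp
  qed
  have diag: "(\<Sum>d\<in>F. \<Sum>d'\<in>F. H d d') \<le> 2 * real M * L ^ 4 / real d1"
  proof -
    have "(\<Sum>d\<in>F. \<Sum>d'\<in>F. H d d') = (\<Sum>e\<in>E. \<Sum>e'\<in>E. 2 * real M / real d1 * (1 / real (lcm e e')))"
      unfolding sumF H_def lcm_E by simp
    also have "\<dots> = 2 * real M / real d1 * (\<Sum>e\<in>E. \<Sum>e'\<in>E. 1 / real (lcm e e'))" by (simp only: sum_distrib_left)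
    also have "\<dots> \<le> 2 * real M / real d1 * L ^ 4"
    proof (intro mult_left_mono sum_inverse_lcm_le finE E_pos)
      show "lcm e e' \<le> N" if "e \<in> E" "e' \<in> E" for e e'
      proof -
        have "1 * lcm e e' \<le> d1 * lcm e e'" using d1 by (intro mult_le_mono1) auto
        also have "\<dots> \<le> M" unfolding lcm_E[symmetric] by (intro lcm_M E_mem that)
        also have "\<dots> \<le> N" using M by simp
        finally show ?thesis by simp
      qed
      show "(\<Sum>k=1..N. 1 / real k) \<le> L" by (rule harm_le_L) (use xN in simp)
    qed auto
    finally show ?thesis by simp
  qed
  define J where "J = nat \<lfloor>x / r ^ 24 / (real d1)\<^sup>2\<rfloor>"
  define h where "h j = cap_at (d1^2 * j)" for j
  have off: "(\<Sum>d\<in>F. \<Sum>d'\<in>F. \<Sum>l=1..n1 div gcd d d'. cap (H d d') (\<alpha> * real (d * d' * l))) \<le> (\<Sum>j=1..J. (tau j)^2 * h j)"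
  proof -
    define T where "T = (\<lambda>((e, e'), l). (e, e', l)) ` (SIGMA p:E \<times> E. {1..n1 div gcd (d1 * fst p) (d1 * snd p)})"
    have injT: "inj_on (\<lambda>((e, e'), l). (e, e', l)) (SIGMA p:E \<times> E. {1..n1 div gcd (d1 * fst p) (d1 * snd p)})"
      by (auto simp: inj_on_def)
    have div_le: "A / W \<le> u / B" if "A * B \<le> u * W" "0 < B" "0 < W" for A B W u :: real
      using that by (simp add: field_simps)
    \<comment> \<open>gcd(d, d') l <= 2 N / M, so (2 M / lcm) times d d' l is at most 4 N. This is
      why x = 4 N.\<close>
    have key: "real (d * d' * l) \<le> x / r ^ 24" "H d d' \<le> x / real (d * d' * l)"
      if dd: "d \<in> F" "d' \<in> F" and l: "1 \<le> l" "l \<le> n1 div gcd d d'" for d d' l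
    proof -
      have "gcd d d' * l \<le> n1" using l lcm_pos[OF dd] by (simp add: less_eq_div_iff_mult_less_eq mult.commute)
      then have "gcd d d' * l * M \<le> n1 * M" by (rule mult_le_mono1)
      also have "\<dots> \<le> 2 * N" by (simp add: n1_def)
      finally have GM: "real (gcd d d' * l) * real M \<le> 2 * real N" by (metis of_nat_le_iff of_nat_mult of_nat_numeral)
      have eq: "real (d * d' * l) = real (lcm d d') * real (gcd d d' * l)"
        unfolding of_nat_mult[symmetric] by (metis gl mult.assoc mult.commute)
      have "real (d * d' * l) \<le> (real M / r ^ 24) * real (gcd d d' * l)"
        unfolding eq by (intro mult_right_mono lcm_d1 dd) simp
      also have "\<dots> = real (gcd d d' * l) * real M / r ^ 24" by simp
      also have "\<dots> \<le> x / r ^ 24" using GM xN r_pow(2)[of 24] by (intro divide_right_mono) auto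
      finally show "real (d * d' * l) \<le> x / r ^ 24" .
      have "2 * real M * real (d * d' * l) = 2 * real (lcm d d') * (real (gcd d d' * l) * real M)" unfolding eq by simp
      also have "\<dots> \<le> 2 * real (lcm d d') * (2 * real N)" by (intro mult_left_mono GM) simp
      also have "\<dots> = x * real (lcm d d')" by (simp add: xN)
      finally have "2 * real M * real (d * d' * l) \<le> x * real (lcm d d')" .
      moreover have "0 < real (d * d' * l)" "0 < real (lcm d d')" using F(2)[OF dd(1)] F(2)[OF dd(2)] l lcm_pos[OF dd] by auto
      ultimately show "H d d' \<le> x / real (d * d' * l)" unfolding H_def by (intro div_le)
    qed
    have "(\<Sum>d\<in>F. \<Sum>d'\<in>F. \<Sum>l=1..n1 div gcd d d'. cap (H d d') (\<alpha> * real (d * d' * l)))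
        \<le> (\<Sum>d\<in>F. \<Sum>d'\<in>F. \<Sum>l=1..n1 div gcd d d'. cap_at (d * d' * l))"
      by (intro sum_mono cap_mono H0 key) auto
    also have "\<dots> = (\<Sum>e\<in>E. \<Sum>e'\<in>E. \<Sum>l=1..n1 div gcd (d1 * e) (d1 * e'). h (e * e' * l))"
      unfolding sumF h_def by (simp add: power2_eq_square mult_ac)
    also have "\<dots> = (\<Sum>p\<in>E \<times> E. \<Sum>l=1..n1 div gcd (d1 * fst p) (d1 * snd p). h (fst p * snd p * l))"
      by (simp add: sum.cartesian_product case_prod_unfold)
    also have "\<dots> = (\<Sum>(e, e', l)\<in>T. h (e * e' * l))"
      unfolding T_def using finE by (subst sum.reindex[OF injT]) (simp add: sum.Sigma case_prod_unfold)
    also have "\<dots> \<le> (\<Sum>j=1..J. (tau j)^2 * h j)"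
    proof (rule sum_triples_le_tau)
      show "finite T" unfolding T_def using finE by auto
      show "0 \<le> h j" for j unfolding h_def using x_ge_2 by (intro cap_nonneg) auto
      fix e e' l assume "(e, e', l) \<in> T"
      then have t: "e \<in> E" "e' \<in> E" "1 \<le> l" "l \<le> n1 div gcd (d1 * e) (d1 * e')" by (auto simp: T_def)
      have "real ((d1 * e) * (d1 * e') * l) \<le> x / r ^ 24" by (rule key(1)) (use t E_mem in auto)
      then have "real (e * e' * l) * (real d1)\<^sup>2 \<le> x / r ^ 24"
        by (simp add: power2_eq_square mult_ac)
      then have "real (e * e' * l) \<le> x / r ^ 24 / (real d1)\<^sup>2"
        using d1 by (subst pos_le_divide_eq) auto
      then have "e * e' * l \<le> J" unfolding J_def by (rule le_nat_floor)
      then show "0 < e * e' * l \<and> e * e' * l \<le> J" using t E_pos by auto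
    qed
    finally show ?thesis .
  qed
  let ?X = "\<lambda>m. \<Sum>d\<in>F. \<Sum>n\<in>?I. c d * \<eta> n * g d m n"
  have "of_real (\<Sum>m=M..<2*M. (norm (?X m))\<^sup>2) = (\<Sum>m=M..<2*M. ?X m * cnj (?X m))"
    by (simp only: complex_norm_square[symmetric] of_real_sum)
  also have "\<dots> = (\<Sum>m=M..<2*M. \<Sum>d\<in>F. \<Sum>n\<in>?I. \<Sum>d'\<in>F. \<Sum>n'\<in>?I. (c d * \<eta> n * cnj (c d' * \<eta> n')) * (g d m n * cnj (g d' m n')))"
    by (simp only: sum_distrib_right, simp only: cnj_sum sum_distrib_left complex_cnj_mult mult_ac)
  also have "\<dots> = (\<Sum>d\<in>F. \<Sum>n\<in>?I. \<Sum>d'\<in>F. \<Sum>n'\<in>?I. (c d * \<eta> n * cnj (c d' * \<eta> n')) * (\<Sum>m=M..<2*M. g d m n * cnj (g d' m n')))"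
    unfolding sum_distrib_left by (simp only: sum.swap[of _ _ "{M..<2*M}"])
  finally have eq: "of_real (\<Sum>m=M..<2*M. (norm (?X m))\<^sup>2) = (\<Sum>d\<in>F. \<Sum>n\<in>?I. \<Sum>d'\<in>F. \<Sum>n'\<in>?I. (c d * \<eta> n * cnj (c d' * \<eta> n')) * (\<Sum>m=M..<2*M. g d m n * cnj (g d' m n')))" .
  have "(\<Sum>m=M..<2*M. (norm (?X m))\<^sup>2) = norm (of_real (\<Sum>m=M..<2*M. (norm (?X m))\<^sup>2) :: complex)"
    unfolding norm_of_real by (simp add: sum_nonneg)
  also have "\<dots> \<le> (\<Sum>d\<in>F. \<Sum>n\<in>?I. \<Sum>d'\<in>F. \<Sum>n'\<in>?I. norm (\<eta> n) * norm (\<eta> n') * \<kappa> d d' n n')"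
    unfolding eq
  proof (intro order_trans[OF norm_sum] sum_mono)
    fix d n d' n' assume d: "d \<in> F" "d' \<in> F"
    have 1: "norm (\<Sum>m=M..<2*M. g d m n * cnj (g d' m n')) \<le> \<kappa> d d' n n'"
    proof -
      have eqs: "real (2 * M) / real (lcm d d') = H d d'"
        "\<alpha> * (real n - real n') * real (lcm d d') = \<alpha> * real (lcm d d') * (real n - real n')"
        by (simp_all add: H_def)
      have "norm (\<Sum>m=M..<2*M. g d m n * cnj (g d' m n'))
          \<le> (if [n = n'] (mod gcd d d') then cap (2 * M / lcm d d') (\<alpha> * (real n - real n') * real (lcm d d')) else 0)"
        unfolding g_def using F(2)[OF d(1)] F(2)[OF d(2)] lcm_M[OF d] by (intro bilinear_correlation_le) auto
      then show ?thesis unfolding \<kappa>_def eqs .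
    qed
    have "norm (c d) * norm (c d') \<le> 1" using c by (intro mult_le_one) auto
    then have "(norm (c d) * norm (c d')) * (norm (\<eta> n) * norm (\<eta> n')) \<le> 1 * (norm (\<eta> n) * norm (\<eta> n'))"
      by (intro mult_right_mono) auto
    then have "norm (c d * \<eta> n * cnj (c d' * \<eta> n')) \<le> norm (\<eta> n) * norm (\<eta> n')"
      by (simp add: norm_mult mult_ac)
    then show "norm ((c d * \<eta> n * cnj (c d' * \<eta> n')) * (\<Sum>m=M..<2*M. g d m n * cnj (g d' m n'))) \<le> norm (\<eta> n) * norm (\<eta> n') * \<kappa> d d' n n'"
      unfolding norm_mult[of "c d * \<eta> n * cnj (c d' * \<eta> n')"] using 1 by (intro mult_mono) auto
  qed
  also have "\<dots> = (\<Sum>d\<in>F. \<Sum>d'\<in>F. \<Sum>n\<in>?I. \<Sum>n'\<in>?I. norm (\<eta> n) * norm (\<eta> n') * \<kappa> d d' n n')"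
    by (simp only: sum.swap[of _ F ?I])
  also have "\<dots> \<le> (\<Sum>d\<in>F. \<Sum>d'\<in>F. Y * (H d d' + 2 * (\<Sum>l=1..n1 div gcd d d'. cap (H d d') (\<alpha> * real (d * d' * l)))))"
    by (intro sum_mono pair)
  also have "\<dots> = Y * ((\<Sum>d\<in>F. \<Sum>d'\<in>F. H d d') + 2 * (\<Sum>d\<in>F. \<Sum>d'\<in>F. \<Sum>l=1..n1 div gcd d d'. cap (H d d') (\<alpha> * real (d * d' * l))))"
    by (simp only: sum_distrib_left[symmetric] sum.distrib)
  also have "\<dots> \<le> Y * (2 * real M * L ^ 4 / real d1 + 2 * (\<Sum>j=1..J. (tau j)^2 * h j))"
    using Y0 by (intro mult_left_mono add_mono diag off) auto
  finally show ?thesis unfolding n1_def g_def J_def h_def .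
qed

end

section \<open>Type I and type II estimates\<close>

lemma cnj_sgn_mult_self: "cnj (sgn z) * z = of_real (norm z)"
proof (cases "z = 0")
  case False
  have "cnj (sgn z) * z = (z * cnj z) / of_real (norm z)"
    by (simp add: sgn_eq)
  also have "\<dots> = of_real (norm z)"
    using False by (simp add: complex_norm_square[symmetric] power2_eq_square)
  finally show ?thesis .
qed simp

context minor_arc
begin

text \<open>\<open>f d\<close> is the factor d_1; with d_2 = d / d_1 the bound on d^2 says d_1 d_2^2
  <= M / r^24. The moduli are grouped by d_1, and the groups together produce the sum over
  \<open>small_pairs\<close>. The bound on \<open>f d\<close> limits the number of groups, each of
  which contributes a diagonal of order M L^4.\<close>

lemma type_II_block:
  fixes N M :: nat and b :: int and Ds :: "nat set" and f :: "nat \<Rightarrow> nat" and \<xi> \<eta> :: "nat \<Rightarrow> complex"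
  assumes xN: "x = 4 * real N" and M: "0 < M" "real M \<le> real N"
    and Ds: "finite Ds" "\<And>d. d \<in> Ds \<Longrightarrow> 0 < d \<and> f d dvd d \<and> coprime (int d) b"
      "\<And>d. d \<in> Ds \<Longrightarrow> (real d)\<^sup>2 \<le> real (f d) * real M / r ^ 24"
      "\<And>d. d \<in> Ds \<Longrightarrow> real (f d) \<le> real N / (real M * r ^ 24)"
    and \<xi>: "(\<Sum>m=M..<2*M. (norm (\<xi> m))\<^sup>2) \<le> X"
    and \<eta>: "(\<Sum>n=1..2*N div M. (norm (\<eta> n))\<^sup>2) \<le> Y"
  shows "(\<Sum>d\<in>Ds. norm (bilinear_ap \<alpha> N b {M..<2*M} \<xi> \<eta> d))\<^sup>2 \<le> X * L * (Y * (75 * x * L ^ 12 / r))"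
proof -
  define n1 where "n1 = 2 * N div M"
  define B where "B d = bilinear_ap \<alpha> N b {M..<2*M} \<xi> \<eta> d" for d
  \<comment> \<open>\<open>c d\<close> rotates \<open>B d\<close> onto its norm and is 0 where
    \<open>B d\<close> is 0. The sum of norms becomes linear in \<open>B d\<close>, so d_1 and m can
    be pulled outside.\<close>
  define c where "c d = cnj (sgn (B d))" for d
  define F where "F d1 = {d\<in>Ds. f d = d1}" for d1
  define V where "V d1 m = (\<Sum>d\<in>F d1. \<Sum>n=1..n1. c d * \<eta> n * ap_term \<alpha> N b d (m * n))" for d1 m
  have X0: "0 \<le> X" and Y0: "0 \<le> Y" using \<xi> \<eta> by (meson order_trans sum_nonneg zero_le_power2)+
  \<comment> \<open>For m >= M and n > 2 N / M the product m n is at least 2 N, where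
    \<open>ap_term\<close> vanishes.\<close>
  have B_eq: "B d = (\<Sum>m=M..<2*M. \<Sum>n=1..n1. \<xi> m * \<eta> n * ap_term \<alpha> N b d (m * n))" for d
    unfolding B_def bilinear_ap_def
  proof (rule sum.cong[OF refl], rule sum.mono_neutral_right)
    fix m assume m: "m \<in> {M..<2*M}"
    show "\<forall>n\<in>{1..2*N} - {1..n1}. \<xi> m * \<eta> n * ap_term \<alpha> N b d (m * n) = 0"
    proof
    fix n assume n: "n \<in> {1..2*N} - {1..n1}"
    have "2 * N < Suc n1 * M" using M unfolding n1_def by (metis dividend_less_div_times mult_Suc)
    also have "Suc n1 * M \<le> n * m" using m n by (intro mult_le_mono) auto
    finally have "2 * N \<le> m * n" by (simp add: mult.commute)
    then show "\<xi> m * \<eta> n * ap_term \<alpha> N b d (m * n) = 0" by (simp add: ap_term_eq_0)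
    qed
  qed (auto simp: n1_def intro: order_trans[OF _ div_le_dividend])
  have c1: "norm (c d) \<le> 1" for d unfolding c_def by (simp add: norm_sgn)
  let ?D1 = "f ` Ds"
  have D1_pos: "0 < d1" if "d1 \<in> ?D1" for d1
    using that Ds(2) by (metis imageE dvd_pos_nat)
  define n0 where "n0 = nat \<lfloor>real N / (real M * r ^ 24)\<rfloor>"
  have D1_sub: "?D1 \<subseteq> {1..n0}"
    using D1_pos Ds(4) by (auto simp: n0_def Suc_le_eq intro!: le_nat_floor)
  have n0: "real n0 \<le> real N / (real M * r ^ 24)" unfolding n0_def using r_pow(2)[of 24] by simp
  have n0N: "n0 \<le> N"
  proof -
    have "1 * 1 \<le> real M * r ^ 24" using M r_pow[of 24] by (intro mult_mono) auto
    then have "real N / (real M * r ^ 24) \<le> real N / 1" by (intro divide_left_mono) auto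
    then show ?thesis using n0 by linarith
  qed
  have "of_real (\<Sum>d\<in>Ds. norm (B d)) = (\<Sum>d\<in>Ds. c d * B d)"
    by (simp add: c_def cnj_sgn_mult_self)
  also have "\<dots> = (\<Sum>d1\<in>?D1. \<Sum>d\<in>F d1. c d * B d)"
    unfolding F_def by (rule sum.image_gen[OF Ds(1)])
  also have "\<dots> = (\<Sum>d1\<in>?D1. \<Sum>m=M..<2*M. \<xi> m * V d1 m)"
    unfolding B_eq V_def sum_distrib_left
    by (subst sum.swap) (simp only: mult_ac)
  finally have eq: "of_real (\<Sum>d\<in>Ds. norm (B d)) = (\<Sum>d1\<in>?D1. \<Sum>m=M..<2*M. \<xi> m * V d1 m)" .
  let ?P = "?D1 \<times> {M..<2*M}"
  have "(\<Sum>d\<in>Ds. norm (B d)) = norm (of_real (\<Sum>d\<in>Ds. norm (B d)) :: complex)"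
    unfolding norm_of_real by (simp add: sum_nonneg)
  also have "\<dots> \<le> (\<Sum>d1\<in>?D1. \<Sum>m=M..<2*M. norm (\<xi> m) * norm (V d1 m))"
    unfolding eq by (intro order_trans[OF norm_sum] sum_mono) (simp add: norm_mult)
  also have "\<dots> = (\<Sum>p\<in>?P. (norm (\<xi> (snd p)) / sqrt (fst p)) * (sqrt (fst p) * norm (V (fst p) (snd p))))"
    unfolding sum.cartesian_product case_prod_unfold using D1_pos by (intro sum.cong) force+
  finally have le: "(\<Sum>d\<in>Ds. norm (B d)) \<le> (\<Sum>p\<in>?P. (norm (\<xi> (snd p)) / sqrt (fst p)) * (sqrt (fst p) * norm (V (fst p) (snd p))))" .
  \<comment> \<open>The weight \<open>d1\<close> in Cauchy-Schwarz makes a dyadic decomposition of \<open>d\<close> unnecessary.\<close>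
  have A: "(\<Sum>p\<in>?P. (norm (\<xi> (snd p)) / sqrt (fst p))\<^sup>2) \<le> X * L"
  proof -
    have "(\<Sum>p\<in>?P. (norm (\<xi> (snd p)) / sqrt (fst p))\<^sup>2) = (\<Sum>p\<in>?P. (1 / real (fst p)) * (norm (\<xi> (snd p)))\<^sup>2)"
      by (simp add: power_divide)
    also have "\<dots> = (\<Sum>d1\<in>?D1. 1 / real d1) * (\<Sum>m=M..<2*M. (norm (\<xi> m))\<^sup>2)"
      unfolding sum_product by (simp add: sum.cartesian_product case_prod_unfold)
    also have "\<dots> \<le> L * X"
    proof (intro mult_mono \<xi>)
      have "(\<Sum>d1\<in>?D1. 1 / real d1) \<le> (\<Sum>d1=1..n0. 1 / real d1)" using D1_sub by (intro sum_mono2) auto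
      also have "\<dots> \<le> L" by (rule harm_le_L) (use n0N xN in simp)
      finally show "(\<Sum>d1\<in>?D1. 1 / real d1) \<le> L" .
    qed (use L_ge_2 in \<open>auto intro!: sum_nonneg\<close>)
    finally show ?thesis by (simp add: mult.commute)
  qed
  have C: "(\<Sum>p\<in>?P. (sqrt (fst p) * norm (V (fst p) (snd p)))\<^sup>2) \<le> Y * (75 * x * L ^ 12 / r)"
  proof -
    define h where "h d1 j = (tau j)\<^sup>2 * cap_at (d1^2 * j)" for d1 j
    define J where "J d1 = nat \<lfloor>x / r ^ 24 / (real d1)\<^sup>2\<rfloor>" for d1
    have "(\<Sum>p\<in>?P. (sqrt (fst p) * norm (V (fst p) (snd p)))\<^sup>2) = (\<Sum>d1\<in>?D1. real d1 * (\<Sum>m=M..<2*M. (norm (V d1 m))\<^sup>2))"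
      unfolding sum_distrib_left sum.cartesian_product case_prod_unfold by (simp add: power_mult_distrib)
    also have "\<dots> \<le> (\<Sum>d1\<in>?D1. real d1 * (Y * (2 * real M * L ^ 4 / real d1 + 2 * (\<Sum>j=1..J d1. h d1 j))))"
    proof (intro sum_mono mult_left_mono)
      fix d1 assume d1: "d1 \<in> ?D1"
      show "(\<Sum>m=M..<2*M. (norm (V d1 m))\<^sup>2) \<le> Y * (2 * real M * L ^ 4 / real d1 + 2 * (\<Sum>j=1..J d1. h d1 j))"
        unfolding V_def n1_def h_def J_def
        by (rule sum_correlations_le) (use xN D1_pos[OF d1] M Ds c1 \<eta> in \<open>auto simp: F_def\<close>)
    qed simp
    also have "\<dots> = (\<Sum>d1\<in>?D1. Y * (2 * real M * L ^ 4) + Y * (2 * (\<Sum>j=1..J d1. real d1 * h d1 j)))"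
    proof (rule sum.cong[OF refl])
      fix d1 assume "d1 \<in> ?D1"
      then have "0 < d1" by (rule D1_pos)
      then show "real d1 * (Y * (2 * real M * L ^ 4 / real d1 + 2 * (\<Sum>j=1..J d1. h d1 j)))
        = Y * (2 * real M * L ^ 4) + Y * (2 * (\<Sum>j=1..J d1. real d1 * h d1 j))"
        unfolding sum_distrib_left[symmetric] by (simp add: distrib_left mult.left_commute[of "real d1"])
    qed
    also have "\<dots> = Y * (real (card ?D1) * (2 * real M * L ^ 4) + 2 * (\<Sum>d1\<in>?D1. \<Sum>j=1..J d1. real d1 * h d1 j))"
      by (simp add: sum.distrib distrib_left sum_distrib_left[symmetric])
    \<comment> \<open>The 75 of the statement is 1 + 2 * 37: diagonal plus twice
      \<open>sum_cap_pairs\<close>.\<close>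
    also have "\<dots> \<le> Y * (x * L ^ 12 / r + 2 * (37 * x * L ^ 12 / r))"
    proof (rule mult_left_mono[OF add_mono Y0])
      have "card ?D1 \<le> n0" using card_mono[OF _ D1_sub] by simp
      then have "real (card ?D1) \<le> real N / (real M * r ^ 24)" using n0 by linarith
      then have "real (card ?D1) * (2 * real M * L ^ 4) \<le> real N / (real M * r ^ 24) * (2 * real M * L ^ 4)"
        using L_ge_2 by (intro mult_right_mono) auto
      also have "\<dots> = (x / r ^ 24) * L ^ 4 / 2" using M xN by simp
      also have "\<dots> \<le> (x / r ^ 24) * L ^ 4"
      proof -
        have "0 \<le> (x / r ^ 24) * L ^ 4" using x_ge_2 L_ge_2 r_pow(2)[of 24] by simp
        moreover have "u / 2 \<le> u" if "0 \<le> u" for u :: real using that by simp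
        ultimately show ?thesis by blast
      qed
      also have "\<dots> \<le> (x / r ^ 1) * L ^ 12"
        using x_div_r_mono[of 1 24] L_pow_mono[of 4 12] x_ge_2 L_ge_2 r by (intro mult_mono) auto
      finally show "real (card ?D1) * (2 * real M * L ^ 4) \<le> x * L ^ 12 / r" by simp
      have "(\<Sum>d1\<in>?D1. \<Sum>j=1..J d1. real d1 * h d1 j) = (\<Sum>(d1, j)\<in>(SIGMA d1:?D1. {1..J d1}). real d1 * h d1 j)"
        using Ds(1) by (subst sum.Sigma) auto
      also have "\<dots> \<le> (\<Sum>(d1, j)\<in>small_pairs. real d1 * h d1 j)"
      proof (rule sum_mono2[OF finite_small_pairs])
        show "(SIGMA d1:?D1. {1..J d1}) \<subseteq> small_pairs"
        proof
          fix p assume "p \<in> (SIGMA d1:?D1. {1..J d1})"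
          then obtain d1 j where p: "p = (d1, j)" "d1 \<in> ?D1" "1 \<le> j" "j \<le> J d1" by auto
          have "0 \<le> x / r ^ 24 / (real d1)\<^sup>2" using x_ge_2 r_pow(2)[of 24] by simp
          then have "real j \<le> x / r ^ 24 / (real d1)\<^sup>2" using p(4) unfolding J_def by linarith
          then have "real j * (real d1)\<^sup>2 \<le> x / r ^ 24"
            by (subst (asm) pos_le_divide_eq) (use D1_pos[OF p(2)] in auto)
          then show "p \<in> small_pairs" using p D1_pos[OF p(2)] by (simp add: small_pairs_def mult.commute)
        qed
      qed (use x_ge_2 in \<open>auto simp: h_def intro!: mult_nonneg_nonneg cap_nonneg\<close>)
      also have "\<dots> \<le> 37 * x * L ^ 12 / r"
        using sum_cap_pairs unfolding h_def mult.assoc .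
      finally show "2 * (\<Sum>d1\<in>?D1. \<Sum>j=1..J d1. real d1 * h d1 j) \<le> 2 * (37 * x * L ^ 12 / r)" by simp
    qed
    finally show ?thesis by (simp add: field_simps)
  qed
  have "(\<Sum>d\<in>Ds. norm (B d))\<^sup>2 \<le> (\<Sum>p\<in>?P. (norm (\<xi> (snd p)) / sqrt (fst p)) * (sqrt (fst p) * norm (V (fst p) (snd p))))\<^sup>2"
    using le by (intro power_mono) (auto intro: sum_nonneg)
  also have "\<dots> \<le> (\<Sum>p\<in>?P. (norm (\<xi> (snd p)) / sqrt (fst p))\<^sup>2) * (\<Sum>p\<in>?P. (sqrt (fst p) * norm (V (fst p) (snd p)))\<^sup>2)"
    by (rule Cauchy_Schwarz_sum_real)
  also have "\<dots> \<le> (X * L) * (Y * (75 * x * L ^ 12 / r))"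
    using X0 L_ge_2 by (intro mult_mono A C) (auto intro!: sum_nonneg)
  finally show ?thesis unfolding B_def .
qed

text \<open>For fixed d and m the weight of n is monotone (a constant or a logarithm), so partial
  summation leaves geometric sums over n in one class modulo d, of frequency d m. Each product j = d
  m is counted with divisor weights, and the part d = 1 of \<open>small_pairs\<close>
  suffices.\<close>

lemma type_I:
  fixes N :: nat and b :: int and Ds I :: "nat set" and \<xi> :: "nat \<Rightarrow> complex" and w :: "nat \<Rightarrow> real"
  assumes xN: "x = 4 * real N"
    and Ds: "finite Ds" "finite I" "\<And>d. d \<in> Ds \<Longrightarrow> 0 < d \<and> coprime (int d) b"
    and I: "\<And>m. m \<in> I \<Longrightarrow> 0 < m \<and> norm (\<xi> m) \<le> A"
    and dm: "\<And>d m. d \<in> Ds \<Longrightarrow> m \<in> I \<Longrightarrow> real (d * m) \<le> x / r ^ 24"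
    and w: "w 0 = 0" "mono w" "w (2 * N) \<le> L" and A: "0 \<le> A"
  shows "(\<Sum>d\<in>Ds. norm (bilinear_ap \<alpha> N b I \<xi> (\<lambda>n. of_real (w n)) d)) \<le> A * L * (37 * x * L ^ 12 / r)"
proof -
  have r24: "4 \<le> r ^ 24"
  proof -
    have "(2::real) ^ 2 \<le> 2 ^ 24" by (rule power_increasing) auto
    also have "(2::real) ^ 24 \<le> r ^ 24" using r by (intro power_mono) auto
    finally show ?thesis by simp
  qed
  have inner: "norm (\<Sum>n=1..2*N. of_real (w n) * ap_term \<alpha> N b d (m * n)) \<le> L * cap_at (d * m)"
    if d: "d \<in> Ds" and m: "m \<in> I" for d m
  proof -
    have pos: "0 < d" "0 < m" "coprime (int d) b" using Ds(3)[OF d] I[OF m] by auto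
    have dm1: "real d * real m \<le> real N"
    proof -
      have "x / r ^ 24 \<le> x / 4" using r24 x_ge_2 by (intro divide_left_mono) auto
      then show ?thesis using dm[OF d m] xN by simp
    qed
    \<comment> \<open>Increments of w. They are nonnegative and sum to w (2 N) <= L, so partial
      summation costs one factor L.\<close>
    define \<delta> where "\<delta> t = w (Suc t) - w t" for t
    have \<delta>0: "0 \<le> \<delta> t" for t using w(2) by (simp add: \<delta>_def mono_def)
    have w_sum: "w n = (\<Sum>t\<in>{..<n}. \<delta> t)" for n
      unfolding \<delta>_def using w(1) by (simp add: sum_lessThan_telescope)
    have tail: "norm (\<Sum>n=Suc t..2*N. ap_term \<alpha> N b d (m * n)) \<le> cap_at (d * m)" for t
    proof -
      define A where "A = {n\<in>{Suc t..2*N}. N \<le> m * n \<and> m * n < 2 * N}"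
      define B where "B = {n\<in>A. [int (m * n) = b] (mod int d)}"
      have "(\<Sum>n=Suc t..2*N. ap_term \<alpha> N b d (m * n)) = (\<Sum>n\<in>B. e_char ((\<alpha> * real m) * real n))"
        by (rule sum.mono_neutral_cong_right) (auto simp: A_def B_def ap_term_def mult_ac)
      also have "norm \<dots> \<le> cap (x / real (d * m)) ((\<alpha> * real m) * real d)"
      proof (rule norm_sum_e_char_convex_cong_le_cap)
        show "A \<subseteq> {N div m..<Suc (2 * N div m)}"
        proof
          fix n assume "n \<in> A"
          then have n: "N \<le> m * n" "m * n \<le> 2 * N" by (auto simp: A_def)
          have "N div m \<le> (m * n) div m" "(m * n) div m \<le> 2 * N div m" by (rule div_le_mono[OF n(1)], rule div_le_mono[OF n(2)])
          moreover have "(m * n) div m = n" using pos by simp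
          ultimately show "n \<in> {N div m..<Suc (2 * N div m)}" by simp
        qed
        show "j \<in> A" if "i \<in> A" "k \<in> A" "i \<le> j" "j \<le> k" for i j k
        proof -
          have "m * i \<le> m * j" "m * j \<le> m * k" using that by auto
          moreover have "Suc t \<le> i" "k \<le> 2 * N" "N \<le> m * i" "m * k < 2 * N" using that by (auto simp: A_def)
          ultimately have "Suc t \<le> j \<and> j \<le> 2 * N \<and> N \<le> m * j \<and> m * j < 2 * N" using that by linarith
          then show "j \<in> A" by (simp add: A_def)
        qed
        show "B \<subseteq> A" by (auto simp: B_def)
        show "n' \<in> B \<longleftrightarrow> [n' = n] (mod d)" if "n \<in> B" "n' \<in> A" for n n'
        proof -
          have "[int (n * m) = b] (mod int d)" using that by (simp add: B_def mult.commute)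
          from cong_mult_cancel_coprime_target(1)[OF pos(3) this, of n'] that(2)
          show ?thesis by (simp add: B_def mult.commute)
        qed
        have "2 * N div m * m \<le> 2 * N" by simp
        then have "real (2 * N div m) * real m \<le> 2 * real N" by (metis of_nat_le_iff of_nat_mult of_nat_numeral)
        then have "real (2 * N div m) \<le> 2 * real N / real m" using pos by (simp add: pos_le_divide_eq)
        moreover have "N < Suc (N div m) * m" using pos by (metis dividend_less_div_times mult_Suc)
        then have "real N < real (Suc (N div m)) * real m" by (metis of_nat_less_iff of_nat_mult)
        then have "real N / real m - 1 \<le> real (N div m)" using pos by (simp add: field_simps)
        ultimately have "real (Suc (2 * N div m)) - real (N div m) \<le> real N / real m + 2" by simp
        then have "(real (Suc (2 * N div m)) - real (N div m)) / real d + 1 \<le> (real N / real m + 2) / real d + 1"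
          by (intro add_mono divide_right_mono) auto
        also have "(real N / real m + 2) / real d + 1 = real N / (real d * real m) + (2 / real d + 1)"
          by (simp add: add_divide_distrib mult.commute)
        \<comment> \<open>The rounding terms total at most 3 <= 3 N / (d m), because d m <= N; with
          the main term this is 4 N / (d m) = x / (d m).\<close>
        also have "2 / real d + 1 \<le> 3" using pos by (simp add: field_simps)
        also have "3 \<le> 3 * (real N / (real d * real m))"
        proof -
          have "1 \<le> real N / (real d * real m)" using dm1 pos by (subst le_divide_eq_1_pos) auto
          then show ?thesis by linarith
        qed
        finally show "(real (Suc (2 * N div m)) - real (N div m)) / real d + 1 \<le> x / real (d * m)"
          using xN by simp
      qed (use pos x_ge_2 in auto)
      also have "(\<alpha> * real m) * real d = \<alpha> * real (d * m)" by simp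
      finally show ?thesis .
    qed
    have "(\<Sum>n=1..2*N. of_real (w n) * ap_term \<alpha> N b d (m * n))
        = (\<Sum>n=1..2*N. \<Sum>t\<in>{..<n}. of_real (\<delta> t) * ap_term \<alpha> N b d (m * n))"
      by (simp add: w_sum sum_distrib_right)
    also have "\<dots> = (\<Sum>t\<in>{..<2*N}. \<Sum>n=Suc t..2*N. of_real (\<delta> t) * ap_term \<alpha> N b d (m * n))"
      unfolding sum.Sigma[OF finite_atLeastAtMost ballI[OF finite_lessThan]]
        sum.Sigma[OF finite_lessThan ballI[OF finite_atLeastAtMost]]
      by (rule sum.reindex_bij_witness[where i = "\<lambda>(t, n). (n, t)" and j = "\<lambda>(n, t). (t, n)"]) auto
    also have "\<dots> = (\<Sum>t\<in>{..<2*N}. of_real (\<delta> t) * (\<Sum>n=Suc t..2*N. ap_term \<alpha> N b d (m * n)))"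
      by (simp add: sum_distrib_left)
    also have "norm \<dots> \<le> (\<Sum>t\<in>{..<2*N}. \<delta> t * cap_at (d * m))"
    proof (intro order_trans[OF norm_sum] sum_mono)
      fix t
      show "norm (of_real (\<delta> t) * (\<Sum>n=Suc t..2*N. ap_term \<alpha> N b d (m * n))) \<le> \<delta> t * cap_at (d * m)"
        using \<delta>0[of t] unfolding norm_mult norm_of_real by (intro mult_mono tail) auto
    qed
    also have "\<dots> = w (2 * N) * cap_at (d * m)" by (simp add: w_sum sum_distrib_right)
    also have "\<dots> \<le> L * cap_at (d * m)"
      using w(3) x_ge_2 by (intro mult_right_mono cap_nonneg) auto
    finally show ?thesis .
  qed
  define h where "h j = cap_at j" for j
  have h0: "0 \<le> h j" for j unfolding h_def using x_ge_2 by (intro cap_nonneg) auto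
  define J where "J = nat \<lfloor>x / r ^ 24\<rfloor>"
  have "(\<Sum>d\<in>Ds. norm (bilinear_ap \<alpha> N b I \<xi> (\<lambda>n. of_real (w n)) d))
      \<le> (\<Sum>d\<in>Ds. \<Sum>m\<in>I. A * (L * h (d * m)))"
  proof (rule sum_mono)
    fix d assume d: "d \<in> Ds"
    have "bilinear_ap \<alpha> N b I \<xi> (\<lambda>n. of_real (w n)) d = (\<Sum>m\<in>I. \<xi> m * (\<Sum>n=1..2*N. of_real (w n) * ap_term \<alpha> N b d (m * n)))"
      unfolding bilinear_ap_def by (simp add: sum_distrib_left mult.assoc)
    also have "norm \<dots> \<le> (\<Sum>m\<in>I. A * (L * h (d * m)))"
    proof (intro order_trans[OF norm_sum] sum_mono)
      fix m assume m: "m \<in> I"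
      show "norm (\<xi> m * (\<Sum>n=1..2*N. of_real (w n) * ap_term \<alpha> N b d (m * n))) \<le> A * (L * h (d * m))"
        unfolding norm_mult h_def using I[OF m] A by (intro mult_mono inner[OF d m]) auto
    qed
    finally show "norm (bilinear_ap \<alpha> N b I \<xi> (\<lambda>n. of_real (w n)) d) \<le> (\<Sum>m\<in>I. A * (L * h (d * m)))" .
  qed
  also have "\<dots> = A * L * (\<Sum>(d, m)\<in>Ds \<times> I. h (d * m))"
    by (simp add: sum_distrib_left sum.cartesian_product mult.assoc case_prod_unfold)
  also have "\<dots> \<le> A * L * (37 * x * L ^ 12 / r)"
  proof (intro mult_left_mono)
    \<comment> \<open>A third factor 1 fits the pairs (d, m) to
      \<open>sum_triples_le_tau\<close>.\<close>
    have "(\<Sum>(d, m)\<in>Ds \<times> I. h (d * m)) = (\<Sum>(d, m, k)\<in>(\<lambda>(d, m). (d, m, 1)) ` (Ds \<times> I). h (d * m * k))"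
      by (subst sum.reindex) (auto simp: inj_on_def case_prod_unfold)
    also have "\<dots> \<le> (\<Sum>j=1..J. (tau j)^2 * h j)"
    proof (rule sum_triples_le_tau)
      show "finite ((\<lambda>(d, m). (d, m, 1::nat)) ` (Ds \<times> I))" using Ds by auto
      fix d m k assume "(d, m, k) \<in> (\<lambda>(d, m). (d, m, 1::nat)) ` (Ds \<times> I)"
      then have k: "k = 1" "d \<in> Ds" "m \<in> I" by auto
      then have "d * m \<le> J" unfolding J_def by (intro le_nat_floor dm)
      then show "0 < d * m * k \<and> d * m * k \<le> J" using k Ds(3) I by simp
    qed (rule h0)
    also have "\<dots> = (\<Sum>(d, j)\<in>{1} \<times> {1..J}. real d * (tau j)^2 * cap_at (d^2 * j))"
      by (simp add: h_def flip: sum.cartesian_product)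
    also have "\<dots> \<le> (\<Sum>(d, j)\<in>small_pairs. real d * (tau j)^2 * cap_at (d^2 * j))"
    proof (rule sum_mono2[OF finite_small_pairs])
      have "real j \<le> x / r ^ 24" if "j \<le> J" for j
      proof -
        have "0 \<le> x / r ^ 24" using x_ge_2 r_pow(2)[of 24] by simp
        then show ?thesis using that unfolding J_def by linarith
      qed
      then show "{1} \<times> {1..J} \<subseteq> small_pairs" by (auto simp: small_pairs_def)
    qed (use x_ge_2 in \<open>auto intro!: mult_nonneg_nonneg cap_nonneg\<close>)
    also have "\<dots> \<le> 37 * x * L ^ 12 / r" by (rule sum_cap_pairs)
    finally show "(\<Sum>(d, m)\<in>Ds \<times> I. h (d * m)) \<le> 37 * x * L ^ 12 / r" .
  qed (use A L_ge_2 in auto)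
  finally show ?thesis .
qed

end

section \<open>Vaughan's identity\<close>

text \<open>For a fixed prime p dividing n > 1, the squarefree divisors d prime to p are paired with
  p d, which has the opposite sign.\<close>

lemma sum_moebius_mu_divisors:
  assumes "0 < n"
  shows "(\<Sum>d | d dvd n. moebius_mu d) = (if n = 1 then 1 else 0)"
proof (cases "n = 1")
  case True
  then show ?thesis by (simp add: moebius_mu_def)
next
  case False
  then obtain p where p: "prime p" "p dvd n" using prime_factor_nat by blast
  have p0: "0 < p" using p by (simp add: prime_gt_0_nat)
  define A where "A = {d. d dvd n \<and> squarefree d \<and> \<not> p dvd d}"
  define B where "B = {d. d dvd n \<and> squarefree d \<and> p dvd d}"
  have fin: "finite A" "finite B" using assms by (auto simp: A_def B_def)
  have copd: "coprime p d" if "\<not> p dvd d" for d using p that by (simp add: prime_imp_coprime_nat)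
  have B_eq: "B = (\<lambda>d. p * d) ` A"
  proof (intro equalityI subsetI)
    fix e assume e: "e \<in> B"
    then obtain d where d: "e = p * d" by (auto simp: B_def)
    have "\<not> p dvd d"
    proof
      assume "p dvd d"
      then have "p\<^sup>2 dvd e" unfolding d power2_eq_square by simp
      then have "p dvd 1" using e unfolding B_def squarefree_def by blast
      then show False using p by simp
    qed
    moreover have "squarefree d" using e d unfolding B_def by (auto dest: squarefree_multD)
    moreover have "d dvd n" using e d unfolding B_def by (auto dest: dvd_mult_right)
    ultimately show "e \<in> (\<lambda>d. p * d) ` A" using d by (auto simp: A_def)
  next
    fix e assume "e \<in> (\<lambda>d. p * d) ` A"
    then obtain d where d: "e = p * d" "d dvd n" "squarefree d" "\<not> p dvd d" by (auto simp: A_def)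
    have "p * d dvd n" using d p copd by (intro divides_mult) auto
    moreover have "squarefree (p * d)"
      using d p copd by (intro squarefree_mult_coprime[OF _ squarefree_prime]) auto
    ultimately show "e \<in> B" using d by (simp add: B_def)
  qed
  have neg: "moebius_mu (p * d) = - moebius_mu d" if "d \<in> A" for d
  proof -
    have d: "squarefree d" "\<not> p dvd d" "d \<noteq> 0" using that assms by (auto simp: A_def)
    have "squarefree (p * d)" using that B_eq by (auto simp: B_def)
    moreover have "prime_factors (p * d) = insert p (prime_factors d)"
      using d p p0 by (subst prime_factors_product) (auto simp: prime_prime_factors)
    moreover have "p \<notin> prime_factors d" using d by (auto dest: in_prime_factors_imp_dvd)
    ultimately show ?thesis using d p0 by (simp add: moebius_mu_def)
  qed
  have "(\<Sum>d | d dvd n. moebius_mu d) = (\<Sum>d\<in>A \<union> B. moebius_mu d)"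
    using assms by (intro sum.mono_neutral_right) (auto simp: A_def B_def moebius_mu_def)
  also have "\<dots> = (\<Sum>d\<in>A. moebius_mu d) + (\<Sum>d\<in>B. moebius_mu d)"
    using fin by (intro sum.union_disjoint) (auto simp: A_def B_def)
  also have "(\<Sum>d\<in>B. moebius_mu d) = (\<Sum>d\<in>A. moebius_mu (p * d))"
    unfolding B_eq using p0 by (subst sum.reindex) (auto simp: inj_on_def)
  also have "\<dots> = - (\<Sum>d\<in>A. moebius_mu d)" by (simp add: neg sum_negf)
  finally show ?thesis using False by simp
qed

lemma abs_moebius_mu_le: "\<bar>moebius_mu n\<bar> \<le> 1"
  by (simp add: moebius_mu_def power_abs)

section \<open>Dirichlet convolution\<close>

definition dconv :: "(nat \<Rightarrow> complex) \<Rightarrow> (nat \<Rightarrow> complex) \<Rightarrow> nat \<Rightarrow> complex" where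
  "dconv f g n = (\<Sum>d | d dvd n. f d * g (n div d))"

text \<open>In this symmetric form commutativity and associativity are bijections between sets of
  factorizations.\<close>

lemma dconv_pairs:
  assumes "0 < n"
  shows "dconv f g n = (\<Sum>(d, e)\<in>{(d, e). d * e = n}. f d * g e)"
  unfolding dconv_def
  by (rule sum.reindex_bij_witness[where i = fst and j = "\<lambda>d. (d, n div d)"]) (use assms in auto)

lemma dconv_commute: "dconv f g n = dconv g f n" if "0 < n"
  unfolding dconv_pairs[OF that]
  by (rule sum.reindex_bij_witness[where i = "\<lambda>(d, e). (e, d)" and j = "\<lambda>(d, e). (e, d)"]) (auto simp: mult_ac)

lemma finite_factor_pairs: "0 < n \<Longrightarrow> finite {(d, e). d * e = (n::nat)}"
  by (rule finite_subset[of _ "{..n} \<times> {..n}"]) (auto simp: dvd_imp_le intro: dvd_imp_le)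

lemma dconv_assoc:
  assumes n: "0 < n"
  shows "dconv (dconv f g) h n = dconv f (dconv g h) n"
proof -
  have pos: "0 < fst p" "0 < snd p" if "p \<in> {(d, e). d * e = n}" for p :: "nat \<times> nat"
    using that n by (auto intro: gr0I)
  have "dconv (dconv f g) h n = (\<Sum>p\<in>{(d, e). d * e = n}. \<Sum>q\<in>{(d, e). d * e = fst p}. f (fst q) * g (snd q) * h (snd p))"
    unfolding dconv_pairs[OF n] case_prod_unfold
    by (rule sum.cong[OF refl]) (simp add: dconv_pairs pos case_prod_unfold sum_distrib_right)
  also have "\<dots> = (\<Sum>p\<in>{(d, e). d * e = n}. \<Sum>q\<in>{(d, e). d * e = snd p}. f (fst p) * (g (fst q) * h (snd q)))"
    by (subst (1 2) sum.Sigma)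
      (use n in \<open>auto intro!: finite_factor_pairs ballI pos
        sum.reindex_bij_witness[where i = "\<lambda>((a, m), (b, c)). ((a * b, c), (a, b))" and j = "\<lambda>((m, c), (a, b)). ((a, b * c), (b, c))"]
        simp: mult_ac\<close>)
  also have "\<dots> = dconv f (dconv g h) n"
    unfolding dconv_pairs[OF n] case_prod_unfold
    by (rule sum.cong[OF refl]) (simp add: dconv_pairs pos case_prod_unfold sum_distrib_left)
  finally show ?thesis .
qed

lemma dconv_cong:
  assumes "0 < n" "\<And>d. 0 < d \<Longrightarrow> d \<le> n \<Longrightarrow> f d = f' d" "\<And>d. 0 < d \<Longrightarrow> d \<le> n \<Longrightarrow> g d = g' d"
  shows "dconv f g n = dconv f' g' n"
  unfolding dconv_def
proof (rule sum.cong[OF refl])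
  fix d assume "d \<in> {d. d dvd n}"
  then have "0 < d" "d \<le> n" "0 < n div d" "n div d \<le> n"
    using assms(1) by (auto simp: dvd_imp_le div_greater_zero_iff intro: dvd_pos_nat)
  then show "f d * g (n div d) = f' d * g' (n div d)" using assms by simp
qed

lemma dconv_add_right: "dconv f (\<lambda>k. g k + h k) n = dconv f g n + dconv f h n"
  by (simp add: dconv_def sum.distrib algebra_simps)

lemma dconv_diff_right: "dconv f (\<lambda>k. g k - h k) n = dconv f g n - dconv f h n"
  by (simp add: dconv_def sum_subtractf algebra_simps)

definition mu_low :: "real \<Rightarrow> nat \<Rightarrow> complex" where
  "mu_low U n = (if real n \<le> U then of_int (moebius_mu n) else 0)"
definition mu_high :: "real \<Rightarrow> nat \<Rightarrow> complex" where
  "mu_high U n = (if real n \<le> U then 0 else of_int (moebius_mu n))"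
definition vm_low :: "real \<Rightarrow> nat \<Rightarrow> complex" where
  "vm_low U n = (if real n \<le> U then mangoldt n else 0)"
definition vm_high :: "real \<Rightarrow> nat \<Rightarrow> complex" where
  "vm_high U n = (if real n \<le> U then 0 else mangoldt n)"

lemma dconv_vm_one: "0 < n \<Longrightarrow> dconv (\<lambda>_. 1) (\<lambda>k. vm_low U k + vm_high U k) n = of_real (ln (real n))"
proof -
  assume n: "0 < n"
  have "dconv (\<lambda>_. 1) (\<lambda>k. vm_low U k + vm_high U k) n = dconv (\<lambda>k. vm_low U k + vm_high U k) (\<lambda>_. 1) n"
    by (rule dconv_commute[OF n])
  also have "\<dots> = (\<Sum>d | d dvd n. mangoldt d)" by (auto simp: dconv_def vm_low_def vm_high_def intro!: sum.cong)
  finally show ?thesis using mangoldt_sum[of n] n by simp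
qed

lemma dconv_mu_one: "0 < n \<Longrightarrow> dconv (\<lambda>k. mu_low U k + mu_high U k) (\<lambda>_. 1) n = (if n = 1 then 1 else 0)"
proof -
  assume n: "0 < n"
  have "dconv (\<lambda>k. mu_low U k + mu_high U k) (\<lambda>_. 1) n = of_int (\<Sum>d | d dvd n. moebius_mu d)"
    unfolding of_int_sum by (auto simp: dconv_def mu_low_def mu_high_def intro!: sum.cong)
  then show ?thesis using sum_moebius_mu_divisors[OF n] by simp
qed

lemma dconv_delta: "0 < n \<Longrightarrow> dconv f (\<lambda>k. if k = 1 then 1 else 0) n = f n"
proof -
  assume n: "0 < n"
  have "dconv f (\<lambda>k. if k = 1 then 1 else 0) n = (\<Sum>d\<in>{n}. f d * (if n div d = 1 then 1 else 0))"
    unfolding dconv_def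
  proof (rule sum.mono_neutral_right)
    show "\<forall>d\<in>{d. d dvd n} - {n}. f d * (if n div d = 1 then 1 else 0) = 0"
      using n by (auto elim!: dvdE)
  qed (use n in auto)
  then show ?thesis using n by simp
qed

text \<open>For n > U only the high part of Lambda is seen. It is convolved with the identity 1 *
  mu, and mu is split at U. In the term with low mu, 1 * Lambda_high is replaced by log - 1 *
  Lambda_low.\<close>

lemma vaughan_identity:
  assumes n: "0 < n" "U < real n"
  shows "mangoldt n = dconv (mu_low U) (\<lambda>k. of_real (ln (real k))) n
    - dconv (dconv (mu_low U) (vm_low U)) (\<lambda>_. 1) n
    + dconv (dconv (mu_high U) (\<lambda>_. 1)) (vm_high U) n"
proof -
  let ?one = "\<lambda>_::nat. 1::complex"
  have "mangoldt n = vm_high U n" using n by (simp add: vm_high_def)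
  also have "\<dots> = dconv (vm_high U) (\<lambda>k. if k = 1 then 1 else 0) n" using dconv_delta[OF n(1)] by simp
  also have "\<dots> = dconv (vm_high U) (dconv ?one (\<lambda>k. mu_low U k + mu_high U k)) n"
    by (rule dconv_cong[OF n(1) refl]) (simp add: dconv_mu_one dconv_commute[of _ ?one])
  also have "\<dots> = dconv (vm_high U) (\<lambda>k. dconv ?one (mu_low U) k + dconv ?one (mu_high U) k) n"
    by (rule dconv_cong[OF n(1) refl]) (rule dconv_add_right)
  also have "\<dots> = dconv (vm_high U) (dconv ?one (mu_low U)) n + dconv (vm_high U) (dconv ?one (mu_high U)) n"
    by (rule dconv_add_right)
  also have "dconv (vm_high U) (dconv ?one (mu_high U)) n = dconv (dconv (mu_high U) ?one) (vm_high U) n"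
  proof -
    have "dconv (vm_high U) (dconv ?one (mu_high U)) n = dconv (vm_high U) (dconv (mu_high U) ?one) n"
      by (rule dconv_cong[OF n(1) refl]) (rule dconv_commute)
    then show ?thesis using dconv_commute[OF n(1)] by simp
  qed
  also have "dconv (vm_high U) (dconv ?one (mu_low U)) n = dconv (dconv ?one (vm_high U)) (mu_low U) n"
  proof -
    have "dconv (vm_high U) (dconv ?one (mu_low U)) n = dconv (dconv (vm_high U) ?one) (mu_low U) n"
      by (rule dconv_assoc[OF n(1), symmetric])
    also have "\<dots> = dconv (dconv ?one (vm_high U)) (mu_low U) n"
      by (rule dconv_cong[OF n(1) _ refl]) (rule dconv_commute)
    finally show ?thesis .
  qed
  also have "\<dots> = dconv (mu_low U) (dconv ?one (vm_high U)) n" by (rule dconv_commute[OF n(1)])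
  also have "\<dots> = dconv (mu_low U) (\<lambda>k. of_real (ln (real k)) - dconv ?one (vm_low U) k) n"
  proof (rule dconv_cong[OF n(1) refl])
    fix k :: nat assume "0 < k"
    then show "dconv ?one (vm_high U) k = of_real (ln (real k)) - dconv ?one (vm_low U) k"
      using dconv_vm_one[of k U] by (simp add: dconv_add_right algebra_simps)
  qed
  also have "\<dots> = dconv (mu_low U) (\<lambda>k. of_real (ln (real k))) n - dconv (mu_low U) (dconv ?one (vm_low U)) n"
    by (rule dconv_diff_right)
  also have "dconv (mu_low U) (dconv ?one (vm_low U)) n = dconv (dconv (mu_low U) (vm_low U)) ?one n"
  proof -
    have "dconv (mu_low U) (dconv ?one (vm_low U)) n = dconv (mu_low U) (dconv (vm_low U) ?one) n"
      by (rule dconv_cong[OF n(1) refl]) (rule dconv_commute)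
    then show ?thesis using dconv_assoc[OF n(1)] by simp
  qed
  finally show ?thesis .
qed

lemma norm_mu_low_le: "norm (mu_low U n) \<le> 1" and norm_mu_high_le: "norm (mu_high U n) \<le> 1"
  using abs_moebius_mu_le[of n] by (auto simp: mu_low_def mu_high_def norm_of_int)

lemma norm_dconv_mu_high_one_le: "norm (dconv (mu_high U) (\<lambda>_. 1) n) \<le> tau n"
proof -
  have "norm (dconv (mu_high U) (\<lambda>_. 1) n) \<le> (\<Sum>d | d dvd n. 1)"
    unfolding dconv_def by (intro order_trans[OF norm_sum] sum_mono) (simp add: norm_mu_high_le)
  then show ?thesis by (simp add: tau_def)
qed

lemma norm_vm_high_le: "0 < n \<Longrightarrow> norm (vm_high U n) \<le> ln (real n)"
  using mangoldt_le[of n] by (simp add: vm_high_def)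

text \<open>The divisor sum of Lambda is log n, so the coefficient is bounded by a logarithm without
  any divisor function; this allows its use as a type I coefficient.\<close>

lemma norm_dconv_mu_low_vm_low_le:
  assumes "0 < n"
  shows "norm (dconv (mu_low U) (vm_low U) n) \<le> ln (real n)"
proof -
  have "norm (dconv (mu_low U) (vm_low U) n) = norm (dconv (vm_low U) (mu_low U) n)"
    using dconv_commute[OF assms] by simp
  also have "\<dots> \<le> (\<Sum>d | d dvd n. mangoldt d)"
    unfolding dconv_def
  proof (intro order_trans[OF norm_sum] sum_mono)
    fix d
    have "norm (vm_low U d) * norm (mu_low U (n div d)) \<le> mangoldt d * 1"
      using mangoldt_nonneg[of d] by (intro mult_mono norm_mu_low_le) (auto simp: vm_low_def)
    then show "norm (vm_low U d * mu_low U (n div d)) \<le> mangoldt d" by (simp add: norm_mult)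
  qed
  also have "\<dots> = ln (real n)" using mangoldt_sum[of n, where 'a = real] assms by simp
  finally show ?thesis .
qed

lemma dconv_mu_high_one_eq_0:
  assumes "0 < n" "real n \<le> U"
  shows "dconv (mu_high U) (\<lambda>_. 1) n = 0"
  unfolding dconv_def
proof (rule sum.neutral, rule ballI)
  fix d assume "d \<in> {d. d dvd n}"
  then have "real d \<le> U" using assms dvd_imp_le[of d n] by (auto intro: order_trans[rotated])
  then show "mu_high U d * 1 = 0" by (simp add: mu_high_def)
qed

lemma dconv_mu_low_vm_low_eq_0:
  assumes "0 < n" "U\<^sup>2 < real n"
  shows "dconv (mu_low U) (vm_low U) n = 0"
  unfolding dconv_def
proof (rule sum.neutral, rule ballI)
  fix d assume d: "d \<in> {d. d dvd n}"
  show "mu_low U d * vm_low U (n div d) = 0"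
  proof (rule ccontr)
    assume "mu_low U d * vm_low U (n div d) \<noteq> 0"
    then have "real d \<le> U" "real (n div d) \<le> U" by (auto simp: mu_low_def vm_low_def split: if_splits)
    then have "real d * real (n div d) \<le> U * U" by (intro mult_mono) auto
    moreover have "real d * real (n div d) = real n" using d by (simp flip: of_nat_mult)
    ultimately show False using assms by (simp add: power2_eq_square)
  qed
qed

lemma sum_dconv_ap_term:
  "(\<Sum>n=1..2*N. dconv f g n * ap_term \<alpha> N b d n) = bilinear_ap \<alpha> N b {1..2*N} f g d"
proof -
  have "(\<Sum>n=1..2*N. dconv f g n * ap_term \<alpha> N b d n)
      = (\<Sum>n=1..2*N. \<Sum>m | m dvd n. f m * g (n div m) * ap_term \<alpha> N b d n)"
    by (simp add: dconv_def sum_distrib_right)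
  also have "\<dots> = (\<Sum>(n, m)\<in>(SIGMA n:{1..2*N}. {m. m dvd n}). f m * g (n div m) * ap_term \<alpha> N b d n)"
    by (subst sum.Sigma) auto
  also have "\<dots> = (\<Sum>(m, k)\<in>{(m, k)\<in>{1..2*N}\<times>{1..2*N}. m * k \<le> 2 * N}. f m * g k * ap_term \<alpha> N b d (m * k))"
  proof (rule sum.reindex_bij_witness[where i = "\<lambda>(m, k). (m * k, m)" and j = "\<lambda>(n, m). (m, n div m)"])
    fix p assume "p \<in> (SIGMA n:{1..2*N}. {m. m dvd n})"
    then obtain m k where p: "p = (m * k, m)" "1 \<le> m * k" "m * k \<le> 2 * N" by (force elim: dvdE)
    then have pos: "0 < m" "0 < k" by auto
    then have "m \<le> m * k" "k \<le> m * k" by auto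
    then have "m \<le> 2 * N" "k \<le> 2 * N" using p(3) by linarith+
    then show "(case case p of (n, m) \<Rightarrow> (m, n div m) of (m, k) \<Rightarrow> (m * k, m)) = p"
      "(case p of (n, m) \<Rightarrow> (m, n div m)) \<in> {(m, k)\<in>{1..2*N}\<times>{1..2*N}. m * k \<le> 2 * N}"
      "(case case p of (n, m) \<Rightarrow> (m, n div m) of (m, k) \<Rightarrow> f m * g k * ap_term \<alpha> N b d (m * k)) = (case p of (n, m) \<Rightarrow> f m * g (n div m) * ap_term \<alpha> N b d n)"
      using p pos by auto
  qed auto
  also have "\<dots> = (\<Sum>(m, k)\<in>{1..2*N}\<times>{1..2*N}. f m * g k * ap_term \<alpha> N b d (m * k))"
    by (rule sum.mono_neutral_left) (auto simp: ap_term_def split: if_splits)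
  finally show ?thesis by (simp add: bilinear_ap_def sum.cartesian_product)
qed

lemma S_ap_vaughan:
  assumes "0 < N" "U < real N"
  shows "S_ap N \<alpha> b d = bilinear_ap \<alpha> N b {1..2*N} (mu_low U) (\<lambda>k. of_real (ln (real k))) d
    - bilinear_ap \<alpha> N b {1..2*N} (dconv (mu_low U) (vm_low U)) (\<lambda>_. 1) d
    + bilinear_ap \<alpha> N b {1..2*N} (dconv (mu_high U) (\<lambda>_. 1)) (vm_high U) d"
proof -
  have "S_ap N \<alpha> b d = (\<Sum>n=1..2*N. mangoldt n * ap_term \<alpha> N b d n)"
    unfolding S_ap_def using assms by (intro sum.mono_neutral_cong_left) (auto simp: ap_term_def)
  also have "\<dots> = (\<Sum>n=1..2*N. (dconv (mu_low U) (\<lambda>k. of_real (ln (real k))) n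
    - dconv (dconv (mu_low U) (vm_low U)) (\<lambda>_. 1) n + dconv (dconv (mu_high U) (\<lambda>_. 1)) (vm_high U) n) * ap_term \<alpha> N b d n)"
  proof (rule sum.cong[OF refl])
    fix n assume n: "n \<in> {1..2*N}"
    show "mangoldt n * ap_term \<alpha> N b d n = (dconv (mu_low U) (\<lambda>k. of_real (ln (real k))) n
    - dconv (dconv (mu_low U) (vm_low U)) (\<lambda>_. 1) n + dconv (dconv (mu_high U) (\<lambda>_. 1)) (vm_high U) n) * ap_term \<alpha> N b d n"
    proof (cases "N \<le> n")
      case True
      then have "0 < n" "U < real n" using assms by auto
      then show ?thesis by (simp only: vaughan_identity)
    qed (simp add: ap_term_def)
  qed
  finally show ?thesis
    by (simp only: distrib_right left_diff_distrib sum.distrib sum_subtractf sum_dconv_ap_term)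
qed

section \<open>Factorization of sieve moduli\<close>

text \<open>Greedy choice: factors are dropped from the end while the product stays at least T. The
  first product below T, with its next factor restored, lies between T and T Z.\<close>

lemma exists_divisor_between:
  assumes "\<forall>p\<in>set ps. 0 < p \<and> real p \<le> Z" "1 \<le> T" "1 \<le> Z" "T \<le> real (prod_list ps)"
  shows "\<exists>e. e dvd prod_list ps \<and> T \<le> real e \<and> real e \<le> T * Z"
  using assms
proof (induction ps rule: rev_induct)
  case Nil
  have "1 * 1 \<le> T * Z" using Nil by (intro mult_mono) auto
  then show ?case using Nil by (intro exI[of _ 1]) auto
next
  case (snoc p ps)
  show ?case
  proof (cases "T \<le> real (prod_list ps)")
    case True
    then obtain e where "e dvd prod_list ps" "T \<le> real e" "real e \<le> T * Z" using snoc by auto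
    then show ?thesis by (intro exI[of _ e]) auto
  next
    case False
    then have "real (prod_list ps) * real p \<le> T * Z" using snoc.prems by (intro mult_mono) auto
    then show ?thesis using snoc.prems by (intro exI[of _ "prod_list (ps @ [p])"]) auto
  qed
qed

text \<open>Applied with u = n^rho, v = n^(1 - rho), c = n^(1/3), P = n^eps. In terms of e = d / f
  the goal is d e <= M / Q and d / e <= n / (M Q). As d <= u / P, any divisor e between M / v and M
  / u works, and the ratio v / u of these ends is the allowed size of the factors in
  \<open>ps\<close>.\<close>

lemma exists_balanced_divisor:
  fixes n u v c M P Q :: real and d p :: nat
  assumes d: "d = p * prod_list ps" "0 < p" and ps: "\<forall>q\<in>set ps. 0 < q \<and> real q \<le> v / u"
    and uv: "u * v = n" "1 \<le> u" "u \<le> v" and c: "0 < c" "real p \<le> c / P" and dP: "real d \<le> u / P"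
    and M: "u \<le> M" "M \<le> 2 * n / c" and Q: "1 \<le> Q" "2 * Q \<le> P"
  shows "\<exists>f. f dvd d \<and> (real d)\<^sup>2 \<le> real f * M / Q \<and> real f \<le> n / (M * Q)"
proof -
  have pos: "0 < u" "0 < v" "0 < M" "0 < Q" "0 < P" "0 < n" using uv M Q by (auto simp: uv(1)[symmetric])
  have PQ: "Q \<le> P" using Q by linarith
  have MPQ: "M / P \<le> M / Q" "n / (M * P) \<le> n / (M * Q)" using pos PQ by (auto intro!: divide_left_mono mult_left_mono)
  have ps_pos: "0 < prod_list ps" using ps by (induction ps) auto
  show ?thesis
  proof (cases "M \<le> v")
    case True
    \<comment> \<open>Here M / v <= 1, so e = 1, that is f = d, already works.\<close>
    have "real d \<le> u / Q" using dP pos PQ divide_left_mono[of Q P u] by (simp add: order_trans)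
    also have "\<dots> \<le> M / Q" using M pos by (intro divide_right_mono) auto
    finally have "real d * real d \<le> real d * (M / Q)" by (intro mult_left_mono) auto
    moreover have "real d \<le> n / (M * Q)"
    proof -
      have "u * M \<le> n" using True pos uv by (metis mult_left_mono less_imp_le)
      then have "u / Q \<le> n / (M * Q)" using pos by (simp add: field_simps)
      then show ?thesis using \<open>real d \<le> u / Q\<close> by linarith
    qed
    ultimately show ?thesis by (intro exI[of _ d]) (simp add: power2_eq_square)
  next
    case False
    define T where "T = M / v"
    have T: "1 \<le> T" using False pos by (simp add: T_def)
    have Z: "1 \<le> v / u" using uv pos by simp
    show ?thesis
    proof (cases "T \<le> real (prod_list ps)")
      case True
      obtain e where e: "e dvd prod_list ps" "T \<le> real e" "real e \<le> T * (v / u)"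
        using exists_divisor_between[OF ps T Z True] by blast
      have "e dvd d" using e d by simp
      then obtain f where f: "d = e * f" by (elim dvdE)
      have e0: "0 < real e" using e T by linarith
      have "T * real f \<le> real e * real f" using e by (intro mult_right_mono) auto
      also have "\<dots> \<le> u / P" using dP f by simp
      finally have "real f \<le> n / (M * P)" unfolding T_def uv(1)[symmetric] using pos by (simp add: field_simps)
      moreover have "(real d)\<^sup>2 \<le> real f * M / Q"
      proof -
        have "real d * real e \<le> u / P * (T * (v / u))" using dP e pos T by (intro mult_mono) auto
        also have "\<dots> = M / P" using pos by (simp add: T_def)
        finally have "real d * real e \<le> M / Q" using MPQ by linarith
        then have "real f * (real d * real e) \<le> real f * (M / Q)" by (intro mult_left_mono) auto
        then show ?thesis unfolding f by (simp add: power2_eq_square mult_ac)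
      qed
      ultimately show ?thesis using f MPQ by (intro exI[of _ f]) auto
    next
      case False
      \<comment> \<open>The product of \<open>ps\<close> does not reach the window. Then e is this
        whole product: it is small enough for d e, and f = p is acceptable by p <= c / P and M <= 2
        n / c. The 2 of the last bound is absorbed by 2 Q <= P.\<close>
      define e where "e = prod_list ps"
      have e: "real e \<le> T" using False by (simp add: e_def)
      have "real d * real e \<le> u / P * T" using dP e pos by (intro mult_mono) auto
      also have "\<dots> = M / P * (u / v)" by (simp add: T_def)
      also have "\<dots> \<le> M / P * 1" using pos uv by (intro mult_left_mono) auto
      finally have "real d * real e \<le> M / Q" using MPQ by linarith
      then have "real p * (real d * real e) \<le> real p * (M / Q)" by (intro mult_left_mono) auto
      then have "(real d)\<^sup>2 \<le> real p * M / Q" unfolding d e_def by (simp add: power2_eq_square mult_ac)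
      moreover have "real p \<le> n / (M * Q)"
      proof -
        have "real p * (M * Q) \<le> c / P * (2 * n / c * Q)" using c M pos by (intro mult_mono) auto
        also have "\<dots> = n * (2 * Q / P)" using c by simp
        also have "\<dots> \<le> n * 1" using Q pos by (intro mult_left_mono) auto
        finally show ?thesis using pos by (simp add: pos_le_divide_eq)
      qed
      ultimately show ?thesis using d by (intro exI[of _ p]) auto
    qed
  qed
qed

lemma powr_le_powr_divideI:
  fixes y n :: real and k :: nat
  assumes "0 \<le> y" "y ^ k \<le> n powr a" "0 < k" "a / k = c" "0 < n"
  shows "y \<le> n powr c"
proof (cases "y = 0")
  case False
  then have "y = (y powr k) powr (1 / k)" using assms by (simp add: powr_powr)
  also have "\<dots> = (y ^ k) powr (1 / k)" using False assms by (simp add: powr_realpow)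
  also have "\<dots> \<le> (n powr a) powr (1 / k)" using assms by (intro powr_mono2) auto
  also have "\<dots> = n powr c" using assms by (simp add: powr_powr)
  finally show ?thesis .
qed simp

text \<open>The condition at index 0 gives p_1^2 <= n^(2/5), so all prime factors are at most
  n^(1/5), and 1/5 = 1 - 2 * (2/5). The exceptional factor is taken to be 1.\<close>

lemma sieve_support_upper_factor:
  fixes n :: real
  assumes d: "d \<in> sieve_support True n (2/5 - \<epsilon>) z" and n: "1 \<le> n" and \<epsilon>: "0 < \<epsilon>" "\<epsilon> \<le> 1/3"
  shows "\<exists>p ps. d = p * prod_list ps \<and> 0 < p \<and> real p \<le> n powr (1/3 - \<epsilon>) \<and>
    (\<forall>q\<in>set ps. 0 < q \<and> real q \<le> n powr (1 - 2 * (2/5)))"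
proof -
  obtain ps where ps: "d = prod_list ps" "\<forall>p\<in>set ps. prime p \<and> real p \<le> z" "sorted_wrt (>) ps"
    "\<forall>i<length ps. even i \<longrightarrow> real (prod_list (take i ps) * (ps ! i)^2) \<le> n powr (2/5 - \<epsilon>)"
    using d by (auto simp: sieve_support_def)
  have "real q \<le> n powr (1 - 2 * (2/5))" if q: "q \<in> set ps" for q
  proof -
    obtain p1 qs where c: "ps = p1 # qs" using q by (cases ps) auto
    have "q \<le> p1" using q ps(3) unfolding c by auto
    then have "(real q)\<^sup>2 \<le> (real p1)\<^sup>2" by (intro power_mono) auto
    also have "(real p1)\<^sup>2 \<le> n powr (2/5 - \<epsilon>)" using ps(4)[rule_format, of 0] by (simp add: c)
    also have "\<dots> \<le> n powr (2/5)" using n \<epsilon> by (intro powr_mono) auto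
    finally show ?thesis using n by (intro powr_le_powr_divideI[of "real q" 2 n "2/5"]) auto
  qed
  moreover have "0 < q" if "q \<in> set ps" for q using that ps(2) by (simp add: prime_gt_0_nat)
  moreover have "1 \<le> n powr (1/3 - \<epsilon>)" using n \<epsilon> by (intro ge_one_powr_ge_zero) auto
  ultimately show ?thesis using ps(1) by (intro exI[of _ 1] exI[of _ ps]) auto
qed

text \<open>The exceptional factor is p_1, controlled by z. Any other prime q satisfies q^3 <= p_1
  p_2^2 <= n^(3/7), hence q <= n^(1/7), and 1/7 = 1 - 2 * (3/7).\<close>

lemma sieve_support_lower_factor:
  fixes n :: real
  assumes d: "d \<in> sieve_support False n (3/7 - \<epsilon>) z" and n: "1 \<le> n" and \<epsilon>: "0 < \<epsilon>" "\<epsilon> \<le> 1/3"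
    and z: "z \<le> n powr (1/3 - \<epsilon>)"
  shows "\<exists>p ps. d = p * prod_list ps \<and> 0 < p \<and> real p \<le> n powr (1/3 - \<epsilon>) \<and>
    (\<forall>q\<in>set ps. 0 < q \<and> real q \<le> n powr (1 - 2 * (3/7)))"
proof -
  obtain ps where ps: "d = prod_list ps" "\<forall>p\<in>set ps. prime p \<and> real p \<le> z" "sorted_wrt (>) ps"
    "\<forall>i<length ps. odd i \<longrightarrow> real (prod_list (take i ps) * (ps ! i)^2) \<le> n powr (3/7 - \<epsilon>)"
    using d by (auto simp: sieve_support_def)
  show ?thesis
  proof (cases ps)
    case Nil
    have "1 \<le> n powr (1/3 - \<epsilon>)" using n \<epsilon> by (intro ge_one_powr_ge_zero) auto
    then show ?thesis using ps(1) Nil by (intro exI[of _ 1] exI[of _ "[]"]) auto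
  next
    case (Cons p1 qs)
    have "real q \<le> n powr (1 - 2 * (3/7))" if q: "q \<in> set qs" for q
    proof -
      obtain p2 rs where c: "qs = p2 # rs" using q by (cases qs) auto
      have "q \<le> p2" "p2 \<le> p1" using q ps(3) unfolding Cons c by auto
      then have "real q ^ 3 \<le> real p1 * (real p2)\<^sup>2"
        unfolding power3_eq_cube power2_eq_square mult.assoc by (intro mult_mono) auto
      also have "\<dots> \<le> n powr (3/7 - \<epsilon>)" using ps(4)[rule_format, of 1] by (simp add: Cons c)
      also have "\<dots> \<le> n powr (3/7)" using n \<epsilon> by (intro powr_mono) auto
      finally show ?thesis using n by (intro powr_le_powr_divideI[of "real q" 3 n "3/7"]) auto
    qed
    moreover have "0 < q" if "q \<in> set ps" for q using that ps(2) by (simp add: prime_gt_0_nat)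
    moreover have "real p1 \<le> n powr (1/3 - \<epsilon>)" using ps(2) z Cons by auto
    ultimately show ?thesis using ps(1) Cons by (intro exI[of _ p1] exI[of _ qs]) auto
  qed
qed

lemma sum_dyadic_blocks:
  fixes F :: "nat \<Rightarrow> 'a::comm_monoid_add"
  shows "(\<Sum>m=s..<s * 2 ^ I. F m) = (\<Sum>i<I. \<Sum>m\<in>{s * 2 ^ i..<2 * (s * 2 ^ i)}. F m)"
proof (induction I)
  case (Suc I)
  have "s * 1 \<le> s * 2 ^ I" "s * 2 ^ I * 1 \<le> s * 2 ^ I * 2" by (rule mult_le_mono2, simp)+
  then have "(\<Sum>m=s..<s * 2 ^ Suc I. F m) = (\<Sum>m=s..<s * 2 ^ I. F m) + (\<Sum>m\<in>{s * 2 ^ I..<s * 2 ^ Suc I}. F m)"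
    by (intro sum.atLeastLessThan_concat[symmetric]) auto
  then show ?case using Suc by (simp add: mult_ac)
qed simp

context minor_arc
begin

text \<open>A factor n / m >= 1 is inserted to reach the moment of tau with weight 1 / m.\<close>

lemma sum_norm_square_le:
  fixes \<xi> :: "nat \<Rightarrow> complex"
  assumes "real n \<le> 2 * x" "I \<subseteq> {1..n}" "\<And>m. m \<in> I \<Longrightarrow> norm (\<xi> m) \<le> L * tau m"
  shows "(\<Sum>m\<in>I. (norm (\<xi> m))\<^sup>2) \<le> real n * L ^ 6"
proof -
  have "(\<Sum>m\<in>I. (norm (\<xi> m))\<^sup>2) \<le> (\<Sum>m\<in>I. real n * L\<^sup>2 * (tau m ^ 2 / real m))"
  proof (rule sum_mono)
    fix m assume m: "m \<in> I"
    have "(norm (\<xi> m))\<^sup>2 \<le> (L * tau m)\<^sup>2" using assms(3)[OF m] by (intro power_mono) auto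
    also have "\<dots> = 1 * (L\<^sup>2 * (tau m)\<^sup>2)" by (simp add: power_mult_distrib)
    also have "\<dots> \<le> real n / real m * (L\<^sup>2 * (tau m)\<^sup>2)" using m assms(2) by (intro mult_right_mono) auto
    finally show "(norm (\<xi> m))\<^sup>2 \<le> real n * L\<^sup>2 * (tau m ^ 2 / real m)" by simp
  qed
  also have "\<dots> \<le> (\<Sum>m=1..n. real n * L\<^sup>2 * (tau m ^ 2 / real m))"
    using assms(2) by (intro sum_mono2) auto
  also have "\<dots> = real n * L\<^sup>2 * (\<Sum>m=1..n. tau m ^ 2 / real m)" by (rule sum_distrib_left[symmetric])
  also have "\<dots> \<le> real n * L\<^sup>2 * L ^ (2 ^ 2)"
    by (intro mult_left_mono sum_tau_power_le harm_le_L assms) auto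
  also have "\<dots> = real n * L ^ 6" by (simp flip: power_add)
  finally show ?thesis .
qed

text \<open>Dyadic decomposition of m. In a block at M the squared norms of the coefficients have
  sizes about M and N / M up to powers of L, so their product and the bound do not depend on M; the
  number of blocks costs a factor 2 L.\<close>

lemma type_II:
  fixes N :: nat and b :: int and Ds :: "nat set" and \<xi> \<eta> :: "nat \<Rightarrow> complex" and T s :: real
  assumes xN: "x = 4 * real N" and Ds: "finite Ds" "\<And>d. d \<in> Ds \<Longrightarrow> 0 < d \<and> coprime (int d) b"
    and s: "1 \<le> s" "T \<le> real N"
    and fac: "\<And>d M. d \<in> Ds \<Longrightarrow> s \<le> real M \<Longrightarrow> real M < T \<Longrightarrow>
        \<exists>f. f dvd d \<and> (real d)\<^sup>2 \<le> real f * real M / r ^ 24 \<and> real f \<le> real N / (real M * r ^ 24)"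
    and supp: "\<And>m. \<xi> m \<noteq> 0 \<Longrightarrow> s \<le> real m \<and> real m < T"
    and \<xi>: "\<And>m. 1 \<le> m \<Longrightarrow> m \<le> 2 * N \<Longrightarrow> norm (\<xi> m) \<le> L * tau m"
    and \<eta>: "\<And>m. 1 \<le> m \<Longrightarrow> m \<le> 2 * N \<Longrightarrow> norm (\<eta> m) \<le> L * tau m"
  shows "(\<Sum>d\<in>Ds. norm (bilinear_ap \<alpha> N b {1..2*N} \<xi> \<eta> d)) \<le> 18 * x * L ^ 14 / sqrt r"
proof -
  \<comment> \<open>Rounding up makes all blocks start at integers M >= s, where \<open>fac\<close>
    is available.\<close>
  define s0 where "s0 = nat \<lceil>s\<rceil>"
  have s0: "s \<le> real m \<longleftrightarrow> s0 \<le> m" for m unfolding s0_def by linarith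
  have s0_ge: "1 \<le> s0" using s unfolding s0_def by linarith
  obtain I :: nat where I: "x < 2 ^ I" "real I \<le> 2 * L" by (rule exists_dyadic_length)
  define M where "M i = s0 * 2 ^ i" for i
  have M1: "1 \<le> M i" "s0 \<le> M i" for i using s0_ge by (auto simp: M_def Suc_le_eq)
  have decomp: "bilinear_ap \<alpha> N b {1..2*N} \<xi> \<eta> d = (\<Sum>i<I. bilinear_ap \<alpha> N b {M i..<2 * M i} \<xi> \<eta> d)" for d
  proof -
    define F where "F m = (\<Sum>n=1..2*N. \<xi> m * \<eta> n * ap_term \<alpha> N b d (m * n))" for m
    have F0: "F m = 0" if "\<not> (s0 \<le> m \<and> real m < T)" for m
    proof (rule ccontr)
      assume "F m \<noteq> 0"
      then have "\<xi> m \<noteq> 0" unfolding F_def by (metis (no_types, lifting) mult_eq_0_iff sum.neutral)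
      then show False using supp[of m] s0[of m] that by blast
    qed
    have big: "2 * N < s0 * 2 ^ I"
    proof -
      have "real (2 * N) \<le> x" using xN by simp
      also have "\<dots> < real (2 ^ I)" using I by simp
      finally have "2 * N < 1 * 2 ^ I" by (simp only: of_nat_less_iff mult_1)
      also have "\<dots> \<le> s0 * 2 ^ I" using s0_ge by (intro mult_le_mono1)
      finally show ?thesis .
    qed
    have "bilinear_ap \<alpha> N b {1..2*N} \<xi> \<eta> d = (\<Sum>m=1..2*N. F m)" by (simp add: bilinear_ap_def F_def)
    also have "\<dots> = (\<Sum>m=s0..<s0 * 2 ^ I. F m)"
    proof (rule sum.mono_neutral_cong)
      show "F m = 0" if "m \<in> {s0..<s0 * 2 ^ I} - {1..2*N}" for m
      proof (rule F0)
        have "2 * N < m" using that s0_ge by auto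
        then show "\<not> (s0 \<le> m \<and> real m < T)" using s by linarith
      qed
      show "F m = 0" if "m \<in> {1..2*N} - {s0..<s0 * 2 ^ I}" for m
        using that big by (intro F0) auto
    qed auto
    also have "\<dots> = (\<Sum>i<I. bilinear_ap \<alpha> N b {M i..<2 * M i} \<xi> \<eta> d)"
      unfolding sum_dyadic_blocks M_def bilinear_ap_def F_def ..
    finally show ?thesis .
  qed
  have block: "(\<Sum>d\<in>Ds. norm (bilinear_ap \<alpha> N b {M i..<2 * M i} \<xi> \<eta> d)) \<le> 9 * x * L ^ 13 / sqrt r" for i
  proof (cases "real (M i) < T")
    case True
    have Ms: "s \<le> real (M i)" using M1 s0 by blast
    have MN: "real (M i) \<le> real N" using True s by linarith
    \<comment> \<open>The factorization depends on M, so it is chosen separately for each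
      block.\<close>
    define f where "f d = (SOME f. f dvd d \<and> (real d)\<^sup>2 \<le> real f * real (M i) / r ^ 24 \<and> real f \<le> real N / (real (M i) * r ^ 24))" for d
    have f: "f d dvd d \<and> (real d)\<^sup>2 \<le> real (f d) * real (M i) / r ^ 24 \<and> real (f d) \<le> real N / (real (M i) * r ^ 24)"
      if "d \<in> Ds" for d
      unfolding f_def using fac[OF that Ms True] by (rule someI_ex)
    have N0: "0 < N" using MN M1[of i] by linarith
    define n1 where "n1 = 2 * N div M i"
    have n1: "real n1 * real (M i) \<le> 2 * real N"
    proof -
      have "n1 * M i \<le> 2 * N" by (simp add: n1_def)
      then show ?thesis by (metis of_nat_le_iff of_nat_mult of_nat_numeral)
    qed
    have n1N: "n1 \<le> 2 * N" by (simp add: n1_def)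
    have "(\<Sum>d\<in>Ds. norm (bilinear_ap \<alpha> N b {M i..<2 * M i} \<xi> \<eta> d))\<^sup>2
        \<le> (real (2 * M i) * L ^ 6) * L * ((real n1 * L ^ 6) * (75 * x * L ^ 12 / r))"
    proof (rule type_II_block[where f = f])
      show "(\<Sum>m=M i..<2 * M i. (norm (\<xi> m))\<^sup>2) \<le> real (2 * M i) * L ^ 6"
        using MN M1[of i] xN by (intro sum_norm_square_le \<xi>) auto
      show "(\<Sum>n=1..2 * N div M i. (norm (\<eta> n))\<^sup>2) \<le> real n1 * L ^ 6"
        unfolding n1_def[symmetric] using n1N xN by (intro sum_norm_square_le \<eta>) auto
    qed (use f Ds xN MN M1[of i] in auto)
    also have "\<dots> = (real n1 * real (M i)) * (150 * x / r * L ^ 25)"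
      by (simp add: eval_nat_numeral)
    also have "\<dots> \<le> (2 * real N) * (150 * x / r * L ^ 25)"
      using n1 x_ge_2 L_ge_2 r by (intro mult_right_mono) auto
    also have "\<dots> = 75 * (x\<^sup>2 / r * L ^ 25)" using xN by (simp add: power2_eq_square)
    also have "\<dots> \<le> 81 * (x\<^sup>2 / r * L ^ 26)"
      using L_pow_mono[of 25 26] L_ge_2 r by (intro mult_mono) auto
    also have "\<dots> = (9 * x * L ^ 13 / sqrt r)\<^sup>2"
      using r by (simp add: power_mult_distrib power_divide flip: power_mult)
    finally show ?thesis
      by (rule power2_le_imp_le) (use x_ge_2 L_ge_2 r in \<open>auto intro!: divide_nonneg_nonneg mult_nonneg_nonneg\<close>)
  next
    case False
    have "bilinear_ap \<alpha> N b {M i..<2 * M i} \<xi> \<eta> d = 0" for d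
      unfolding bilinear_ap_def
    proof (rule sum.neutral, rule ballI)
      fix m assume "m \<in> {M i..<2 * M i}"
      then have "\<xi> m = 0" using supp[of m] False by (cases "\<xi> m = 0") auto
      then show "(\<Sum>n = 1..2 * N. \<xi> m * \<eta> n * ap_term \<alpha> N b d (m * n)) = 0" by simp
    qed
    then show ?thesis using x_ge_2 L_ge_2 r by simp
  qed
  have "(\<Sum>d\<in>Ds. norm (bilinear_ap \<alpha> N b {1..2*N} \<xi> \<eta> d)) \<le> (\<Sum>d\<in>Ds. \<Sum>i<I. norm (bilinear_ap \<alpha> N b {M i..<2 * M i} \<xi> \<eta> d))"
    unfolding decomp by (intro sum_mono norm_sum)
  also have "\<dots> = (\<Sum>i<I. \<Sum>d\<in>Ds. norm (bilinear_ap \<alpha> N b {M i..<2 * M i} \<xi> \<eta> d))" by (rule sum.swap)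
  also have "\<dots> \<le> (\<Sum>i<I. 9 * x * L ^ 13 / sqrt r)" by (intro sum_mono block)
  also have "\<dots> = real I * (9 * x * L ^ 13 / sqrt r)" by simp
  also have "\<dots> \<le> 2 * L * (9 * x * L ^ 13 / sqrt r)"
    using I x_ge_2 L_ge_2 r by (intro mult_right_mono) auto
  also have "\<dots> = 18 * x * L ^ 14 / sqrt r" by (simp add: eval_nat_numeral)
  finally show ?thesis .
qed

end

lemma bilinear_ap_add_left:
  "bilinear_ap \<alpha> N b I (\<lambda>m. \<xi> m + \<xi>' m) \<eta> d = bilinear_ap \<alpha> N b I \<xi> \<eta> d + bilinear_ap \<alpha> N b I \<xi>' \<eta> d"
  by (simp add: bilinear_ap_def sum.distrib algebra_simps)

lemma bilinear_ap_restrict: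
  assumes "\<And>m. m \<in> I \<Longrightarrow> m \<notin> J \<Longrightarrow> \<xi> m = 0" "J \<subseteq> I" "finite I"
  shows "bilinear_ap \<alpha> N b I \<xi> \<eta> d = bilinear_ap \<alpha> N b J \<xi> \<eta> d"
  unfolding bilinear_ap_def by (rule sum.mono_neutral_right) (use assms in auto)

lemma bilinear_ap_commute:
  "bilinear_ap \<alpha> N b {1..2*N} \<xi> \<eta> d = bilinear_ap \<alpha> N b {1..2*N} \<eta> \<xi> d"
  unfolding bilinear_ap_def by (subst sum.swap) (simp only: mult_ac)

lemma bilinear_ap_cong:
  assumes "\<And>m n. m \<in> I \<Longrightarrow> n \<in> {1..2*N} \<Longrightarrow> N \<le> m * n \<Longrightarrow> m * n < 2 * N \<Longrightarrow> \<xi> m * \<eta> n = \<xi>' m * \<eta>' n"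
  shows "bilinear_ap \<alpha> N b I \<xi> \<eta> d = bilinear_ap \<alpha> N b I \<xi>' \<eta>' d"
  unfolding bilinear_ap_def
proof (intro sum.cong refl)
  fix m n assume "m \<in> I" "n \<in> {1..2*N}"
  then show "\<xi> m * \<eta> n * ap_term \<alpha> N b d (m * n) = \<xi>' m * \<eta>' n * ap_term \<alpha> N b d (m * n)"
    using assms[of m n] by (cases "N \<le> m * n \<and> m * n < 2 * N") (auto simp: ap_term_def)
qed

context minor_arc
begin

text \<open>The three convolutions yield five sums. \<open>mu_low\<close> lives on m <= U <= sqrt N:
  type I. \<open>dconv (mu_low U) (vm_low U)\<close> lives on m <= U^2; the part up to sqrt N is
  type I, the rest type II with coefficients 1. In the last convolution both variables exceed U,
  hence lie below T = 2 N / U, and since their product is at least N one of them is at least sqrt N;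
  that one becomes the outer variable.\<close>

lemma S_ap_sum_le:
  fixes N :: nat and b :: int and Ds :: "nat set" and U :: real
  assumes xN: "x = 4 * real N" and Ds: "finite Ds" "\<And>d. d \<in> Ds \<Longrightarrow> 0 < d \<and> coprime (int d) b"
    and U: "2 \<le> U" "U\<^sup>2 \<le> real N" "U ^ 3 \<le> real N"
    and fac: "\<And>d M. d \<in> Ds \<Longrightarrow> sqrt (real N) \<le> real M \<Longrightarrow> real M < 2 * real N / U \<Longrightarrow>
        \<exists>f. f dvd d \<and> (real d)\<^sup>2 \<le> real f * real M / r ^ 24 \<and> real f \<le> real N / (real M * r ^ 24)"
    and small: "\<And>d. d \<in> Ds \<Longrightarrow> real d * sqrt (real N) \<le> x / r ^ 24"
  shows "(\<Sum>d\<in>Ds. norm (S_ap N \<alpha> b d)) \<le> 128 * x * L ^ 14 / sqrt r"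
proof -
  define s where "s = sqrt (real N)"
  define T where "T = 2 * real N / U"
  have N1: "1 \<le> real N" 
  proof -
    have "(1::real) \<le> U\<^sup>2" using U by (intro one_le_power) auto
    then show ?thesis using U by linarith
  qed
  have N0: "0 < N" using N1 by linarith
  have s1: "1 \<le> s" "s * s = real N" using N1 by (auto simp: s_def)
  have Us: "U \<le> s" unfolding s_def using U by (intro real_le_rsqrt) auto
  have TN: "T \<le> real N" unfolding T_def using U N1 by (simp add: field_simps)
  have U2T: "U\<^sup>2 < T" 
  proof -
    have "U\<^sup>2 * U < 2 * real N" using U N1 by (simp add: power2_eq_square power3_eq_cube)
    then show ?thesis unfolding T_def using U by (simp add: pos_less_divide_eq)
  qed
  have UN: "U < real N"
  proof -
    have "U * 2 \<le> U * U" using U by (intro mult_left_mono) auto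
    also have "\<dots> \<le> real N" using U(2) by (simp add: power2_eq_square)
    finally show ?thesis using U by linarith
  qed
  have lnL: "ln (real m) \<le> L" if "m \<le> 2 * N" for m :: nat
  proof (cases "m = 0")
    case False
    have "ln (real m) \<le> ln x" using that False xN N0 by (subst ln_le_cancel_iff) auto
    then show ?thesis by (simp add: L_def)
  qed (use L_ge_2 in simp)
  have lnL': "ln (real m) \<le> L * tau m" if "1 \<le> m" "m \<le> 2 * N" for m :: nat
  proof -
    have "L * 1 \<le> L * tau m" using that L_ge_2 by (intro mult_left_mono tau_ge_1) auto
    then show ?thesis using lnL[OF that(2)] by simp
  qed
  have tauL: "tau m \<le> L * tau m" for m
  proof -
    have "1 * tau m \<le> L * tau m" using L_ge_2 by (intro mult_right_mono) auto
    then show ?thesis by simp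
  qed
  let ?one = "\<lambda>_::nat. 1 :: complex" and ?ln = "\<lambda>k::nat. of_real (ln (real k)) :: complex"
  let ?c2 = "dconv (mu_low U) (vm_low U)" and ?c3 = "dconv (mu_high U) ?one"
  let ?B = "\<lambda>I \<xi> \<eta> d. bilinear_ap \<alpha> N b I \<xi> \<eta> d"
  let ?I = "{m\<in>{1..2*N}. real m \<le> s}"
  \<comment> \<open>The value m = s, possible when N is a square, already belongs to
    \<open>?I\<close> and is excluded here.\<close>
  define \<xi>2 where "\<xi>2 m = (if s \<le> real m \<and> real m < T \<and> s \<noteq> real m then ?c2 m else 0)" for m
  define \<xi>3 where "\<xi>3 m = (if s \<le> real m \<and> real m < T then ?c3 m else 0)" for m
  \<comment> \<open>For m below sqrt N the roles are exchanged: \<open>v3\<close> becomes the outer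
    coefficient and \<open>\<eta>3\<close> the inner one.\<close>
  define \<eta>3 where "\<eta>3 m = (if s \<le> real m then 0 else ?c3 m)" for m
  define v3 where "v3 k = (if s \<le> real k \<and> real k < T then vm_high U k else 0)" for k
  have dm: "real (d * m) \<le> x / r ^ 24" if "d \<in> Ds" "m \<in> ?I" for d m
  proof -
    have "real (d * m) \<le> real d * s" unfolding of_nat_mult using that by (intro mult_left_mono) auto
    then show ?thesis using small[OF that(1)] unfolding s_def by linarith
  qed
  have T1: "(\<Sum>d\<in>Ds. norm (?B {1..2*N} (mu_low U) ?ln d)) \<le> 1 * L * (37 * x * L ^ 12 / r)"
  proof -
    have "?B {1..2*N} (mu_low U) ?ln d = ?B ?I (mu_low U) ?ln d" for d
      by (rule bilinear_ap_restrict) (use Us in \<open>auto simp: mu_low_def\<close>)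
    moreover have "mono (\<lambda>k::nat. ln (real k))"
    proof (rule monoI)
      fix i j :: nat assume "i \<le> j"
      then show "ln (real i) \<le> ln (real j)" by (cases "i = 0"; cases "j = 0") auto
    qed
    ultimately show ?thesis
      using type_I[OF xN Ds(1) _ Ds(2), of ?I "mu_low U" 1 "\<lambda>k. ln (real k)"] dm norm_mu_low_le lnL[of "2 * N"] by simp
  qed
  have T2a: "(\<Sum>d\<in>Ds. norm (?B ?I ?c2 ?one d)) \<le> L * L * (37 * x * L ^ 12 / r)"
  proof -
    have "?B ?I ?c2 ?one d = ?B ?I ?c2 (\<lambda>n. of_real (if n = 0 then 0 else 1)) d" for d
      by (rule bilinear_ap_cong) auto
    moreover have "mono (\<lambda>n::nat. if n = 0 then 0 else 1 :: real)" by (rule monoI) auto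
    moreover have "norm (?c2 m) \<le> L" if "m \<in> ?I" for m
      using norm_dconv_mu_low_vm_low_le[of m U] lnL[of m] that by auto
    ultimately show ?thesis
      using type_I[OF xN Ds(1) _ Ds(2), of ?I ?c2 L "\<lambda>n. if n = 0 then 0 else 1"] dm L_ge_2 by simp
  qed
  have T2b: "(\<Sum>d\<in>Ds. norm (?B {1..2*N} \<xi>2 ?one d)) \<le> 18 * x * L ^ 14 / sqrt r"
  proof (rule type_II[OF xN Ds s1(1) TN fac[folded s_def T_def]])
    fix m :: nat assume m: "1 \<le> m" "m \<le> 2 * N"
    show "norm (\<xi>2 m) \<le> L * tau m"
      using norm_dconv_mu_low_vm_low_le[of m U] lnL'[OF m] m L_ge_2 by (auto simp: \<xi>2_def)
    show "norm (1::complex) \<le> L * tau m"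
      using tau_ge_1[of m] tauL[of m] m unfolding norm_one by linarith
  qed (auto simp: \<xi>2_def split: if_splits)
  have T3a: "(\<Sum>d\<in>Ds. norm (?B {1..2*N} \<xi>3 (vm_high U) d)) \<le> 18 * x * L ^ 14 / sqrt r"
  proof (rule type_II[OF xN Ds s1(1) TN fac[folded s_def T_def]])
    fix m :: nat assume m: "1 \<le> m" "m \<le> 2 * N"
    show "norm (\<xi>3 m) \<le> L * tau m"
      using norm_dconv_mu_high_one_le[of U m] tauL[of m] L_ge_2 by (auto simp: \<xi>3_def)
    show "norm (vm_high U m) \<le> L * tau m"
      using norm_vm_high_le[of m U] lnL'[OF m] m by simp
  qed (auto simp: \<xi>3_def split: if_splits)
  have T3b: "(\<Sum>d\<in>Ds. norm (?B {1..2*N} v3 \<eta>3 d)) \<le> 18 * x * L ^ 14 / sqrt r"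
  proof (rule type_II[OF xN Ds s1(1) TN fac[folded s_def T_def]])
    fix m :: nat assume m: "1 \<le> m" "m \<le> 2 * N"
    show "norm (\<eta>3 m) \<le> L * tau m"
      using norm_dconv_mu_high_one_le[of U m] tauL[of m] L_ge_2 by (auto simp: \<eta>3_def)
    show "norm (v3 m) \<le> L * tau m"
      using norm_vm_high_le[of m U] lnL'[OF m] m L_ge_2 by (auto simp: v3_def)
  qed (auto simp: v3_def split: if_splits)
  have split2: "?B {1..2*N} ?c2 ?one d = ?B ?I ?c2 ?one d + ?B {1..2*N} \<xi>2 ?one d" for d
  proof -
    have "?B {1..2*N} ?c2 ?one d = ?B {1..2*N} (\<lambda>m. (if real m \<le> s then ?c2 m else 0) + \<xi>2 m) ?one d"
    proof (rule bilinear_ap_cong)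
      fix m n assume m: "m \<in> {1..2*N}"
      have "?c2 m = 0" if "T \<le> real m"
        using U2T that m by (intro dconv_mu_low_vm_low_eq_0) auto
      then show "?c2 m * 1 = ((if real m \<le> s then ?c2 m else 0) + \<xi>2 m) * 1"
        by (auto simp: \<xi>2_def)
    qed
    also have "\<dots> = ?B {1..2*N} (\<lambda>m. if real m \<le> s then ?c2 m else 0) ?one d + ?B {1..2*N} \<xi>2 ?one d"
      by (rule bilinear_ap_add_left)
    also have "?B {1..2*N} (\<lambda>m. if real m \<le> s then ?c2 m else 0) ?one d = ?B ?I (\<lambda>m. if real m \<le> s then ?c2 m else 0) ?one d"
      by (rule bilinear_ap_restrict) auto
    also have "\<dots> = ?B ?I ?c2 ?one d" by (rule bilinear_ap_cong) auto
    finally show ?thesis .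
  qed
  have split3: "?B {1..2*N} ?c3 (vm_high U) d = ?B {1..2*N} \<xi>3 (vm_high U) d + ?B {1..2*N} v3 \<eta>3 d" for d
  proof -
    have big: "U * real k < 2 * real N" if "U < real m" "0 < k" "m * k < 2 * N" for m k :: nat
    proof -
      have "U * real k \<le> real m * real k" using that by (intro mult_right_mono) auto
      also have "\<dots> < 2 * real N" using that(3) by (metis of_nat_less_iff of_nat_mult of_nat_numeral)
      finally show ?thesis .
    qed
    have lt_T: "real k < T" if "U < real m" "0 < k" "m * k < 2 * N" for m k :: nat
      using big[OF that] U unfolding T_def by (simp add: pos_less_divide_eq mult.commute)
    have "?B {1..2*N} ?c3 (vm_high U) d = ?B {1..2*N} (\<lambda>m. (if s \<le> real m then ?c3 m else 0) + \<eta>3 m) (vm_high U) d"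
      by (rule bilinear_ap_cong) (simp add: \<eta>3_def)
    also have "\<dots> = ?B {1..2*N} (\<lambda>m. if s \<le> real m then ?c3 m else 0) (vm_high U) d + ?B {1..2*N} \<eta>3 (vm_high U) d"
      by (rule bilinear_ap_add_left)
    also have "?B {1..2*N} (\<lambda>m. if s \<le> real m then ?c3 m else 0) (vm_high U) d = ?B {1..2*N} \<xi>3 (vm_high U) d"
    proof (rule bilinear_ap_cong)
      fix m n assume mn: "m \<in> {1..2*N}" "n \<in> {1..2*N}" "N \<le> m * n" "m * n < 2 * N"
      have "real m < T" if "vm_high U n \<noteq> 0"
        using lt_T[of n m] mn that by (auto simp: vm_high_def mult.commute split: if_splits)
      then show "(if s \<le> real m then ?c3 m else 0) * vm_high U n = \<xi>3 m * vm_high U n"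
        by (auto simp: \<xi>3_def)
    qed
    also have "?B {1..2*N} \<eta>3 (vm_high U) d = ?B {1..2*N} \<eta>3 v3 d"
    proof (rule bilinear_ap_cong)
      fix m n assume mn: "m \<in> {1..2*N}" "n \<in> {1..2*N}" "N \<le> m * n" "m * n < 2 * N"
      have "s \<le> real n \<and> real n < T" if nz: "\<eta>3 m \<noteq> 0"
      proof
        have ms: "real m < s" "?c3 m \<noteq> 0" using nz by (auto simp: \<eta>3_def split: if_splits)
        have "U < real m" using dconv_mu_high_one_eq_0[of m U] ms mn by (cases "real m \<le> U") auto
        then show "real n < T" using lt_T[of m n] mn by simp
        have "s * s \<le> real m * real n" unfolding s1 using mn(3) by (metis of_nat_le_iff of_nat_mult)
        also have "\<dots> \<le> s * real n" using ms by (intro mult_right_mono) auto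
        finally show "s \<le> real n" by (rule mult_left_le_imp_le) (use s1 in simp)
      qed
      then show "\<eta>3 m * vm_high U n = \<eta>3 m * v3 n" by (auto simp: v3_def)
    qed
    also have "\<dots> = ?B {1..2*N} v3 \<eta>3 d" by (rule bilinear_ap_commute)
    finally show ?thesis .
  qed
  have "(\<Sum>d\<in>Ds. norm (S_ap N \<alpha> b d)) \<le> (\<Sum>d\<in>Ds. norm (?B {1..2*N} (mu_low U) ?ln d) + norm (?B ?I ?c2 ?one d)
      + norm (?B {1..2*N} \<xi>2 ?one d) + norm (?B {1..2*N} \<xi>3 (vm_high U) d) + norm (?B {1..2*N} v3 \<eta>3 d))"
  proof (rule sum_mono)
    fix d
    have tri: "norm (p - (q1 + q2) + (t1 + t2)) \<le> norm p + norm q1 + norm q2 + norm t1 + norm t2" for p q1 q2 t1 t2 :: complex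
      by (smt (verit) norm_triangle_ineq norm_triangle_ineq4)
    show "norm (S_ap N \<alpha> b d) \<le> norm (?B {1..2*N} (mu_low U) ?ln d) + norm (?B ?I ?c2 ?one d)
      + norm (?B {1..2*N} \<xi>2 ?one d) + norm (?B {1..2*N} \<xi>3 (vm_high U) d) + norm (?B {1..2*N} v3 \<eta>3 d)"
      unfolding S_ap_vaughan[OF N0 UN] split2 split3 by (rule tri)
  qed
  also have "\<dots> \<le> 1 * L * (37 * x * L ^ 12 / r) + L * L * (37 * x * L ^ 12 / r) + 18 * x * L ^ 14 / sqrt r
      + 18 * x * L ^ 14 / sqrt r + 18 * x * L ^ 14 / sqrt r"
    unfolding sum.distrib by (intro add_mono T1 T2a T2b T3a T3b)
  also have "\<dots> \<le> 37 * (x * L ^ 14 / sqrt r) + 37 * (x * L ^ 14 / sqrt r) + 54 * (x * L ^ 14 / sqrt r)"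
  proof -
    have rs: "sqrt r \<le> r" using r by (intro real_le_lsqrt) (auto simp: power2_eq_square)
    have "x * L ^ 13 / r \<le> x * L ^ 14 / sqrt r"
      using rs r x_ge_2 L_ge_2 L_pow_mono[of 13 14] by (intro frac_le mult_left_mono) auto
    moreover have "x * L ^ 14 / r \<le> x * L ^ 14 / sqrt r"
      using rs r x_ge_2 L_ge_2 by (intro divide_left_mono) auto
    moreover have "1 * L * (37 * x * L ^ 12 / r) = 37 * (x * L ^ 13 / r)" by (simp add: eval_nat_numeral)
    moreover have "L * L * (37 * x * L ^ 12 / r) = 37 * (x * L ^ 14 / r)" by (simp add: eval_nat_numeral)
    moreover have "18 * x * L ^ 14 / sqrt r = 18 * (x * L ^ 14 / sqrt r)" by simp
    ultimately show ?thesis by linarith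
  qed
  also have "\<dots> = 128 * x * L ^ 14 / sqrt r" by simp
  finally show ?thesis .
qed

end

section \<open>Conclusion\<close>

lemma sieve_sum_le:
  fixes N :: nat and \<alpha> \<epsilon> C \<rho> :: real and a q b :: int and D :: "nat set"
  assumes \<epsilon>: "0 < \<epsilon>" and C: "10 \<le> C" and \<rho>: "0 \<le> \<rho>" "\<rho> \<le> 1/2"
    and N: "3 \<le> ln (real N)" "2 * ln (real N) powr (960 * C) \<le> real N powr \<epsilon>"
    and co: "coprime a q" and ql: "ln (real N) powr (1000 * C) \<le> real_of_int q"
    and qu: "real_of_int q \<le> real N * ln (real N) powr (- 1000 * C)"
    and approx: "\<bar>\<alpha> - real_of_int a / real_of_int q\<bar> \<le> 1 / (real_of_int q)^2"
    and D: "\<And>d. d \<in> D \<Longrightarrow> \<exists>p ps. d = p * prod_list ps \<and> 0 < p \<and> real p \<le> real N powr (1/3 - \<epsilon>) \<and>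
      (\<forall>q\<in>set ps. 0 < q \<and> real q \<le> real N powr (1 - 2 * \<rho>))"
  shows "sieve_sum D (\<rho> - \<epsilon>) N \<alpha> b \<le> (512 * 5 ^ 14) * real N / ln (real N) powr C"
proof -
  define l where "l = ln (real N)"
  have l: "3 \<le> l" using N by (simp add: l_def)
  have N0: "0 < real N" using l by (cases "N = 0") (auto simp: l_def)
  \<comment> \<open>N >= 8 ensures \<open>2 \<le> U\<close> for U = N^(1/3).\<close>
  have N8: "8 \<le> real N"
  proof -
    have "(2::real) ^ 3 \<le> exp 1 ^ 3" using exp_ge_add_one_self[of 1] by (intro power_mono) auto
    also have "\<dots> = exp 3" by (simp flip: exp_of_nat_mult)
    also have "\<dots> \<le> exp l" using l by simp
    finally show ?thesis using N0 by (simp add: l_def)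
  qed
  \<comment> \<open>r^24 = l^(960 C) stays below the l^(1000 C) in the range of q, while sqrt r =
    l^(20 C) outweighs L^14 and still leaves l^C.\<close>
  define r where "r = l powr (40 * C)"
  have r24: "r ^ 24 = l powr (960 * C)"
    using l unfolding r_def by (simp add: powr_powr flip: powr_realpow)
  have r24_le: "r ^ 24 \<le> l powr (1000 * C)" unfolding r24 using l C by (intro powr_mono) auto
  define L where "L = 2 + ln (4 * real N)"
  have q0: "0 < q"
  proof -
    have "0 < l powr (1000 * C)" using l by simp
    then have "0 < real_of_int q" using ql unfolding l_def by linarith
    then show ?thesis by simp
  qed
  interpret minor_arc \<alpha> a "nat q" "4 * real N" r L
  proof
    show "coprime a (int (nat q))" using co q0 by simp
    show "\<bar>\<alpha> - real_of_int a / real (nat q)\<bar> \<le> 1 / (real (nat q))\<^sup>2" using approx q0 by simp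
    have "l powr 1 \<le> l powr (40 * C)" using l C by (intro powr_mono) auto
    then show "2 \<le> r" using l by (simp add: r_def)
    show "r ^ 24 \<le> real (nat q)" using r24_le ql q0 by (simp add: l_def)
    have "real_of_int q \<le> real N / l powr (1000 * C)" using qu by (simp add: l_def powr_minus divide_inverse)
    also have "\<dots> \<le> real N / r ^ 24" using r24_le l by (intro divide_left_mono) (auto simp: r24)
    also have "\<dots> \<le> 4 * real N / r ^ 24" using l by (intro divide_right_mono) (auto simp: r24)
    finally show "real (nat q) \<le> 4 * real N / r ^ 24" using q0 by simp
    show "L = 2 + ln (4 * real N)" by (rule L_def)
  qed
  \<comment> \<open>\<open>U\<close> serves twice: as parameter of Vaughan's identity it ends the
    type II range at 2 N / U, and as \<open>c\<close> in \<open>exists_balanced_divisor\<close> it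
    matches the bound N^(1/3) / P for the exceptional prime.\<close>
  define U where "U = real N powr (1/3)"
  define P where "P = real N powr \<epsilon>"
  define Ds where "Ds = {d\<in>D. 1 \<le> d \<and> real d \<le> real N powr (\<rho> - \<epsilon>) \<and> coprime (int d) b}"
  have P: "2 * r ^ 24 \<le> P" using N unfolding r24 P_def l_def by simp
  have P0: "0 < P" using N0 by (simp add: P_def)
  have dP: "real d \<le> real N powr \<rho> / P" if "d \<in> Ds" for d
    using that unfolding Ds_def P_def by (simp add: powr_diff)
  have finDs: "finite Ds"
    by (rule finite_subset[of _ "{..nat \<lfloor>real N powr (\<rho> - \<epsilon>)\<rfloor>}"]) (auto simp: Ds_def intro: le_nat_floor)
  have half: "real N powr \<rho> \<le> sqrt (real N)"
    unfolding powr_half_sqrt[symmetric, OF less_imp_le[OF N0]] using \<rho> N8 by (intro powr_mono) auto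
  have sum_Ds: "(\<Sum>d\<in>Ds. norm (S_ap N \<alpha> b d)) \<le> 128 * (4 * real N) * L ^ 14 / sqrt r"
  proof (rule S_ap_sum_le[where U = U])
    show "0 < d \<and> coprime (int d) b" if "d \<in> Ds" for d using that by (simp add: Ds_def Suc_le_eq)
    have "8 powr (1/3) \<le> U" unfolding U_def using N8 by (intro powr_mono2) auto
    moreover have "(8::real) powr (1/3) = 2"
    proof -
      have "(8::real) powr (1/3) = (2 powr 3) powr (1/3)" by simp
      also have "\<dots> = 2" unfolding powr_powr by simp
      finally show ?thesis .
    qed
    ultimately show "2 \<le> U" by simp
    have U: "U ^ k = real N powr (k / 3)" for k :: nat
      unfolding U_def using N0 by (simp add: powr_powr flip: powr_realpow)
    show "U ^ 3 \<le> real N" unfolding U using N0 by simp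
    have "real N powr (2/3) \<le> real N powr 1" using N8 by (intro powr_mono) auto
    then show "U\<^sup>2 \<le> real N" unfolding U using N0 by simp
    fix d assume d: "d \<in> Ds"
    have "real d * sqrt (real N) \<le> real N powr \<rho> / P * sqrt (real N)" using dP[OF d] by (intro mult_right_mono) auto
    also have "\<dots> \<le> sqrt (real N) / P * sqrt (real N)" using half P0 by (intro mult_right_mono divide_right_mono) auto
    also have "\<dots> = real N / P" by simp
    also have "\<dots> \<le> real N / r ^ 24" using P r_pow[of 24] by (intro divide_left_mono) auto
    also have "\<dots> \<le> 4 * real N / r ^ 24" using r_pow(2)[of 24] by (intro divide_right_mono) auto
    finally show "real d * sqrt (real N) \<le> 4 * real N / r ^ 24" .
    fix M :: nat assume M: "sqrt (real N) \<le> real M" "real M < 2 * real N / U"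
    obtain p ps where p: "d = p * prod_list ps" "0 < p" "real p \<le> real N powr (1/3 - \<epsilon>)"
      "\<forall>q\<in>set ps. 0 < q \<and> real q \<le> real N powr (1 - 2 * \<rho>)" using D[of d] d by (auto simp: Ds_def)
    have e: "(1 - \<rho>) - \<rho> = 1 - 2 * \<rho>" by simp
    show "\<exists>f. f dvd d \<and> (real d)\<^sup>2 \<le> real f * real M / r ^ 24 \<and> real f \<le> real N / (real M * r ^ 24)"
    proof (rule exists_balanced_divisor[where u = "real N powr \<rho>" and v = "real N powr (1 - \<rho>)" and c = U and P = P])
      show "\<forall>q\<in>set ps. 0 < q \<and> real q \<le> real N powr (1 - \<rho>) / real N powr \<rho>"
        using p(4) unfolding powr_diff[symmetric] e .
      show "real N powr \<rho> * real N powr (1 - \<rho>) = real N" using N0 by (simp flip: powr_add)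
      show "1 \<le> real N powr \<rho>" using N8 \<rho> by (intro ge_one_powr_ge_zero) auto
      show "real N powr \<rho> \<le> real N powr (1 - \<rho>)" using N8 \<rho> by (intro powr_mono) auto
      show "real p \<le> U / P" using p(3) by (simp add: U_def P_def powr_diff)
    qed (use p dP[OF d] M half N0 P r_pow(1)[of 24] in \<open>auto simp: U_def\<close>)
  qed (use finDs in auto)
  have "sieve_sum D (\<rho> - \<epsilon>) N \<alpha> b = (\<Sum>d\<in>Ds. norm (of_int (sieve_weight D d) * S_ap N \<alpha> b d))"
    unfolding sieve_sum_def
  proof (rule sum.mono_neutral_right)
    show "finite {d. 1 \<le> d \<and> real d \<le> real N powr (\<rho> - \<epsilon>) \<and> coprime (int d) b}"
      by (rule finite_subset[of _ "{..nat \<lfloor>real N powr (\<rho> - \<epsilon>)\<rfloor>}"]) (auto intro: le_nat_floor)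
  qed (auto simp: Ds_def sieve_weight_def)
  also have "\<dots> \<le> (\<Sum>d\<in>Ds. norm (S_ap N \<alpha> b d))"
  proof (rule sum_mono)
    fix d
    have "\<bar>sieve_weight D d\<bar> \<le> 1" using abs_moebius_mu_le[of d] by (simp add: sieve_weight_def)
    then have "\<bar>real_of_int (sieve_weight D d)\<bar> \<le> 1" by linarith
    then have "\<bar>real_of_int (sieve_weight D d)\<bar> * norm (S_ap N \<alpha> b d) \<le> 1 * norm (S_ap N \<alpha> b d)"
      by (intro mult_right_mono) auto
    then show "norm (of_int (sieve_weight D d) * S_ap N \<alpha> b d) \<le> norm (S_ap N \<alpha> b d)" by (simp add: norm_mult)
  qed
  also note sum_Ds
  also have "128 * (4 * real N) * L ^ 14 / sqrt r \<le> 512 * real N * ((5 ^ 14) / l powr C)"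
  proof -
    have "ln (4 * real N) = 2 * ln 2 + l"
    proof -
      have "ln (4::real) = 2 * ln 2" using ln_realpow[of 2 2] by simp
      then show ?thesis using N0 by (simp add: ln_mult l_def)
    qed
    \<comment> \<open>2 + 2 ln 2 + l <= 4 + l <= 5 l, as l >= 3.\<close>
    then have "L \<le> 5 * l" unfolding L_def using l ln_2_less_1 by simp
    then have "L ^ 14 \<le> (5 * l) ^ 14" using L_ge_2 by (intro power_mono) auto
    also have "\<dots> = 5 ^ 14 * l powr 14" using l by (simp add: power_mult_distrib powr_numeral)
    \<comment> \<open>The exponent 14 is at most 19 C.\<close>
    also have "\<dots> \<le> 5 ^ 14 * l powr (20 * C - C)" using l C by (intro mult_left_mono powr_mono) auto
    also have "\<dots> = 5 ^ 14 * (l powr (20 * C) / l powr C)" by (simp only: powr_diff)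
    also have "l powr (20 * C) = sqrt r"
      using l unfolding r_def powr_half_sqrt[symmetric, OF powr_ge_zero] by (simp add: powr_powr)
    finally have "L ^ 14 / sqrt r \<le> 5 ^ 14 * (sqrt r / l powr C) / sqrt r"
      using r by (intro divide_right_mono) auto
    also have "\<dots> = 5 ^ 14 / l powr C" using r by simp
    finally have "L ^ 14 / sqrt r \<le> 5 ^ 14 / l powr C" .
    then have "512 * real N * (L ^ 14 / sqrt r) \<le> 512 * real N * (5 ^ 14 / l powr C)" by (intro mult_left_mono) auto
    then show ?thesis by simp
  qed
  finally show ?thesis by (simp add: l_def mult_ac)
qed

theorem theorem5:
  "\<exists>\<epsilon>0>0. \<forall>\<epsilon>. 0 < \<epsilon> \<and> \<epsilon> < \<epsilon>0 \<longrightarrow>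
     (\<forall>C::real. C \<ge> 10 \<longrightarrow>
       (\<exists>K::real. \<exists>N0::nat. \<forall>N::nat. N \<ge> N0 \<longrightarrow>
         (\<forall>(zp::real) (zm::real) (\<alpha>::real) (a::int) (q::int) (b::int).
            zp \<le> real N powr (1/2) \<longrightarrow>
            zm \<le> real N powr (1/3 - \<epsilon>) \<longrightarrow>
            coprime a q \<longrightarrow>
            ln (real N) powr (1000 * C) \<le> real_of_int q \<longrightarrow>
            real_of_int q \<le> real N * ln (real N) powr (- 1000 * C) \<longrightarrow>
            \<bar>\<alpha> - real_of_int a / real_of_int q\<bar> \<le> 1 / (real_of_int q)^2 \<longrightarrow>
            b \<noteq> 0 \<longrightarrow>
              sieve_sum (D_plus \<epsilon> (real N) zp) (2/5 - \<epsilon>) N \<alpha> b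
                 \<le> K * real N / ln (real N) powr C
            \<and> sieve_sum (D_minus \<epsilon> (real N) zm) (3/7 - \<epsilon>) N \<alpha> b
                 \<le> K * real N / ln (real N) powr C)))"
\<comment> \<open>For eps <= 1/3 one has N^(1/3 - eps) >= 1, so that 1 is an admissible exceptional
  factor.\<close>
proof (rule exI[of _ "1/3"], intro conjI allI impI, goal_cases)
  case (2 \<epsilon> C)
  then have \<epsilon>: "0 < \<epsilon> \<and> \<epsilon> < 1/3" and C: "10 \<le> C" by simp_all
  have "eventually (\<lambda>N. 3 \<le> ln (real N) \<and> 2 * ln (real N) powr (960 * C) \<le> real N powr \<epsilon>) sequentially"
  proof (rule eventually_conj)
    show "eventually (\<lambda>N. 3 \<le> ln (real N)) sequentially" by real_asymp
    have "0 < \<epsilon>" using \<epsilon> by simp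
    then show "eventually (\<lambda>N. 2 * ln (real N) powr (960 * C) \<le> real N powr \<epsilon>) sequentially" by real_asymp
  qed
  then obtain N0 where N0: "\<And>N. N0 \<le> N \<Longrightarrow> 3 \<le> ln (real N) \<and> 2 * ln (real N) powr (960 * C) \<le> real N powr \<epsilon>"
    unfolding eventually_sequentially by blast
  have N_ge_1: "1 \<le> real N" if "3 \<le> ln (real N)" for N :: nat
    using that by (cases "N = 0") auto
  show ?case
  proof (rule exI[of _ "512 * 5 ^ 14"], rule exI[of _ N0], intro allI impI conjI)
    fix N :: nat and zp zm \<alpha> :: real and a q b :: int
    assume N: "N0 \<le> N" and zm: "zm \<le> real N powr (1/3 - \<epsilon>)" and co: "coprime a q"
      and q: "ln (real N) powr (1000 * C) \<le> real_of_int q"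
        "real_of_int q \<le> real N * ln (real N) powr (- 1000 * C)"
        "\<bar>\<alpha> - real_of_int a / real_of_int q\<bar> \<le> 1 / (real_of_int q)^2"
    note N' = conjunct1[OF N0[OF N]] conjunct2[OF N0[OF N]]
    show "sieve_sum (D_plus \<epsilon> (real N) zp) (2/5 - \<epsilon>) N \<alpha> b \<le> 512 * 5 ^ 14 * real N / ln (real N) powr C"
    proof (rule sieve_sum_le[OF _ C _ _ N' co q])
      show "\<exists>p ps. d = p * prod_list ps \<and> 0 < p \<and> real p \<le> real N powr (1/3 - \<epsilon>) \<and>
        (\<forall>q\<in>set ps. 0 < q \<and> real q \<le> real N powr (1 - 2 * (2/5)))" if "d \<in> D_plus \<epsilon> (real N) zp" for d
        using that \<epsilon> N_ge_1[OF N'(1)] unfolding D_plus_def by (intro sieve_support_upper_factor) auto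
    qed (use \<epsilon> in auto)
    show "sieve_sum (D_minus \<epsilon> (real N) zm) (3/7 - \<epsilon>) N \<alpha> b \<le> 512 * 5 ^ 14 * real N / ln (real N) powr C"
    proof (rule sieve_sum_le[OF _ C _ _ N' co q])
      show "\<exists>p ps. d = p * prod_list ps \<and> 0 < p \<and> real p \<le> real N powr (1/3 - \<epsilon>) \<and>
        (\<forall>q\<in>set ps. 0 < q \<and> real q \<le> real N powr (1 - 2 * (3/7)))" if "d \<in> D_minus \<epsilon> (real N) zm" for d
        using that \<epsilon> N_ge_1[OF N'(1)] zm unfolding D_minus_def by (intro sieve_support_lower_factor) auto
    qed (use \<epsilon> in auto)
  qed
qed simp

end
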